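(* Let $g$ be a non-negative operator monotone decreasing function on $(0,\infty)$, let $p,q>1$ with $\frac1p+\frac1q=1$, and let $A,B$ be positive definite operators on a Hilbert space $\mathcal{H}$ such that $0 < sA^p\le B^q\le tA^p$ for some constants $s,t>0$. Put $R=\max\{\frac1p,\frac1q\}$ and $K(x)=\frac{(x+1)^2}{4x}$ for $x>0$. Then $$g\big(A^p\sharp_{1/q}B^q\big)\le \max\{K(s)^R,K(t)^R\}\,\big(g(A^p)\sharp_{1/q}g(B^q)\big),$$ and for all $\xi\in\mathcal{H}$ $$\big\langle g(A^p\sharp_{1/q}B^q)\xi,\xi\big\rangle\le \max\{K(s)^R,K(t)^R\}\,\langle g(A^p)\xi,\xi\rangle^{1/p}\,\langle g(B^q)\xi,\xi\rangle^{1/q}.$$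
   Context: Operators are bounded linear operators on a Hilbert space. For self-adjoint $A,B$, $A\le B$ means $B-A$ is positive, i.e. $\langle (B-A)x,x\rangle\ge 0$ for all $x$. $A>0$ (positive definite) means $A$ is positive and invertible. Functions and powers of positive definite operators are taken via the continuous functional calculus. A continuous function $g:(0,\infty)\to\mathbb{R}$ is operator monotone decreasing if $A\ge B$ implies $g(A)\le g(B)$ for all positive definite operators $A,B$ (on an arbitrary Hilbert space). For positive definite $A,B$ and $\alpha\in[0,1]$ the $\alpha$-geometric mean is $A\sharp_\alpha B=A^{1/2}(A^{-1/2}BA^{-1/2})^{\alpha}A^{1/2}$, with the convention $0\sharp_\alpha 0=0$ (relevant only if $g\equiv 0$). *)

theory Defs
  imports "HOL-Analysis.Analysis"
begin

section \<open>Complex Hilbert spaces\<close>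

text \<open>The inner product is linear in the first argument. The real inner product of the superclass is
  its real part, so norm and topology are those induced by the complex inner product.\<close>

class complex_hilbert_space = real_inner + complete_space +
  fixes scaleC :: "complex \<Rightarrow> 'a \<Rightarrow> 'a"  (infixr "*\<^sub>C" 75)
    and cinner :: "'a \<Rightarrow> 'a \<Rightarrow> complex"
  assumes scaleC_add_right: "c *\<^sub>C (x + y) = c *\<^sub>C x + c *\<^sub>C y"
    and scaleC_add_left: "(c + d) *\<^sub>C x = c *\<^sub>C x + d *\<^sub>C x"
    and scaleC_scaleC: "c *\<^sub>C (d *\<^sub>C x) = (c * d) *\<^sub>C x"
    and scaleC_of_real: "complex_of_real r *\<^sub>C x = r *\<^sub>R x"
    and cinner_add_left: "cinner (x + y) z = cinner x z + cinner y z"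
    and cinner_scaleC_left: "cinner (c *\<^sub>C x) y = c * cinner x y"
    and cinner_commute: "cinner x y = cnj (cinner y x)"
    and Re_cinner: "Re (cinner x y) = inner x y"

section \<open>The Hilbert space of square-summable sequences\<close>

typedef ell2 = "{f :: nat \<Rightarrow> complex. summable (\<lambda>n. (cmod (f n))\<^sup>2)}"
  morphisms ell2_nth Abs_ell2
  by (rule exI[of _ "\<lambda>_. 0"]) simp

setup_lifting type_definition_ell2

lemma ell2_summable: "summable (\<lambda>n. (cmod (ell2_nth x n))\<^sup>2)"
  using ell2_nth[of x] by simp

lemma ell2_eqI: "(\<And>n. ell2_nth x n = ell2_nth y n) \<Longrightarrow> x = y"
  by (metis ell2_nth_inject ext)

lemma square_summable_add:
  assumes "summable (\<lambda>n. (cmod (f n))\<^sup>2)" "summable (\<lambda>n. (cmod (g n))\<^sup>2)"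
  shows "summable (\<lambda>n. (cmod (f n + g n))\<^sup>2)"
proof (rule summable_comparison_test'[where N = 0])
  show "summable (\<lambda>n. 2 * (cmod (f n))\<^sup>2 + 2 * (cmod (g n))\<^sup>2)"
    using assms by (intro summable_add summable_mult)
  fix n
  have "(cmod (f n + g n))\<^sup>2 \<le> (cmod (f n) + cmod (g n))\<^sup>2"
    by (intro power_mono norm_triangle_ineq) simp
  also have "\<dots> \<le> 2 * (cmod (f n))\<^sup>2 + 2 * (cmod (g n))\<^sup>2"
    using zero_le_power2[of "cmod (f n) - cmod (g n)"]
    by (simp add: power2_diff power2_sum)
  finally show "norm ((cmod (f n + g n))\<^sup>2) \<le> 2 * (cmod (f n))\<^sup>2 + 2 * (cmod (g n))\<^sup>2"
    by simp
qed

lemma square_summable_scale: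
  assumes "summable (\<lambda>n. (cmod (f n))\<^sup>2)"
  shows "summable (\<lambda>n. (cmod (c * f n))\<^sup>2)"
  using summable_mult[OF assms, of "(cmod c)\<^sup>2"] by (simp add: norm_mult power_mult_distrib)

lemma square_summable_prod:
  fixes f g :: "nat \<Rightarrow> complex"
  assumes "summable (\<lambda>n. (cmod (f n))\<^sup>2)" "summable (\<lambda>n. (cmod (g n))\<^sup>2)"
  shows "summable (\<lambda>n. f n * cnj (g n))"
proof (rule summable_comparison_test'[where N = 0])
  show "summable (\<lambda>n. (cmod (f n))\<^sup>2 + (cmod (g n))\<^sup>2)"
    using assms by (intro summable_add)
  fix n
  have "cmod (f n) * cmod (g n) \<le> (cmod (f n))\<^sup>2 + (cmod (g n))\<^sup>2"
  proof -
    have "0 \<le> cmod (f n) * cmod (g n)" by simp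
    moreover have "0 \<le> (cmod (f n))\<^sup>2 + (cmod (g n))\<^sup>2 - 2 * (cmod (f n) * cmod (g n))"
      using zero_le_power2[of "cmod (f n) - cmod (g n)"] by (simp add: power2_diff)
    ultimately show ?thesis by linarith
  qed
  then show "norm (f n * cnj (g n)) \<le> (cmod (f n))\<^sup>2 + (cmod (g n))\<^sup>2"
    by (simp add: norm_mult)
qed

instantiation ell2 :: real_vector
begin
lift_definition zero_ell2 :: ell2 is "\<lambda>_. 0" by simp
lift_definition plus_ell2 :: "ell2 \<Rightarrow> ell2 \<Rightarrow> ell2" is "\<lambda>f g n. f n + g n"
  by (rule square_summable_add)
lift_definition uminus_ell2 :: "ell2 \<Rightarrow> ell2" is "\<lambda>f n. - f n" by simp
lift_definition minus_ell2 :: "ell2 \<Rightarrow> ell2 \<Rightarrow> ell2" is "\<lambda>f g n. f n - g n"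
proof -
  fix f g :: "nat \<Rightarrow> complex"
  assume "summable (\<lambda>n. (cmod (f n))\<^sup>2)" "summable (\<lambda>n. (cmod (g n))\<^sup>2)"
  then show "summable (\<lambda>n. (cmod (f n - g n))\<^sup>2)"
    using square_summable_add[of f "\<lambda>n. - g n"] by simp
qed
lift_definition scaleR_ell2 :: "real \<Rightarrow> ell2 \<Rightarrow> ell2" is "\<lambda>r f n. complex_of_real r * f n"
  by (rule square_summable_scale)
instance
  by standard (transfer; simp add: algebra_simps)+
end

lemma ell2_nth_simps:
  "ell2_nth 0 n = 0"
  "ell2_nth (x + y) n = ell2_nth x n + ell2_nth y n"
  "ell2_nth (x - y) n = ell2_nth x n - ell2_nth y n"
  "ell2_nth (r *\<^sub>R x) n = complex_of_real r * ell2_nth x n"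
  by (transfer; simp)+

lemma Re_mult_cnj_self: "Re (z * cnj z) = (cmod z)\<^sup>2"
  by (metis Re_complex_of_real complex_norm_square)

lemma ell2_summable_prod: "summable (\<lambda>n. ell2_nth x n * cnj (ell2_nth y n))"
  by (intro square_summable_prod ell2_summable)

instantiation ell2 :: real_inner
begin
definition inner_ell2 :: "ell2 \<Rightarrow> ell2 \<Rightarrow> real" where
  "inner_ell2 x y = Re (\<Sum>n. ell2_nth x n * cnj (ell2_nth y n))"
definition norm_ell2 :: "ell2 \<Rightarrow> real" where
  "norm_ell2 x = sqrt (inner x x)"
definition dist_ell2 :: "ell2 \<Rightarrow> ell2 \<Rightarrow> real" where
  "dist_ell2 x y = norm (x - y)"
definition sgn_ell2 :: "ell2 \<Rightarrow> ell2" where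
  "sgn_ell2 x = x /\<^sub>R norm x"
definition uniformity_ell2 :: "(ell2 \<times> ell2) filter" where
  "uniformity_ell2 = (INF e\<in>{0<..}. principal {(x, y). dist x y < e})"
definition open_ell2 :: "ell2 set \<Rightarrow> bool" where
  "open_ell2 U = (\<forall>x\<in>U. \<forall>\<^sub>F (x', y) in uniformity. x' = x \<longrightarrow> y \<in> U)"

instance
proof
  fix x y z :: ell2 and r :: real and U :: "ell2 set"
  have inner_alt: "inner x y = (\<Sum>n. Re (ell2_nth x n * cnj (ell2_nth y n)))" for x y :: ell2
    unfolding inner_ell2_def by (intro Re_suminf ell2_summable_prod)
  have summ: "summable (\<lambda>n. Re (ell2_nth x n * cnj (ell2_nth y n)))" for x y :: ell2
    by (intro summable_Re ell2_summable_prod)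
  have inner_self: "inner x x = (\<Sum>n. (cmod (ell2_nth x n))\<^sup>2)" for x :: ell2
    unfolding inner_alt Re_mult_cnj_self ..
  show "dist x y = norm (x - y)" by (rule dist_ell2_def)
  show "sgn x = x /\<^sub>R norm x" by (rule sgn_ell2_def)
  show "uniformity = (INF e\<in>{0<..}. principal {(x, y :: ell2). dist x y < e})"
    by (rule uniformity_ell2_def)
  show "open U = (\<forall>x\<in>U. \<forall>\<^sub>F (x', y) in uniformity. x' = x \<longrightarrow> y \<in> U)"
    by (rule open_ell2_def)
  show "inner x y = inner y x"
    unfolding inner_alt by (simp add: mult.commute)
  show "inner (x + y) z = inner x z + inner y z"
    unfolding inner_alt by (subst suminf_add[OF summ summ]) (simp add: ell2_nth_simps algebra_simps)
  show "inner (r *\<^sub>R x) y = r * inner x y"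
    unfolding inner_alt by (subst suminf_mult[OF summ, symmetric]) (simp add: ell2_nth_simps algebra_simps)
  show "0 \<le> inner x x"
    unfolding inner_self by (intro suminf_nonneg ell2_summable) simp
  show "(inner x x = 0) = (x = 0)"
    unfolding inner_self using ell2_summable[of x]
    by (subst suminf_eq_zero_iff) (auto intro!: ell2_eqI simp: ell2_nth_simps)
  show "norm x = sqrt (inner x x)" by (rule norm_ell2_def)
qed
end

lemma ell2_norm_sums: "(\<lambda>n. (cmod (ell2_nth x n))\<^sup>2) sums (norm x)\<^sup>2"
proof -
  have "(norm x)\<^sup>2 = (\<Sum>n. (cmod (ell2_nth x n))\<^sup>2)"
    unfolding power2_norm_eq_inner inner_ell2_def Re_suminf[OF ell2_summable_prod] Re_mult_cnj_self ..
  then show ?thesis using ell2_summable[of x] by (simp add: summable_sums)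
qed

lemma ell2_sum_le_norm: "(\<Sum>n<N. (cmod (ell2_nth x n))\<^sup>2) \<le> (norm x)\<^sup>2"
  using sum_le_suminf[of "\<lambda>n. (cmod (ell2_nth x n))\<^sup>2" "{..<N}"] ell2_norm_sums[of x]
  by (simp add: sums_iff)

lemma ell2_nth_le_norm: "cmod (ell2_nth x n) \<le> norm x"
proof (rule power2_le_imp_le)
  have "(cmod (ell2_nth x n))\<^sup>2 \<le> (\<Sum>k<Suc n. (cmod (ell2_nth x k))\<^sup>2)"
    by (simp add: sum_nonneg)
  also have "\<dots> \<le> (norm x)\<^sup>2" by (rule ell2_sum_le_norm)
  finally show "(cmod (ell2_nth x n))\<^sup>2 \<le> (norm x)\<^sup>2" .
qed simp

instance ell2 :: complete_space
proof
  fix X :: "nat \<Rightarrow> ell2"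
  assume X: "Cauchy X"
  have "Cauchy (\<lambda>k. ell2_nth (X k) n)" for n
  proof (rule metric_CauchyI)
    fix e :: real assume "0 < e"
    with X obtain M where M: "\<forall>i\<ge>M. \<forall>j\<ge>M. dist (X i) (X j) < e"
      unfolding Cauchy_def by blast
    have "dist (ell2_nth (X i) n) (ell2_nth (X j) n) < e" if "i \<ge> M" "j \<ge> M" for i j
      using ell2_nth_le_norm[of "X i - X j" n] M that
      by (fastforce simp: dist_norm ell2_nth_simps)
    then show "\<exists>M. \<forall>i\<ge>M. \<forall>j\<ge>M. dist (ell2_nth (X i) n) (ell2_nth (X j) n) < e" by blast
  qed
  then have "\<exists>l. (\<lambda>k. ell2_nth (X k) n) \<longlonglongrightarrow> l" for n
    using Cauchy_convergent_iff convergent_def by blast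
  then obtain L where L: "\<And>n. (\<lambda>k. ell2_nth (X k) n) \<longlonglongrightarrow> L n" by metis
  have bound: "(\<Sum>n<N. (cmod (ell2_nth (X i) n - L n))\<^sup>2) \<le> e\<^sup>2"
    if "\<forall>j\<ge>M. dist (X i) (X j) < e" for N i M e
  proof (rule LIMSEQ_le_const2)
    show "(\<lambda>j. \<Sum>n<N. (cmod (ell2_nth (X i) n - ell2_nth (X j) n))\<^sup>2)
        \<longlonglongrightarrow> (\<Sum>n<N. (cmod (ell2_nth (X i) n - L n))\<^sup>2)"
      by (intro tendsto_intros L)
    have "(\<Sum>n<N. (cmod (ell2_nth (X i) n - ell2_nth (X j) n))\<^sup>2) \<le> e\<^sup>2" if "j \<ge> M" for j
    proof -
      have "norm (X i - X j) \<le> e"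
        using \<open>\<forall>j\<ge>M. dist (X i) (X j) < e\<close> that by (auto simp: dist_norm less_imp_le)
      then have "(norm (X i - X j))\<^sup>2 \<le> e\<^sup>2" by (intro power_mono) auto
      then show ?thesis
        using ell2_sum_le_norm[of "X i - X j" N] by (simp add: ell2_nth_simps)
    qed
    then show "\<exists>M. \<forall>j\<ge>M. (\<Sum>n<N. (cmod (ell2_nth (X i) n - ell2_nth (X j) n))\<^sup>2) \<le> e\<^sup>2"
      by blast
  qed
  have diff_summable: "summable (\<lambda>n. (cmod (ell2_nth (X i) n - L n))\<^sup>2)"
    if "\<forall>j\<ge>M. dist (X i) (X j) < e" for i M e
    by (rule summableI_nonneg_bounded[where x = "e\<^sup>2"]) (use bound[OF that] in auto)
  obtain M1 where M1: "\<forall>i\<ge>M1. \<forall>j\<ge>M1. dist (X i) (X j) < 1"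
    using X unfolding Cauchy_def by (meson zero_less_one)
  have "summable (\<lambda>n. (cmod (ell2_nth (X M1) n + - 1 * (ell2_nth (X M1) n - L n)))\<^sup>2)"
    by (intro square_summable_add square_summable_scale ell2_summable
        diff_summable[where M = M1 and e = 1]) (use M1 in auto)
  then have "summable (\<lambda>n. (cmod (L n))\<^sup>2)" by simp
  then obtain l where l: "ell2_nth l = L"
    using Abs_ell2_inverse[of L] by blast
  have "X \<longlonglongrightarrow> l"
  proof (rule metric_LIMSEQ_I)
    fix e :: real assume "0 < e"
    then obtain M where M: "\<forall>i\<ge>M. \<forall>j\<ge>M. dist (X i) (X j) < e / 2"
      using X unfolding Cauchy_def by (meson half_gt_zero)
    have "dist (X i) l < e" if "i \<ge> M" for i
    proof -
      have close: "\<forall>j\<ge>M. dist (X i) (X j) < e / 2" using M that by blast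
      have "(norm (X i - l))\<^sup>2 \<le> (e / 2)\<^sup>2"
        by (rule LIMSEQ_le_const2[OF ell2_norm_sums[unfolded sums_def]])
          (use bound[OF close] in \<open>auto simp: ell2_nth_simps l\<close>)
      then have "norm (X i - l) \<le> e / 2"
        by (rule power2_le_imp_le) (use \<open>0 < e\<close> in simp)
      then show ?thesis using \<open>0 < e\<close> by (simp add: dist_norm)
    qed
    then show "\<exists>M. \<forall>i\<ge>M. dist (X i) l < e" by blast
  qed
  then show "convergent X" by (auto simp: convergent_def)
qed

instantiation ell2 :: complex_hilbert_space
begin
lift_definition scaleC_ell2 :: "complex \<Rightarrow> ell2 \<Rightarrow> ell2" is "\<lambda>c f n. c * f n"
  by (rule square_summable_scale)
definition cinner_ell2 :: "ell2 \<Rightarrow> ell2 \<Rightarrow> complex" where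
  "cinner_ell2 x y = (\<Sum>n. ell2_nth x n * cnj (ell2_nth y n))"

instance
proof
  fix c d :: complex and r :: real and x y z :: ell2
  have nth_scaleC: "ell2_nth (c *\<^sub>C x) n = c * ell2_nth x n" for c x n
    by transfer simp
  show "c *\<^sub>C (x + y) = c *\<^sub>C x + c *\<^sub>C y" "(c + d) *\<^sub>C x = c *\<^sub>C x + d *\<^sub>C x"
    "c *\<^sub>C d *\<^sub>C x = (c * d) *\<^sub>C x" "complex_of_real r *\<^sub>C x = r *\<^sub>R x"
    by (auto intro!: ell2_eqI simp: nth_scaleC ell2_nth_simps algebra_simps)
  show "cinner (x + y) z = cinner x z + cinner y z"
    unfolding cinner_ell2_def ell2_nth_simps distrib_right
    by (intro suminf_add[symmetric] ell2_summable_prod)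
  show "cinner (c *\<^sub>C x) y = c * cinner x y"
    unfolding cinner_ell2_def nth_scaleC mult.assoc by (intro suminf_mult ell2_summable_prod)
  have "(\<lambda>n. cnj (ell2_nth y n * cnj (ell2_nth x n))) sums cnj (cinner y x)"
    unfolding cinner_ell2_def sums_cnj by (intro summable_sums ell2_summable_prod)
  then show "cinner x y = cnj (cinner y x)"
    unfolding cinner_ell2_def by (simp add: sums_iff mult.commute)
  show "Re (cinner x y) = inner x y"
    unfolding cinner_ell2_def inner_ell2_def ..
qed
end

section \<open>Bounded operators and the continuous functional calculus\<close>

text \<open>The symmetry condition forces the real-linear bounded operator \<open>A\<close> to be complex linear:
  \<open>cinner (A (c *\<^sub>C x)) y = cinner (c *\<^sub>C x) (A y) = c * cinner (A x) y\<close>.\<close>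

definition self_adjoint :: "('h::complex_hilbert_space \<Rightarrow>\<^sub>L 'h) \<Rightarrow> bool" where
  "self_adjoint A \<longleftrightarrow> (\<forall>x y. cinner (A x) y = cinner x (A y))"

text \<open>For self-adjoint \<open>A\<close> the number \<open>cinner (A x) x\<close> is real.\<close>

definition positive_op :: "('h::complex_hilbert_space \<Rightarrow>\<^sub>L 'h) \<Rightarrow> bool" where
  "positive_op A \<longleftrightarrow> self_adjoint A \<and> (\<forall>x. 0 \<le> Re (cinner (A x) x))"

definition op_le :: "('h::complex_hilbert_space \<Rightarrow>\<^sub>L 'h) \<Rightarrow> ('h \<Rightarrow>\<^sub>L 'h) \<Rightarrow> bool"
    (infix "\<preceq>" 50) where
  "A \<preceq> B \<longleftrightarrow> self_adjoint A \<and> self_adjoint B \<and> positive_op (B - A)"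

definition invertible_op :: "('h::complex_hilbert_space \<Rightarrow>\<^sub>L 'h) \<Rightarrow> bool" where
  "invertible_op A \<longleftrightarrow> (\<exists>B. A o\<^sub>L B = id_blinfun \<and> B o\<^sub>L A = id_blinfun)"

definition positive_definite :: "('h::complex_hilbert_space \<Rightarrow>\<^sub>L 'h) \<Rightarrow> bool" where
  "positive_definite A \<longleftrightarrow> positive_op A \<and> invertible_op A"

text \<open>Only used for self-adjoint operators, whose spectrum is real.\<close>

definition op_spectrum :: "('h::complex_hilbert_space \<Rightarrow>\<^sub>L 'h) \<Rightarrow> real set" where
  "op_spectrum A = {r. \<not> invertible_op (A - r *\<^sub>R id_blinfun)}"

definition op_poly :: "real poly \<Rightarrow> ('h::complex_hilbert_space \<Rightarrow>\<^sub>L 'h) \<Rightarrow> ('h \<Rightarrow>\<^sub>L 'h)" where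
  "op_poly P A = (\<Sum>i\<le>degree P. coeff P i *\<^sub>R (((o\<^sub>L) A ^^ i) id_blinfun))"

text \<open>Continuous functional calculus of a self-adjoint operator: for \<open>f\<close> real-valued and continuous on
  the spectrum of \<open>A\<close>, \<open>f(A)\<close> is the norm limit of \<open>P\<^sub>n(A)\<close> for every (equivalently, some) sequence of
  polynomials converging to \<open>f\<close> uniformly on the spectrum.\<close>

definition cfc :: "(real \<Rightarrow> real) \<Rightarrow> ('h::complex_hilbert_space \<Rightarrow>\<^sub>L 'h) \<Rightarrow> ('h \<Rightarrow>\<^sub>L 'h)" where
  "cfc f A = (THE T. \<forall>P :: nat \<Rightarrow> real poly.
     uniform_limit (op_spectrum A) (\<lambda>n. poly (P n)) f sequentially \<longrightarrow>
     (\<lambda>n. op_poly (P n) A) \<longlonglongrightarrow> T)"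

definition op_powr :: "('h::complex_hilbert_space \<Rightarrow>\<^sub>L 'h) \<Rightarrow> real \<Rightarrow> ('h \<Rightarrow>\<^sub>L 'h)" where
  "op_powr A r = cfc (\<lambda>x. x powr r) A"

definition geometric_mean ::
    "real \<Rightarrow> ('h::complex_hilbert_space \<Rightarrow>\<^sub>L 'h) \<Rightarrow> ('h \<Rightarrow>\<^sub>L 'h) \<Rightarrow> ('h \<Rightarrow>\<^sub>L 'h)" where
  "geometric_mean \<alpha> A B =
     (if A = 0 \<and> B = 0 then 0
      else op_powr A (1/2) o\<^sub>L op_powr (op_powr A (-1/2) o\<^sub>L B o\<^sub>L op_powr A (-1/2)) \<alpha>
             o\<^sub>L op_powr A (1/2))"

text \<open>Types cannot be quantified in HOL, so the condition ``for all positive definite operators on an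
  arbitrary Hilbert space'' is imposed on the infinite-dimensional separable space \<^typ>\<open>ell2\<close> only.
  Formally this is implied by the condition on all Hilbert spaces, so a theorem assuming
  it is at least as strong. (By the usual reduction to separable reducing subspaces, which embed
  into \<^typ>\<open>ell2\<close>, the two conditions are equivalent.)\<close>

definition operator_monotone_decreasing :: "(real \<Rightarrow> real) \<Rightarrow> bool" where
  "operator_monotone_decreasing g \<longleftrightarrow> continuous_on {0<..} g \<and>
     (\<forall>A B :: ell2 \<Rightarrow>\<^sub>L ell2. positive_definite A \<and> positive_definite B \<and> B \<preceq> A \<longrightarrow>
        cfc g A \<preceq> cfc g B)"

definition kantorovich :: "real \<Rightarrow> real" where
  "kantorovich x = (x + 1)\<^sup>2 / (4 * x)"

end

theory Submission
  imports Defs "HOL-Computational_Algebra.Fundamental_Theorem_Algebra"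
begin

text \<open>
  Write \<open>X = A\<^sup>p\<close>, \<open>Y = B\<^sup>q\<close> and \<open>\<alpha> = 1/q\<close>, so that \<open>1 - \<alpha> = 1/p\<close>, and let \<open>k\<close> be the constant in the theorem.
  Three facts about means combine.

  First, the scalar reverse Young inequality \<open>(1 - \<alpha>) + \<alpha> x \<le> K(x)\<^sup>R x\<^sup>\<alpha>\<close>
  (\<open>reverse_Young_kantorovich\<close>), together with the fact that \<open>K\<close> attains its maximum over \<open>[s, t]\<close> at an
  endpoint, gives \<open>Z \<le> k (X \<sharp> Y)\<close> for the arithmetic mean \<open>Z = (1 - \<alpha>) X + \<alpha> Y\<close>
  (\<open>arithmetic_le_geometric_mean\<close>). Second, if \<open>g > 0\<close> then \<open>1/g\<close> is operator monotone and therefore operator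
  concave (\<open>reciprocal_operator_concave\<close>); inverting, \<open>g(Z)\<close> is at most the harmonic mean of \<open>g(X)\<close> and
  \<open>g(Y)\<close>, hence at most their geometric mean (\<open>harmonic_le_geometric_mean\<close>). Third, the concavity
  of \<open>1/g\<close> on scalars makes \<open>x g(x)\<close> increasing, so \<open>g(M) \<le> k g(k M)\<close> for \<open>k \<ge> 1\<close>. Hence
  \<open>g(X \<sharp> Y) \<le> k g(k (X \<sharp> Y)) \<le> k g(Z) \<le> k (g(X) \<sharp> g(Y))\<close>. The second inequality of the theorem
  follows from \<open>\<langle>(P \<sharp> Q) \<xi>, \<xi>\<rangle> \<le> \<langle>P \<xi>, \<xi>\<rangle>\<^sup>1\<^sup>-\<^sup>\<alpha> \<langle>Q \<xi>, \<xi>\<rangle>\<^sup>\<alpha>\<close> (\<open>inner_geometric_mean_le\<close>).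
  If \<open>g\<close> has a zero, it vanishes identically and all terms are \<open>0\<close>.

  The operator theory behind this is built up from the definitions. Polynomials of a self-adjoint operator \<open>A\<close>
  satisfy \<open>norm (P(A)) \<le> sup |P|\<close> over the spectrum (\<open>norm_op_poly_le\<close>), which yields the continuous
  functional calculus. Operator monotonicity, assumed on \<^typ>\<open>ell2\<close>, is carried to an
  arbitrary Hilbert space by compressing to finite-dimensional subspaces
  (\<open>operator_monotone_decreasing_transfer\<close>). Operator concavity comes from a \<open>2 \<times> 2\<close> block
  argument on the Hilbert space \<open>H \<times> H\<close> (\<open>operator_monotone_imp_concave\<close>).
\<close>

section \<open>Complex inner products and self-adjoint operators\<close>

instance complex_hilbert_space \<subseteq> banach ..

lemma cinner_add_right: "cinner x (y + z) = cinner x y + cinner x z"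
  by (metis cinner_add_left cinner_commute complex_cnj_add)

lemma cinner_scaleC_right: "cinner x (c *\<^sub>C y) = cnj c * cinner x y"
  by (metis cinner_commute cinner_scaleC_left complex_cnj_mult)

lemma cinner_scaleR_left: "cinner (r *\<^sub>R x) y = of_real r * cinner x y"
  by (metis scaleC_of_real cinner_scaleC_left)

lemma cinner_scaleR_right: "cinner x (r *\<^sub>R y) = of_real r * cinner x y"
  by (metis scaleC_of_real cinner_scaleC_right complex_cnj_complex_of_real)

lemma cinner_minus_left: "cinner (- x) y = - cinner x y"
  using cinner_scaleR_left[of "-1" x y] by simp

lemma cinner_minus_right: "cinner x (- y) = - cinner x y"
  using cinner_scaleR_right[of x "-1" y] by simp

lemma cinner_diff_left: "cinner (x - y) z = cinner x z - cinner y z"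
  using cinner_add_left[of x "-y" z] by (simp add: cinner_minus_left)

lemma cinner_diff_right: "cinner x (y - z) = cinner x y - cinner x z"
  using cinner_add_right[of x y "-z"] by (simp add: cinner_minus_right)

lemma cinner_zero_left [simp]: "cinner 0 y = 0"
  using cinner_scaleR_left[of 0 0 y] by simp

lemma cinner_zero_right [simp]: "cinner x 0 = 0"
  using cinner_scaleR_right[of x 0 0] by simp

lemmas cinner_simps = cinner_add_left cinner_add_right cinner_scaleC_left cinner_scaleC_right
  cinner_scaleR_left cinner_scaleR_right cinner_diff_left cinner_diff_right

lemma Im_cinner: "Im (cinner x y) = - inner (\<i> *\<^sub>C x) y"
  by (simp add: Re_cinner[symmetric] cinner_scaleC_left)

lemma cinner_self: "cinner x x = of_real (inner x x)"
proof (rule complex_eqI)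
  show "Im (cinner x x) = Im (of_real (inner x x))"
    using arg_cong[OF cinner_commute[of x x], of Im] by simp
qed (simp add: Re_cinner)

lemma norm_scaleC: "norm (c *\<^sub>C x) = cmod c * norm x"
proof -
  have "cinner (c *\<^sub>C x) (c *\<^sub>C x) = (c * cnj c) * of_real (inner x x)"
    by (simp only: cinner_scaleC_left cinner_scaleC_right cinner_self[of x] mult_ac)
  also have "\<dots> = of_real ((cmod c)\<^sup>2 * inner x x)"
    unfolding complex_norm_square[symmetric] by (rule of_real_mult[symmetric])
  finally have "inner (c *\<^sub>C x) (c *\<^sub>C x) = (cmod c)\<^sup>2 * inner x x"
    unfolding cinner_self of_real_eq_iff .
  then show ?thesis
    by (simp add: norm_eq_sqrt_inner real_sqrt_mult)
qed

lemma bounded_linear_scaleC: "bounded_linear (scaleC c)"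
proof (rule bounded_linear_intro[where K = "cmod c"])
  show "c *\<^sub>C (r *\<^sub>R x) = r *\<^sub>R (c *\<^sub>C x)" for r x
    by (simp add: scaleC_of_real[symmetric] scaleC_scaleC mult.commute)
qed (simp_all add: scaleC_add_right norm_scaleC mult.commute)

text \<open>Thanks to this splitting the spectral theory below runs with real inner products and real scalars;
  the complex structure enters only through commutation with \<open>\<i>\<close>.\<close>

lemma self_adjoint_iff:
  "self_adjoint A \<longleftrightarrow> (\<forall>x y. inner (A x) y = inner x (A y)) \<and> (\<forall>x. A (\<i> *\<^sub>C x) = \<i> *\<^sub>C A x)"
proof safe
  assume *: "self_adjoint A"
  show "inner (A x) y = inner x (A y)" for x y
    using * by (simp add: self_adjoint_def Re_cinner[symmetric])
  show "A (\<i> *\<^sub>C x) = \<i> *\<^sub>C A x" for x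
  proof -
    have "cinner (A (\<i> *\<^sub>C x)) y = cinner (\<i> *\<^sub>C A x) y" for y
      using * by (simp add: self_adjoint_def cinner_scaleC_left)
    then have "\<forall>y. inner (A (\<i> *\<^sub>C x)) y = inner (\<i> *\<^sub>C A x) y"
      by (simp add: Re_cinner[symmetric])
    then show ?thesis unfolding vector_eq_rdot .
  qed
next
  assume sym: "\<forall>x y. inner (A x) y = inner x (A y)" and i: "\<forall>x. A (\<i> *\<^sub>C x) = \<i> *\<^sub>C A x"
  show "self_adjoint A"
    unfolding self_adjoint_def
  proof (intro allI complex_eqI)
    fix x y
    show "Re (cinner (A x) y) = Re (cinner x (A y))"
      using sym by (simp add: Re_cinner)
    have "inner (\<i> *\<^sub>C A x) y = inner (\<i> *\<^sub>C x) (A y)"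
      using sym i by metis
    then show "Im (cinner (A x) y) = Im (cinner x (A y))"
      by (simp add: Im_cinner)
  qed
qed

lemma self_adjoint_inner: "self_adjoint A \<Longrightarrow> inner (A x) y = inner x (A y)"
  by (simp add: self_adjoint_iff)

lemma positive_op_iff: "positive_op A \<longleftrightarrow> self_adjoint A \<and> (\<forall>x. 0 \<le> inner (A x) x)"
  by (simp add: positive_op_def Re_cinner)

lemma self_adjoint_id [simp]: "self_adjoint id_blinfun"
  by (simp add: self_adjoint_def)

lemma self_adjoint_zero [simp]: "self_adjoint 0"
  by (simp add: self_adjoint_def)

lemma self_adjoint_add: "self_adjoint A \<Longrightarrow> self_adjoint B \<Longrightarrow> self_adjoint (A + B)"
  by (simp add: self_adjoint_def blinfun.bilinear_simps cinner_simps)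

lemma self_adjoint_scaleR: "self_adjoint A \<Longrightarrow> self_adjoint (r *\<^sub>R A)"
  by (simp add: self_adjoint_def blinfun.bilinear_simps cinner_simps)

lemma self_adjoint_diff: "self_adjoint A \<Longrightarrow> self_adjoint B \<Longrightarrow> self_adjoint (A - B)"
  by (simp add: self_adjoint_def blinfun.bilinear_simps cinner_simps)

lemma self_adjoint_compose_commuting:
  assumes "self_adjoint A" "self_adjoint B" "A o\<^sub>L B = B o\<^sub>L A"
  shows "self_adjoint (A o\<^sub>L B)"
  unfolding self_adjoint_def
proof (intro allI)
  fix x y
  have "cinner ((A o\<^sub>L B) x) y = cinner x ((B o\<^sub>L A) y)"
    using assms(1,2) by (simp add: self_adjoint_def)
  then show "cinner ((A o\<^sub>L B) x) y = cinner x ((A o\<^sub>L B) y)"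
    using assms(3) by simp
qed

lemma self_adjoint_conjugate:
  fixes V :: "'a::complex_hilbert_space \<Rightarrow>\<^sub>L 'b::complex_hilbert_space"
    and W :: "'b \<Rightarrow>\<^sub>L 'a"
  assumes "self_adjoint A" "\<And>x y. cinner (V x) y = cinner x (W y)"
  shows "self_adjoint (W o\<^sub>L A o\<^sub>L V)"
  unfolding self_adjoint_def
proof (intro allI)
  fix x y
  have W: "cinner (W x) y = cinner x (V y)" for x y
    by (metis assms(2) cinner_commute)
  show "cinner ((W o\<^sub>L A o\<^sub>L V) x) y = cinner x ((W o\<^sub>L A o\<^sub>L V) y)"
    using assms(1) by (simp add: W assms(2)[symmetric] self_adjoint_def)
qed

lemma self_adjoint_sandwich: "self_adjoint A \<Longrightarrow> self_adjoint S \<Longrightarrow> self_adjoint (S o\<^sub>L A o\<^sub>L S)"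
  by (rule self_adjoint_conjugate) (simp_all add: self_adjoint_def)

lemma self_adjoint_limit:
  fixes T :: "'h::complex_hilbert_space \<Rightarrow>\<^sub>L 'h"
  assumes "\<And>n. self_adjoint (A n)" "A \<longlonglongrightarrow> T"
  shows "self_adjoint T"
proof -
  have lim: "(\<lambda>n. A n x) \<longlonglongrightarrow> T x" for x
    by (intro blinfun.tendsto assms tendsto_const)
  have "inner (T x) y = inner x (T y)" for x y
  proof (rule LIMSEQ_unique)
    show "(\<lambda>n. inner (A n x) y) \<longlonglongrightarrow> inner (T x) y"
      by (intro tendsto_intros lim)
    have "(\<lambda>n. inner x (A n y)) \<longlonglongrightarrow> inner x (T y)"
      by (intro tendsto_intros lim)
    then show "(\<lambda>n. inner (A n x) y) \<longlonglongrightarrow> inner x (T y)"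
      by (simp add: self_adjoint_inner[OF assms(1)])
  qed
  moreover have "T (\<i> *\<^sub>C x) = \<i> *\<^sub>C T x" for x
  proof (rule LIMSEQ_unique)
    show "(\<lambda>n. A n (\<i> *\<^sub>C x)) \<longlonglongrightarrow> T (\<i> *\<^sub>C x)" by (rule lim)
    have "(\<lambda>n. \<i> *\<^sub>C A n x) \<longlonglongrightarrow> \<i> *\<^sub>C T x"
      by (rule bounded_linear.tendsto[OF bounded_linear_scaleC lim])
    then show "(\<lambda>n. A n (\<i> *\<^sub>C x)) \<longlonglongrightarrow> \<i> *\<^sub>C T x"
      using assms(1) by (simp add: self_adjoint_iff)
  qed
  ultimately show ?thesis unfolding self_adjoint_iff by blast
qed

lemma op_le_iff:
  "A \<preceq> B \<longleftrightarrow> self_adjoint A \<and> self_adjoint B \<and> (\<forall>x. inner (A x) x \<le> inner (B x) x)"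
proof -
  have "0 \<le> inner ((B - A) x) x \<longleftrightarrow> inner (A x) x \<le> inner (B x) x" for x
    by (simp add: blinfun.diff_left inner_diff_left)
  then show ?thesis
    unfolding op_le_def positive_op_iff using self_adjoint_diff by blast
qed

lemma positive_op_Cauchy_Schwarz:
  assumes "positive_op A"
  shows "(inner (A x) y)\<^sup>2 \<le> inner (A x) x * inner (A y) y"
proof -
  have sym: "inner (A u) v = inner (A v) u" for u v
    using assms by (metis positive_op_iff self_adjoint_inner inner_commute)
  have pos: "0 \<le> inner (A u) u" for u
    using assms by (simp add: positive_op_iff)
  let ?a = "inner (A x) x" and ?b = "inner (A x) y" and ?c = "inner (A y) y"
  have q: "0 \<le> ?a - 2 * r * ?b + r\<^sup>2 * ?c" for r
    using pos[of "x - r *\<^sub>R y"] sym[of y x]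
    by (simp add: blinfun.bilinear_simps inner_diff_left inner_diff_right power2_eq_square algebra_simps)
  show ?thesis
  proof (cases "?c = 0")
    case True
    have "?b = 0"
    proof (rule ccontr)
      assume "?b \<noteq> 0"
      then show False using q[of "(?a + 1) / (2 * ?b)"] True by simp
    qed
    then show ?thesis using True by simp
  next
    case False
    then have "0 < ?c" using pos[of y] by simp
    then show ?thesis
      using q[of "?b / ?c"] by (simp add: power2_eq_square field_simps)
  qed
qed

section \<open>Invertibility and the spectrum\<close>

lemma invertible_opE:
  fixes A :: "'h::complex_hilbert_space \<Rightarrow>\<^sub>L 'h"
  assumes "invertible_op A"
  obtains B :: "'h \<Rightarrow>\<^sub>L 'h" where "\<And>x. A (B x) = x" "\<And>x. B (A x) = x"
  using assms unfolding invertible_op_def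
  by (metis blinfun_apply_blinfun_compose blinfun_apply_id_blinfun)

lemma invertible_opI:
  fixes A B :: "'h::complex_hilbert_space \<Rightarrow>\<^sub>L 'h"
  assumes "\<And>x. A (B x) = x" "\<And>x. B (A x) = x"
  shows "invertible_op A"
  unfolding invertible_op_def using assms by (auto intro!: exI[of _ B] blinfun_eqI)

lemma invertible_op_compose:
  fixes A B :: "'h::complex_hilbert_space \<Rightarrow>\<^sub>L 'h"
  assumes "invertible_op A" "invertible_op B"
  shows "invertible_op (A o\<^sub>L B)"
proof -
  obtain A' B' :: "'h \<Rightarrow>\<^sub>L 'h" where "\<And>x. A (A' x) = x" "\<And>x. A' (A x) = x"
    "\<And>x. B (B' x) = x" "\<And>x. B' (B x) = x"
    using assms by (elim invertible_opE) blast
  then show ?thesis by (intro invertible_opI[where B = "B' o\<^sub>L A'"]) simp_all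
qed

lemma invertible_op_scaleR:
  fixes A :: "'h::complex_hilbert_space \<Rightarrow>\<^sub>L 'h"
  assumes "invertible_op A" "r \<noteq> 0"
  shows "invertible_op (r *\<^sub>R A)"
proof -
  obtain B :: "'h \<Rightarrow>\<^sub>L 'h" where "\<And>x. A (B x) = x" "\<And>x. B (A x) = x"
    using assms(1) by (elim invertible_opE) blast
  then show ?thesis
    using assms(2) by (intro invertible_opI[where B = "inverse r *\<^sub>R B"]) (simp_all add: blinfun.bilinear_simps)
qed

lemma invertible_op_bounded_below:
  fixes A :: "'h::complex_hilbert_space \<Rightarrow>\<^sub>L 'h"
  assumes "invertible_op A"
  obtains c where "0 < c" "\<And>x. c * norm x \<le> norm (A x)"
proof -
  obtain B :: "'h \<Rightarrow>\<^sub>L 'h" where B: "\<And>x. A (B x) = x" "\<And>x. B (A x) = x"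
    using assms by (elim invertible_opE) blast
  have N: "0 < norm B + 1" by (simp add: add_nonneg_pos)
  have "norm x \<le> (norm B + 1) * norm (A x)" for x
    using norm_blinfun[of B "A x"] B(2)[of x] by (simp add: distrib_right add_increasing2)
  then have "inverse (norm B + 1) * norm x \<le> norm (A x)" for x
    using N by (simp add: field_simps)
  then show ?thesis
    using that[of "inverse (norm B + 1)"] N by simp
qed

lemma norm_diff_scaleR_squared:
  fixes x y :: "'a::real_inner"
  shows "(norm (x - e *\<^sub>R y))\<^sup>2 = (norm x)\<^sup>2 - 2 * e * inner y x + e\<^sup>2 * (norm y)\<^sup>2"
  unfolding power2_norm_eq_inner
  by (simp add: inner_diff_left inner_diff_right inner_commute[of x y] power2_eq_square[of e] algebra_simps)

text \<open>As in the Lax-Milgram lemma, for small \<open>e > 0\<close> the map \<open>x \<mapsto> x - e (A x - y)\<close> is a contraction, and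
  its fixed point solves \<open>A x = y\<close>.\<close>

lemma coercive_imp_invertible:
  fixes A :: "'h::complex_hilbert_space \<Rightarrow>\<^sub>L 'h"
  assumes c: "0 < c" and coercive: "\<And>x. c * inner x x \<le> inner (A x) x"
  shows "invertible_op A"
proof -
  define M where "M = norm A + c"
  have M: "0 < M" "c \<le> M" "norm A \<le> M" using c by (auto simp: M_def add_nonneg_pos)
  define e where "e = c / M\<^sup>2"
  have e: "0 < e" using c M by (simp add: e_def)
  have contr: "(norm (x - e *\<^sub>R A x))\<^sup>2 \<le> (1 - (c / M)\<^sup>2) * (norm x)\<^sup>2" for x
  proof -
    have "(norm (A x))\<^sup>2 \<le> (M * norm x)\<^sup>2"
      by (intro power_mono order_trans[OF norm_blinfun] mult_right_mono M) auto
    then have 1: "e\<^sup>2 * (norm (A x))\<^sup>2 \<le> e\<^sup>2 * (M\<^sup>2 * (norm x)\<^sup>2)"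
      by (intro mult_left_mono) (auto simp: power_mult_distrib)
    have 2: "2 * e * (c * (norm x)\<^sup>2) \<le> 2 * e * inner (A x) x"
      using coercive[of x] e by (intro mult_left_mono) (auto simp: power2_norm_eq_inner)
    have "(norm (x - e *\<^sub>R A x))\<^sup>2 = (norm x)\<^sup>2 - 2 * e * inner (A x) x + e\<^sup>2 * (norm (A x))\<^sup>2"
      by (rule norm_diff_scaleR_squared)
    also have "\<dots> \<le> (norm x)\<^sup>2 - 2 * e * (c * (norm x)\<^sup>2) + e\<^sup>2 * (M\<^sup>2 * (norm x)\<^sup>2)"
      using 1 2 by linarith
    also have "\<dots> = (1 - (c / M)\<^sup>2) * (norm x)\<^sup>2"
      using M by (simp add: e_def power2_eq_square field_simps)
    finally show ?thesis .
  qed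
  define k where "k = sqrt (1 - (c / M)\<^sup>2)"
  have "c / M \<le> 1" "0 < c / M" using M c by auto
  then have "(c / M)\<^sup>2 \<le> 1" "0 < (c / M)\<^sup>2"
    by (simp_all only: power_le_one zero_less_power less_imp_le)
  then have k: "0 \<le> k" "k < 1" unfolding k_def by (simp_all del: power_divide)
  have contr': "norm (x - e *\<^sub>R A x) \<le> k * norm x" for x
    using real_sqrt_le_mono[OF contr[of x]] by (simp add: real_sqrt_mult k_def)
  have "\<exists>!x. A x = y" for y
  proof -
    have "\<exists>!x. x - e *\<^sub>R (A x - y) = x"
    proof (rule banach_fix_type[OF k], intro allI)
      fix x x'
      have "x - e *\<^sub>R (A x - y) - (x' - e *\<^sub>R (A x' - y)) = (x - x') - e *\<^sub>R A (x - x')"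
        by (simp add: blinfun.bilinear_simps algebra_simps)
      then show "dist (x - e *\<^sub>R (A x - y)) (x' - e *\<^sub>R (A x' - y)) \<le> k * dist x x'"
        using contr'[of "x - x'"] unfolding dist_norm by metis
    qed
    then show ?thesis using e by simp
  qed
  then obtain B where B: "\<And>y. A (B y) = y" "\<And>x. B (A x) = x" by metis
  have "bounded_linear B"
  proof (rule bounded_linear_intro[where K = "inverse c"])
    show "B (x + y) = B x + B y" for x y
      by (metis B blinfun.add_right)
    show "B (r *\<^sub>R x) = r *\<^sub>R B x" for r x
      by (metis B blinfun.scaleR_right)
    show "norm (B y) \<le> norm y * inverse c" for y
    proof -
      have "c * (norm (B y))\<^sup>2 \<le> norm y * norm (B y)"
        using order_trans[OF coercive[of "B y"] norm_cauchy_schwarz] B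
        by (simp add: power2_norm_eq_inner)
      then have "c * norm (B y) \<le> norm y"
        by (cases "norm (B y) = 0") (auto simp: power2_eq_square)
      then show ?thesis using c by (simp add: field_simps)
    qed
  qed
  then show ?thesis
    using B by (intro invertible_opI[where B = "Blinfun B"]) (simp_all add: bounded_linear_Blinfun_apply)
qed

text \<open>Bounds on the quadratic form, rather than on the spectrum, are what passes directly to sums,
  conjugates and compressions; they confine the spectrum to the same interval.\<close>

definition form_between :: "real \<Rightarrow> real \<Rightarrow> ('h::complex_hilbert_space \<Rightarrow>\<^sub>L 'h) \<Rightarrow> bool" where
  "form_between a b A \<longleftrightarrow> self_adjoint A \<and>
     (\<forall>x. a * inner x x \<le> inner (A x) x \<and> inner (A x) x \<le> b * inner x x)"

lemma form_between_self_adjoint: "form_between a b A \<Longrightarrow> self_adjoint A"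
  by (simp add: form_between_def)

lemma form_between_mono:
  "form_between a b A \<Longrightarrow> a' \<le> a \<Longrightarrow> b \<le> b' \<Longrightarrow> form_between a' b' A"
  unfolding form_between_def by (meson inner_ge_zero mult_right_mono order_trans)

lemma form_between_spectrum:
  assumes "form_between a b A"
  shows "op_spectrum A \<subseteq> {a..b}"
proof
  fix r assume r: "r \<in> op_spectrum A"
  have 1: "a \<le> r"
  proof (rule ccontr)
    assume "\<not> a \<le> r"
    then have "invertible_op (A - r *\<^sub>R id_blinfun)"
      using assms by (intro coercive_imp_invertible[of "a - r"])
        (auto simp: form_between_def blinfun.bilinear_simps inner_diff_left left_diff_distrib)
    with r show False by (simp add: op_spectrum_def)
  qed
  have 2: "r \<le> b"
  proof (rule ccontr)
    assume "\<not> r \<le> b"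
    then have "invertible_op (- 1 *\<^sub>R (A - r *\<^sub>R id_blinfun))"
      using assms by (intro coercive_imp_invertible[of "r - b"])
        (auto simp: form_between_def blinfun.bilinear_simps inner_diff_left left_diff_distrib)
    then have "invertible_op (- 1 *\<^sub>R (- 1 *\<^sub>R (A - r *\<^sub>R id_blinfun)))"
      by (rule invertible_op_scaleR) simp
    with r show False by (simp add: op_spectrum_def)
  qed
  show "r \<in> {a..b}" using 1 2 by simp
qed

lemma inner_le_norm_blinfun:
  fixes A :: "'h::real_inner \<Rightarrow>\<^sub>L 'h"
  shows "inner (A x) x \<le> norm A * inner x x"
proof -
  have "inner (A x) x \<le> norm (A x) * norm x" by (rule norm_cauchy_schwarz)
  also have "\<dots> \<le> (norm A * norm x) * norm x"
    by (intro mult_right_mono norm_blinfun) simp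
  finally show ?thesis by (simp add: power2_norm_eq_inner[symmetric] power2_eq_square mult.assoc)
qed

text \<open>For a positive operator \<open>(norm (A x))\<^sup>2 \<le> norm A * inner (A x) x\<close>, so that the lower bound
  on \<open>norm (A x)\<close> that comes with invertibility becomes a lower bound on the form.\<close>

lemma positive_definite_iff_coercive:
  "positive_definite A \<longleftrightarrow> self_adjoint A \<and> (\<exists>a>0. \<forall>x. a * inner x x \<le> inner (A x) x)"
proof safe
  assume pd: "positive_definite A"
  then have pos: "positive_op A" and inv: "invertible_op A"
    by (auto simp: positive_definite_def)
  show "self_adjoint A" using pos by (simp add: positive_op_def)
  have pos': "0 \<le> inner (A x) x" for x using pos by (simp add: positive_op_iff)
  obtain c where c: "0 < c" "\<And>x. c * norm x \<le> norm (A x)"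
    using inv by (rule invertible_op_bounded_below) blast
  define N where "N = norm A + 1"
  have N: "0 < N" by (simp add: N_def add_nonneg_pos)
  have upper: "inner (A x) x \<le> N * inner x x" for x
    by (rule order_trans[OF inner_le_norm_blinfun mult_right_mono]) (simp_all add: N_def)
  have "c\<^sup>2 / N * inner x x \<le> inner (A x) x" for x
  proof -
    let ?y = "A x"
    have "(inner ?y ?y)\<^sup>2 \<le> inner (A x) x * inner (A ?y) ?y"
      by (rule positive_op_Cauchy_Schwarz[OF pos])
    also have "\<dots> \<le> inner (A x) x * (N * inner ?y ?y)"
      by (intro mult_left_mono upper pos')
    finally have "inner ?y ?y \<le> N * inner (A x) x"
      by (cases "inner ?y ?y = 0") (use N pos' in \<open>auto simp: power2_eq_square mult.assoc mult.left_commute\<close>)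
    moreover have "c\<^sup>2 * inner x x \<le> inner ?y ?y"
      using power_mono[OF c(2)[of x], of 2] c(1)
      by (simp add: power_mult_distrib power2_norm_eq_inner)
    ultimately show ?thesis using N by (simp add: field_simps)
  qed
  then show "\<exists>a>0. \<forall>x. a * inner x x \<le> inner (A x) x"
    using c N by (intro exI[of _ "c\<^sup>2 / N"]) auto
next
  fix a :: real assume "self_adjoint A" "0 < a" and a: "\<forall>x. a * inner x x \<le> inner (A x) x"
  moreover have "0 \<le> inner (A x) x" for x
    using a \<open>0 < a\<close> by (meson inner_ge_zero mult_nonneg_nonneg less_imp_le order_trans)
  ultimately show "positive_definite A"
    unfolding positive_definite_def positive_op_iff using coercive_imp_invertible by blast
qed

lemma positive_definite_form_between:
  assumes "positive_definite A"
  obtains a b where "0 < a" "a \<le> b" "form_between a b A"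
proof -
  obtain a where a: "0 < a" "\<And>x. a * inner x x \<le> inner (A x) x" and sa: "self_adjoint A"
    using assms by (auto simp: positive_definite_iff_coercive)
  have "inner (A x) x \<le> (norm A + a) * inner x x" for x
    by (rule order_trans[OF inner_le_norm_blinfun mult_right_mono]) (use a in simp_all)
  with a sa have "form_between a (norm A + a) A" by (simp add: form_between_def)
  with a that[of a "norm A + a"] show ?thesis by simp
qed

lemma form_between_positive_definite: "0 < a \<Longrightarrow> form_between a b A \<Longrightarrow> positive_definite A"
  by (auto simp: form_between_def positive_definite_iff_coercive)

lemma positive_definite_self_adjoint: "positive_definite A \<Longrightarrow> self_adjoint A"
  by (simp add: positive_definite_iff_coercive)

text \<open>With \<open>m = norm T\<close>, symmetry turns \<open>norm (T (T x) - m\<^sup>2 x)\<^sup>2\<close> into at most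
  \<open>m\<^sup>2 (m\<^sup>2 (norm x)\<^sup>2 - (norm (T x))\<^sup>2)\<close>. If \<open>T - m\<close> and \<open>T + m\<close> were both invertible, their product
  \<open>T\<^sup>2 - m\<^sup>2\<close> would be bounded below, which would force \<open>norm T < m\<close>.\<close>

lemma norm_attained_on_spectrum:
  assumes sa: "self_adjoint T" and m: "0 < norm T"
  shows "\<exists>r\<in>op_spectrum T. \<bar>r\<bar> = norm T"
proof (rule ccontr)
  define m where "m = norm T"
  assume "\<not> ?thesis"
  then have "r \<notin> op_spectrum T" if "\<bar>r\<bar> = m" for r
    using that by (auto simp: m_def)
  then have "m \<notin> op_spectrum T" "- m \<notin> op_spectrum T"
    by (simp_all add: m_def)
  then have "invertible_op (T - m *\<^sub>R id_blinfun)" "invertible_op (T - (- m) *\<^sub>R id_blinfun)"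
    unfolding op_spectrum_def by blast+
  then obtain c where c: "0 < c"
    "\<And>x. c * norm x \<le> norm (((T - m *\<^sub>R id_blinfun) o\<^sub>L (T - (- m) *\<^sub>R id_blinfun)) x)"
    using invertible_op_bounded_below invertible_op_compose by meson
  have c': "c * norm x \<le> norm (T (T x) - m\<^sup>2 *\<^sub>R x)" for x
    using c(2)[of x] by (simp add: blinfun.bilinear_simps algebra_simps power2_eq_square)
  have mpos: "0 < m" using m by (simp add: m_def)
  define d where "d = max 0 (m\<^sup>2 - c\<^sup>2 / m\<^sup>2)"
  have "norm T \<le> sqrt d"
  proof (rule norm_blinfun_bound)
    show "0 \<le> sqrt d" by (simp add: d_def)
    fix x
    have "(c * norm x)\<^sup>2 \<le> (norm (T (T x) - m\<^sup>2 *\<^sub>R x))\<^sup>2"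
      using c(1) c'[of x] by (intro power_mono) auto
    also have "\<dots> = (norm (T (T x)))\<^sup>2 - 2 * m\<^sup>2 * (norm (T x))\<^sup>2 + m\<^sup>2 * m\<^sup>2 * (norm x)\<^sup>2"
      by (simp add: norm_diff_scaleR_squared inner_commute[of x]
          self_adjoint_inner[OF sa, of "T x" x, symmetric] self_adjoint_inner[OF sa, of x "T x"]
          power2_norm_eq_inner[of "T x"] power2_eq_square[of "m\<^sup>2"])
    also have "(norm (T (T x)))\<^sup>2 \<le> (m * norm (T x))\<^sup>2"
      unfolding m_def by (intro power_mono norm_blinfun) auto
    finally have "c\<^sup>2 * (norm x)\<^sup>2 \<le> m\<^sup>2 * (m\<^sup>2 * (norm x)\<^sup>2 - (norm (T x))\<^sup>2)"
      by (simp add: power_mult_distrib algebra_simps)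
    then have "(norm (T x))\<^sup>2 \<le> (m\<^sup>2 - c\<^sup>2 / m\<^sup>2) * (norm x)\<^sup>2"
      using mpos by (simp add: field_simps)
    also have "\<dots> \<le> d * (norm x)\<^sup>2"
      by (intro mult_right_mono) (auto simp: d_def)
    finally show "norm (T x) \<le> sqrt d * norm x"
      using real_sqrt_le_mono by (fastforce simp: real_sqrt_mult)
  qed
  moreover have "d < m\<^sup>2" using mpos c(1) by (simp add: d_def)
  then have "sqrt d < m" using mpos by (metis real_sqrt_less_mono real_sqrt_unique less_imp_le)
  ultimately show False by (simp add: m_def)
qed

section \<open>Polynomials of a self-adjoint operator\<close>

lemma op_poly_altdef:
  assumes "degree P \<le> n"
  shows "op_poly P A = (\<Sum>i\<le>n. coeff P i *\<^sub>R (((o\<^sub>L) A ^^ i) id_blinfun))"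
  unfolding op_poly_def using assms
  by (intro sum.mono_neutral_left) (auto simp: coeff_eq_0)

lemma op_poly_pCons: "op_poly (pCons a P) A = a *\<^sub>R id_blinfun + (A o\<^sub>L op_poly P A)"
proof -
  have "op_poly (pCons a P) A
      = (\<Sum>i\<le>Suc (degree P). coeff (pCons a P) i *\<^sub>R (((o\<^sub>L) A ^^ i) id_blinfun))"
    by (intro op_poly_altdef degree_pCons_le)
  also have "\<dots> = a *\<^sub>R id_blinfun
      + (\<Sum>i\<le>degree P. (A o\<^sub>L (coeff P i *\<^sub>R (((o\<^sub>L) A ^^ i) id_blinfun))))"
    unfolding sum.atMost_Suc_shift
    by (simp add: bounded_bilinear.scaleR_right[OF bounded_bilinear_blinfun_compose])
  also have "\<dots> = a *\<^sub>R id_blinfun + (A o\<^sub>L op_poly P A)"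
    unfolding op_poly_def
    by (simp add: bounded_bilinear.sum_right[OF bounded_bilinear_blinfun_compose])
  finally show ?thesis .
qed

lemma op_poly_0 [simp]: "op_poly 0 A = 0"
  by (simp add: op_poly_def)

lemma op_poly_pCons_apply: "op_poly (pCons a P) A x = a *\<^sub>R x + A (op_poly P A x)"
  by (simp add: op_poly_pCons blinfun.bilinear_simps)

lemma op_poly_const: "op_poly [:c:] A = c *\<^sub>R id_blinfun"
  by (simp add: op_poly_pCons)

lemma op_poly_add: "op_poly (P + Q) A = op_poly P A + op_poly Q A"
proof (induction P Q rule: poly_induct2)
  case (pCons a P b Q)
  then show ?case
    by (intro blinfun_eqI) (simp add: op_poly_pCons_apply blinfun.bilinear_simps algebra_simps)
qed simp

lemma op_poly_smult: "op_poly (smult c P) A = c *\<^sub>R op_poly P A"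
proof (induction P)
  case (pCons a P)
  then show ?case
    by (intro blinfun_eqI) (simp add: op_poly_pCons_apply blinfun.bilinear_simps algebra_simps)
qed simp

lemma op_poly_diff: "op_poly (P - Q) A = op_poly P A - op_poly Q A"
  using op_poly_add[of P "- Q" A] op_poly_smult[of "-1" Q A] by simp

lemma op_poly_mult: "op_poly (P * Q) A = op_poly P A o\<^sub>L op_poly Q A"
proof (induction P)
  case (pCons a P)
  then show ?case
    by (intro blinfun_eqI)
      (simp add: mult_pCons_left op_poly_add op_poly_smult op_poly_pCons_apply blinfun.bilinear_simps)
qed simp

lemma op_poly_commute: "op_poly P A o\<^sub>L op_poly Q A = op_poly Q A o\<^sub>L op_poly P A"
  by (simp add: op_poly_mult[symmetric] mult.commute)

lemma op_poly_X: "op_poly [:0, 1:] A = A"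
  by (intro blinfun_eqI) (simp add: op_poly_pCons_apply blinfun.bilinear_simps)

lemma self_adjoint_op_poly:
  assumes "self_adjoint A"
  shows "self_adjoint (op_poly P A)"
proof (induction P)
  case (pCons a P)
  have "A o\<^sub>L op_poly P A = op_poly P A o\<^sub>L A"
    using op_poly_commute[of "[:0, 1:]" A P] by (simp add: op_poly_X)
  with pCons assms show ?case
    unfolding op_poly_pCons
    by (intro self_adjoint_add self_adjoint_scaleR self_adjoint_id self_adjoint_compose_commuting)
qed simp

lemma poly_complex_of_real_add:
  "poly (map_poly complex_of_real (P + Q)) z
     = poly (map_poly complex_of_real P) z + poly (map_poly complex_of_real Q) z"
  by (induction P Q rule: poly_induct2) (simp_all add: map_poly_pCons algebra_simps)

lemma poly_complex_of_real_mult: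
  "poly (map_poly complex_of_real (P * Q)) z
     = poly (map_poly complex_of_real P) z * poly (map_poly complex_of_real Q) z"
proof -
  have smult: "poly (map_poly complex_of_real (smult c P)) z
      = complex_of_real c * poly (map_poly complex_of_real P) z" for c P
    by (induction P) (simp_all add: map_poly_pCons algebra_simps)
  show ?thesis
    by (induction P) (simp_all add: map_poly_pCons poly_complex_of_real_add smult algebra_simps)
qed

lemma real_poly_factor_cases:
  fixes P :: "real poly"
  assumes "degree P \<noteq> 0"
  obtains (real) r Q where "P = [:- r, 1:] * Q"
    | (complex) a b Q where "b \<noteq> 0" "P = [:a\<^sup>2 + b\<^sup>2, - 2 * a, 1:] * Q"
proof -
  let ?c = "map_poly complex_of_real"
  have "\<not> constant (poly (?c P))"
    using assms by (simp add: constant_degree degree_map_poly)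
  then obtain z where z: "poly (?c P) z = 0"
    using fundamental_theorem_of_algebra by blast
  show thesis
  proof (cases "Im z = 0")
    case True
    then have zr: "z = complex_of_real (Re z)" by (simp add: complex_eq_iff)
    have "poly (?c P) (complex_of_real x) = complex_of_real (poly P x)" for x
      by (induction P) (simp_all add: map_poly_pCons)
    then have "poly P (Re z) = 0"
      using z zr by (metis of_real_eq_0_iff)
    then obtain Q where "P = [:- Re z, 1:] * Q"
      by (auto simp: poly_eq_0_iff_dvd)
    then show thesis by (rule real)
  next
    case False
    define D where "D = [:(Re z)\<^sup>2 + (Im z)\<^sup>2, - 2 * Re z, 1:]"
    have D0: "poly (?c D) z = 0"
      by (simp add: D_def map_poly_pCons complex_eq_iff power2_eq_square algebra_simps)
    have "degree (P mod D) < degree D"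
      by (cases "P mod D = 0") (use degree_mod_less[of D P] in \<open>auto simp: D_def\<close>)
    then have deg: "degree (P mod D) \<le> 1" by (simp add: D_def)
    obtain u v where uv: "P mod D = [:u, v:]"
    proof -
      have "P mod D = [:coeff (P mod D) 0, coeff (P mod D) 1:]"
        using deg by (intro poly_eqI) (auto simp: coeff_pCons coeff_eq_0 split: nat.split)
      then show ?thesis by (rule that)
    qed
    have "P = D * (P div D) + P mod D" by simp
    then have "poly (?c (P mod D)) z = 0"
      using z D0 by (metis poly_complex_of_real_add poly_complex_of_real_mult mult_zero_left add_0)
    then have "of_real u + z * of_real v = 0"
      by (simp add: uv map_poly_pCons)
    then have "v = 0" "u = 0"
      using False by (auto simp: complex_eq_iff)
    then have "P = D * (P div D)"
      using uv \<open>P = D * (P div D) + P mod D\<close> by simp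
    then show thesis using False unfolding D_def by (rule complex[rotated])
  qed
qed

text \<open>Factor \<open>P\<close> over the reals: a linear factor
  \<open>X - r\<close> has \<open>r\<close> outside the spectrum, and an irreducible quadratic factor \<open>(X - a)\<^sup>2 + b\<^sup>2\<close> gives
  \<open>(A - a)\<^sup>2 + b\<^sup>2 \<ge> b\<^sup>2 > 0\<close>, which is invertible because it is coercive.\<close>

lemma op_poly_invertible:
  fixes A :: "'h::complex_hilbert_space \<Rightarrow>\<^sub>L 'h"
  assumes sa: "self_adjoint A" and "P \<noteq> 0" and "\<And>r. r \<in> op_spectrum A \<Longrightarrow> poly P r \<noteq> 0"
  shows "invertible_op (op_poly P A)"
  using assms(2,3)
proof (induction "degree P" arbitrary: P rule: less_induct)
  case less
  show ?case
  proof (cases "degree P = 0")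
    case True
    then obtain c where c: "P = [:c:]" by (rule degree_eq_zeroE)
    moreover have "invertible_op (id_blinfun :: 'h \<Rightarrow>\<^sub>L 'h)"
      by (rule invertible_opI[where B = id_blinfun]) simp_all
    ultimately show ?thesis
      using less.prems(1) by (simp add: op_poly_const invertible_op_scaleR)
  next
    case False
    then show ?thesis
    proof (cases rule: real_poly_factor_cases)
      case (real r Q)
      then have "r \<notin> op_spectrum A" using less.prems(2)[of r] by auto
      then have "invertible_op (A - r *\<^sub>R id_blinfun)" by (simp add: op_spectrum_def)
      moreover have "op_poly [:- r, 1:] A = A - r *\<^sub>R id_blinfun"
        by (intro blinfun_eqI) (simp add: op_poly_pCons_apply blinfun.bilinear_simps)
      moreover have "Q \<noteq> 0" using less.prems(1) real by auto
      moreover from this have "degree Q < degree P"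
        using real by (simp add: degree_mult_eq del: mult_pCons_left)
      ultimately show ?thesis
        using less.hyps[of Q] less.prems(2) unfolding real
        by (auto simp: op_poly_mult simp del: mult_pCons_left intro!: invertible_op_compose)
    next
      case (complex a b Q)
      let ?D = "[:a\<^sup>2 + b\<^sup>2, - 2 * a, 1:]"
      have D: "op_poly ?D A x = (A (A x - a *\<^sub>R x) - a *\<^sub>R (A x - a *\<^sub>R x)) + b\<^sup>2 *\<^sub>R x" for x
        by (simp add: op_poly_pCons_apply blinfun.bilinear_simps power2_eq_square algebra_simps
            flip: scaleR_2)
      have "b\<^sup>2 * inner x x \<le> inner (op_poly ?D A x) x" for x
      proof -
        have "inner (op_poly ?D A x) x = inner (A x - a *\<^sub>R x) (A x - a *\<^sub>R x) + b\<^sup>2 * inner x x"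
          unfolding D by (simp add: inner_add_left inner_diff_left inner_diff_right self_adjoint_inner[OF sa]
              blinfun.bilinear_simps)
        then show ?thesis by simp
      qed
      then have "invertible_op (op_poly ?D A)"
        using complex by (intro coercive_imp_invertible[of "b\<^sup>2"]) auto
      moreover have "Q \<noteq> 0" using less.prems(1) complex by auto
      moreover from this have "degree Q < degree P"
        using complex by (simp add: degree_mult_eq del: mult_pCons_left)
      ultimately show ?thesis
        using less.hyps[of Q] less.prems(2) unfolding complex
        by (auto simp: op_poly_mult simp del: mult_pCons_left intro!: invertible_op_compose)
    qed
  qed
qed

text \<open>The norm of \<open>P(A)\<close> is \<open>|s|\<close> for some \<open>s\<close> in the spectrum of \<open>P(A)\<close>. As \<open>P(A) - s\<close> is not invertible,
  \<open>P - s\<close> must have a root in the spectrum of \<open>A\<close>.\<close>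

lemma norm_op_poly_le:
  fixes A :: "'h::complex_hilbert_space \<Rightarrow>\<^sub>L 'h"
  assumes sa: "self_adjoint A" and c: "0 \<le> c" "\<And>r. r \<in> op_spectrum A \<Longrightarrow> \<bar>poly P r\<bar> \<le> c"
  shows "norm (op_poly P A) \<le> c"
proof (rule ccontr)
  assume *: "\<not> ?thesis"
  then have "0 < norm (op_poly P A)" using c(1) by linarith
  then obtain s where s: "s \<in> op_spectrum (op_poly P A)" "\<bar>s\<bar> = norm (op_poly P A)"
    using norm_attained_on_spectrum self_adjoint_op_poly[OF sa] by blast
  have "op_poly P A - s *\<^sub>R id_blinfun = op_poly (P - [:s:]) A"
    by (simp add: op_poly_diff op_poly_const)
  then have "\<not> invertible_op (op_poly (P - [:s:]) A)"
    using s(1) by (simp add: op_spectrum_def)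
  moreover have "P - [:s:] \<noteq> 0"
  proof
    assume "P - [:s:] = 0"
    then have P: "P = [:s:]" by simp
    have "op_spectrum A \<noteq> {}"
    proof
      assume "op_spectrum A = {}"
      \<comment> \<open>The spectrum is empty only on the zero space, where \<open>A\<close> itself has norm 0.\<close>
      then have "norm A \<le> 0"
        using norm_attained_on_spectrum[OF sa] by force
      then have "A = 0" by simp
      then have "invertible_op (0 :: 'h \<Rightarrow>\<^sub>L 'h)"
        using \<open>op_spectrum A = {}\<close> by (auto simp: op_spectrum_def dest: spec[of _ 0])
      then obtain B :: "'h \<Rightarrow>\<^sub>L 'h" where "\<And>x. (0 :: 'h \<Rightarrow>\<^sub>L 'h) (B x) = x"
        by (elim invertible_opE) blast
      then have "x = 0" for x :: 'h by (metis blinfun.zero_left)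
      then have "op_poly P A = 0" by (intro blinfun_eqI) metis
      with * c(1) show False by simp
    qed
    then show False using c(2) * s(2) P by force
  qed
  ultimately obtain r where "r \<in> op_spectrum A" "poly (P - [:s:]) r = 0"
    using op_poly_invertible[OF sa] by blast
  then show False using c(2)[of r] * s(2) by simp
qed

section \<open>The continuous functional calculus\<close>

lemma uniform_polynomial_approximation:
  fixes f :: "real \<Rightarrow> real"
  assumes "continuous_on {a..b} f"
  obtains P where "uniform_limit {a..b} (\<lambda>n::nat. poly (P n)) f sequentially"
proof -
  have "\<exists>P. \<forall>x\<in>{a..b}. \<bar>f x - poly P x\<bar> < 1 / Suc n" for n
  proof -
    obtain h where h: "real_polynomial_function h" "\<And>x. x \<in> {a..b} \<Longrightarrow> \<bar>f x - h x\<bar> < 1 / Suc n"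
      using Stone_Weierstrass_real_polynomial_function[OF compact_Icc assms, of "1 / Suc n"] by auto
    obtain c d where "h = (\<lambda>x. \<Sum>i\<le>d. c i * x ^ i)"
      using h(1) real_polynomial_function_iff_sum by auto
    then have "h = poly (\<Sum>i\<le>d. monom (c i) i)"
      by (auto simp: poly_sum poly_monom)
    with h(2) show ?thesis by metis
  qed
  then obtain P where P: "\<And>n x. x \<in> {a..b} \<Longrightarrow> \<bar>f x - poly (P n) x\<bar> < 1 / Suc n" by metis
  have "uniform_limit {a..b} (\<lambda>n. poly (P n)) f sequentially"
  proof (rule uniform_limitI)
    fix e :: real assume "0 < e"
    then obtain N where N: "1 / Suc N < e" using nat_approx_posE by blast
    have "dist (poly (P n) x) (f x) < e" if "n \<ge> N" "x \<in> {a..b}" for n x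
    proof -
      have "1 / Suc n \<le> 1 / Suc N" using that by (simp add: frac_le)
      then show ?thesis using P[OF that(2), of n] N by (simp add: dist_real_def abs_minus_commute)
    qed
    then show "\<forall>\<^sub>F n in sequentially. \<forall>x\<in>{a..b}. dist (poly (P n) x) (f x) < e"
      unfolding eventually_sequentially by blast
  qed
  then show ?thesis by (rule that)
qed

lemma op_poly_Cauchy:
  fixes A :: "'h::complex_hilbert_space \<Rightarrow>\<^sub>L 'h"
  assumes sa: "self_adjoint A"
    and P: "uniform_limit (op_spectrum A) (\<lambda>n. poly (P n)) f sequentially"
    and Q: "uniform_limit (op_spectrum A) (\<lambda>n. poly (Q n)) f sequentially"
    and e: "0 < e"
  obtains N where "\<And>m n. m \<ge> N \<Longrightarrow> n \<ge> N \<Longrightarrow> norm (op_poly (P m) A - op_poly (Q n) A) \<le> e"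
proof -
  have "0 < e / 2" using e by simp
  then obtain N where N: "\<And>n x. n \<ge> N \<Longrightarrow> x \<in> op_spectrum A \<Longrightarrow> dist (poly (P n) x) (f x) < e / 2"
    "\<And>n x. n \<ge> N \<Longrightarrow> x \<in> op_spectrum A \<Longrightarrow> dist (poly (Q n) x) (f x) < e / 2"
    using eventually_conj[OF uniform_limitD[OF P] uniform_limitD[OF Q]]
    unfolding eventually_sequentially by meson
  have "norm (op_poly (P m) A - op_poly (Q n) A) \<le> e" if "m \<ge> N" "n \<ge> N" for m n
    unfolding op_poly_diff[symmetric]
  proof (rule norm_op_poly_le[OF sa])
    fix r assume "r \<in> op_spectrum A"
    then have "\<bar>poly (P m) r - f r\<bar> < e / 2" "\<bar>poly (Q n) r - f r\<bar> < e / 2"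
      using N(1)[of m r] N(2)[of n r] that by (simp_all add: dist_real_def)
    then show "\<bar>poly (P m - Q n) r\<bar> \<le> e"
      unfolding poly_diff by linarith
  qed (use e in simp)
  then show ?thesis by (rule that)
qed

text \<open>Existence and uniqueness of the limit in the definition of \<^const>\<open>cfc\<close> rest on
  \<open>norm (P(A)) \<le> sup |P|\<close> over the spectrum; the enclosing interval supplies at least one
  approximating sequence of polynomials.\<close>

lemma cfc_limit:
  fixes A :: "'h::complex_hilbert_space \<Rightarrow>\<^sub>L 'h"
  assumes sa: "self_adjoint A" and ab: "op_spectrum A \<subseteq> {a..b}" and f: "continuous_on {a..b} f"
    and P: "uniform_limit (op_spectrum A) (\<lambda>n. poly (P n)) f sequentially"
  shows "(\<lambda>n. op_poly (P n) A) \<longlonglongrightarrow> cfc f A"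
proof -
  let ?lim = "\<lambda>T. \<forall>P :: nat \<Rightarrow> real poly. uniform_limit (op_spectrum A) (\<lambda>n. poly (P n)) f sequentially \<longrightarrow>
     (\<lambda>n. op_poly (P n) A) \<longlonglongrightarrow> T"
  obtain Q where "uniform_limit {a..b} (\<lambda>n::nat. poly (Q n)) f sequentially"
    using uniform_polynomial_approximation[OF f] by blast
  then have Q: "uniform_limit (op_spectrum A) (\<lambda>n. poly (Q n)) f sequentially"
    using ab by (rule uniform_limit_on_subset)
  have "Cauchy (\<lambda>n. op_poly (Q n) A)"
  proof (rule CauchyI)
    fix e :: real assume "0 < e"
    then have "0 < e / 2" by simp
    from op_poly_Cauchy[OF sa Q Q this] obtain N where
      "\<And>m n. m \<ge> N \<Longrightarrow> n \<ge> N \<Longrightarrow> norm (op_poly (Q m) A - op_poly (Q n) A) \<le> e / 2" by blast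
    with \<open>0 < e\<close> show "\<exists>M. \<forall>m\<ge>M. \<forall>n\<ge>M. norm (op_poly (Q m) A - op_poly (Q n) A) < e"
      by (intro exI[of _ N]) fastforce
  qed
  then obtain T where T: "(\<lambda>n. op_poly (Q n) A) \<longlonglongrightarrow> T"
    using Cauchy_convergent convergent_def by blast
  have "?lim T"
  proof (intro allI impI)
    fix P :: "nat \<Rightarrow> real poly"
    assume P: "uniform_limit (op_spectrum A) (\<lambda>n. poly (P n)) f sequentially"
    have "(\<lambda>n. op_poly (P n) A - op_poly (Q n) A) \<longlonglongrightarrow> 0"
    proof (rule LIMSEQ_I)
      fix e :: real assume "0 < e"
      then have "0 < e / 2" by simp
      from op_poly_Cauchy[OF sa P Q this] obtain N where
        "\<And>m n. m \<ge> N \<Longrightarrow> n \<ge> N \<Longrightarrow> norm (op_poly (P m) A - op_poly (Q n) A) \<le> e / 2" by blast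
      with \<open>0 < e\<close> show "\<exists>M. \<forall>n\<ge>M. norm (op_poly (P n) A - op_poly (Q n) A - 0) < e"
        by (intro exI[of _ N]) fastforce
    qed
    from tendsto_add[OF this T] show "(\<lambda>n. op_poly (P n) A) \<longlonglongrightarrow> T" by simp
  qed
  moreover have "T' = T" if "?lim T'" for T'
    using that Q T LIMSEQ_unique by blast
  ultimately have "?lim (cfc f A)"
    unfolding cfc_def by (rule theI)
  with P show ?thesis by blast
qed

lemma cfc_op_poly_limit:
  assumes "form_between a b A" "continuous_on {a..b} f"
    and P: "uniform_limit {a..b} (\<lambda>n. poly (P n)) f sequentially"
  shows "(\<lambda>n. op_poly (P n) A) \<longlonglongrightarrow> cfc f A"
  by (rule cfc_limit[OF form_between_self_adjoint form_between_spectrum assms(2)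
        uniform_limit_on_subset[OF P form_between_spectrum]]) (rule assms(1))+

lemma self_adjoint_cfc:
  assumes "form_between a b A" "continuous_on {a..b} f"
  shows "self_adjoint (cfc f A)"
proof -
  obtain P where P: "uniform_limit {a..b} (\<lambda>n::nat. poly (P n)) f sequentially"
    using uniform_polynomial_approximation[OF assms(2)] by blast
  show ?thesis
    by (rule self_adjoint_limit[OF _ cfc_op_poly_limit[OF assms P]])
      (intro self_adjoint_op_poly form_between_self_adjoint[OF assms(1)])
qed

lemma cfc_eq_op_poly:
  assumes A: "form_between a b A" and eq: "\<And>x. x \<in> {a..b} \<Longrightarrow> f x = poly P x"
  shows "cfc f A = op_poly P A"
proof (rule LIMSEQ_unique)
  have f: "continuous_on {a..b} f"
    using eq by (subst continuous_on_cong[OF refl, of _ _ "poly P"]) (auto intro: continuous_intros)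
  show "(\<lambda>n. op_poly P A) \<longlonglongrightarrow> cfc f A"
    by (rule cfc_op_poly_limit[OF A f, of "\<lambda>_. P"]) (auto intro!: uniform_limitI simp: eq)
qed simp

lemma cfc_cong:
  assumes "\<And>x. x \<in> op_spectrum A \<Longrightarrow> f x = g x"
  shows "cfc f A = cfc g A"
proof -
  have "uniform_limit (op_spectrum A) (\<lambda>n. poly (P n)) f sequentially
      \<longleftrightarrow> uniform_limit (op_spectrum A) (\<lambda>n. poly (P n)) g sequentially" for P :: "nat \<Rightarrow> real poly"
    using assms by (intro uniform_limit_cong) auto
  then show ?thesis by (simp add: cfc_def)
qed

lemma cfc_cong_between:
  "form_between a b A \<Longrightarrow> (\<And>x. a \<le> x \<Longrightarrow> x \<le> b \<Longrightarrow> f x = g x) \<Longrightarrow> cfc f A = cfc g A"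
  using form_between_spectrum by (fastforce intro: cfc_cong)

lemma cfc_mult:
  assumes A: "form_between a b A" and f: "continuous_on {a..b} f" and g: "continuous_on {a..b} g"
  shows "cfc (\<lambda>x. f x * g x) A = cfc f A o\<^sub>L cfc g A"
proof -
  obtain P where P: "uniform_limit {a..b} (\<lambda>n::nat. poly (P n)) f sequentially"
    using uniform_polynomial_approximation[OF f] by blast
  obtain Q where Q: "uniform_limit {a..b} (\<lambda>n::nat. poly (Q n)) g sequentially"
    using uniform_polynomial_approximation[OF g] by blast
  have bnd: "bounded (h ` {a..b})" if "continuous_on {a..b} h" for h :: "real \<Rightarrow> real"
    by (rule compact_imp_bounded[OF compact_continuous_image[OF that compact_Icc]])
  have "uniform_limit {a..b} (\<lambda>n x. poly (P n) x * poly (Q n) x) (\<lambda>x. f x * g x) sequentially"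
    by (intro uniform_lim_mult P Q bnd f g)
  then have PQ: "uniform_limit {a..b} (\<lambda>n. poly (P n * Q n)) (\<lambda>x. f x * g x) sequentially"
    by (rule uniform_limit_cong'[THEN iffD1, rotated -1]) simp_all
  show ?thesis
  proof (rule LIMSEQ_unique)
    show "(\<lambda>n. op_poly (P n * Q n) A) \<longlonglongrightarrow> cfc (\<lambda>x. f x * g x) A"
      by (rule cfc_op_poly_limit[OF A _ PQ]) (intro continuous_intros f g)
    show "(\<lambda>n. op_poly (P n * Q n) A) \<longlonglongrightarrow> (cfc f A o\<^sub>L cfc g A)"
      unfolding op_poly_mult
      by (intro bounded_bilinear.tendsto[OF bounded_bilinear_blinfun_compose]
          cfc_op_poly_limit[OF A f P] cfc_op_poly_limit[OF A g Q])
  qed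
qed

lemma cfc_linear:
  assumes A: "form_between a b A" and f: "continuous_on {a..b} f"
  shows "cfc (\<lambda>x. c * f x + d) A = c *\<^sub>R cfc f A + d *\<^sub>R id_blinfun"
proof -
  obtain P where P: "uniform_limit {a..b} (\<lambda>n::nat. poly (P n)) f sequentially"
    using uniform_polynomial_approximation[OF f] by blast
  have "uniform_limit {a..b} (\<lambda>n x. c * poly (P n) x + d) (\<lambda>x. c * f x + d) sequentially"
    by (intro uniform_limit_add uniform_limit_const bounded_linear_uniform_limit_intros P)
  then have cP: "uniform_limit {a..b} (\<lambda>n. poly (smult c (P n) + [:d:])) (\<lambda>x. c * f x + d) sequentially"
    by (rule uniform_limit_cong'[THEN iffD1, rotated -1]) simp_all
  show ?thesis
  proof (rule LIMSEQ_unique)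
    show "(\<lambda>n. op_poly (smult c (P n) + [:d:]) A) \<longlonglongrightarrow> cfc (\<lambda>x. c * f x + d) A"
      by (rule cfc_op_poly_limit[OF A _ cP]) (intro continuous_intros f)
    show "(\<lambda>n. op_poly (smult c (P n) + [:d:]) A) \<longlonglongrightarrow> c *\<^sub>R cfc f A + d *\<^sub>R id_blinfun"
      unfolding op_poly_add op_poly_smult op_poly_const
      by (intro tendsto_intros cfc_op_poly_limit[OF A f P])
  qed
qed

lemma op_poly_pcompose_linear:
  "op_poly (pcompose P [:d, c:]) A = op_poly P (c *\<^sub>R A + d *\<^sub>R id_blinfun)"
proof (induction P)
  case (pCons a P)
  then show ?case
    by (intro blinfun_eqI)
      (simp add: pcompose_pCons op_poly_add op_poly_mult op_poly_smult op_poly_pCons_apply blinfun.bilinear_simps)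
qed simp

lemma cfc_affine_argument:
  assumes A: "form_between a b A" and f: "continuous_on {c * a + d..c * b + d} f" and c: "0 < c"
  shows "cfc f (c *\<^sub>R A + d *\<^sub>R id_blinfun) = cfc (\<lambda>x. f (c * x + d)) A"
proof -
  let ?I = "{c * a + d..c * b + d}"
  have I: "c * x + d \<in> ?I" if "x \<in> {a..b}" for x
    using that c by auto
  have A': "form_between (c * a + d) (c * b + d) (c *\<^sub>R A + d *\<^sub>R id_blinfun)"
    using A c unfolding form_between_def
    by (auto intro!: self_adjoint_add self_adjoint_scaleR
        simp: blinfun.bilinear_simps inner_add_left distrib_right mult.assoc)
  obtain P where P: "uniform_limit ?I (\<lambda>n::nat. poly (P n)) f sequentially"
    using uniform_polynomial_approximation[OF f] by blast
  have "uniform_limit {a..b} (\<lambda>n x. poly (P n) (c * x + d)) (\<lambda>x. f (c * x + d)) sequentially"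
    using uniform_limit_compose'[OF P, of "\<lambda>x. c * x + d" "{a..b}"] I by simp
  then have P': "uniform_limit {a..b} (\<lambda>n. poly (pcompose (P n) [:d, c:])) (\<lambda>x. f (c * x + d)) sequentially"
    by (rule uniform_limit_cong'[THEN iffD1, rotated -1]) (simp_all add: poly_pcompose algebra_simps)
  show ?thesis
  proof (rule LIMSEQ_unique)
    show "(\<lambda>n. op_poly (P n) (c *\<^sub>R A + d *\<^sub>R id_blinfun)) \<longlonglongrightarrow> cfc f (c *\<^sub>R A + d *\<^sub>R id_blinfun)"
      by (rule cfc_op_poly_limit[OF A' f P])
    show "(\<lambda>n. op_poly (P n) (c *\<^sub>R A + d *\<^sub>R id_blinfun)) \<longlonglongrightarrow> cfc (\<lambda>x. f (c * x + d)) A"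
      unfolding op_poly_pcompose_linear[symmetric]
      by (rule cfc_op_poly_limit[OF A continuous_on_compose2[OF f] P'])
        (use I in \<open>auto intro: continuous_intros\<close>)
  qed
qed

text \<open>An intertwining relation passes from \<open>A\<close> to its polynomials and then to their limits. Unitary
  conjugation and the inclusion of a direct summand are both instances.\<close>

lemma cfc_intertwine:
  fixes A :: "'a::complex_hilbert_space \<Rightarrow>\<^sub>L 'a" and B :: "'b::complex_hilbert_space \<Rightarrow>\<^sub>L 'b"
    and V :: "'a \<Rightarrow>\<^sub>L 'b"
  assumes A: "form_between a b A" and B: "form_between a b B" and f: "continuous_on {a..b} f"
    and V: "\<And>x. V (A x) = B (V x)"
  shows "V (cfc f A x) = cfc f B (V x)"
proof -
  have poly: "V (op_poly P A x) = op_poly P B (V x)" for P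
    by (induction P) (simp_all add: op_poly_pCons_apply blinfun.bilinear_simps V)
  obtain P where P: "uniform_limit {a..b} (\<lambda>n::nat. poly (P n)) f sequentially"
    using uniform_polynomial_approximation[OF f] by blast
  show ?thesis
  proof (rule LIMSEQ_unique)
    show "(\<lambda>n. V (op_poly (P n) A x)) \<longlonglongrightarrow> V (cfc f A x)"
      by (intro blinfun.tendsto tendsto_const cfc_op_poly_limit[OF A f P])
    show "(\<lambda>n. V (op_poly (P n) A x)) \<longlonglongrightarrow> cfc f B (V x)"
      unfolding poly by (intro blinfun.tendsto tendsto_const cfc_op_poly_limit[OF B f P])
  qed
qed

text \<open>A nonnegative \<open>f\<close> has a continuous square root, and \<open>f(A)\<close> is the square of the self-adjoint
  operator \<open>\<surd>f(A)\<close>.\<close>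

lemma cfc_nonneg:
  assumes A: "form_between a b A" and f: "continuous_on {a..b} f"
    and pos: "\<And>x. x \<in> {a..b} \<Longrightarrow> 0 \<le> f x"
  shows "0 \<le> inner (cfc f A x) x"
proof -
  have sf: "continuous_on {a..b} (\<lambda>x. sqrt (f x))" by (intro continuous_intros f)
  have "cfc f A = cfc (\<lambda>x. sqrt (f x) * sqrt (f x)) A"
    by (rule cfc_cong_between[OF A]) (use pos in auto)
  also have "\<dots> = cfc (\<lambda>x. sqrt (f x)) A o\<^sub>L cfc (\<lambda>x. sqrt (f x)) A"
    by (rule cfc_mult[OF A sf sf])
  finally show ?thesis
    using self_adjoint_inner[OF self_adjoint_cfc[OF A sf], of "cfc (\<lambda>x. sqrt (f x)) A x" x]
      inner_ge_zero by simp
qed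

lemma cfc_add:
  assumes A: "form_between a b A" and f: "continuous_on {a..b} f" and g: "continuous_on {a..b} g"
  shows "cfc (\<lambda>x. f x + g x) A = cfc f A + cfc g A"
proof -
  obtain P where P: "uniform_limit {a..b} (\<lambda>n::nat. poly (P n)) f sequentially"
    using uniform_polynomial_approximation[OF f] by blast
  obtain Q where Q: "uniform_limit {a..b} (\<lambda>n::nat. poly (Q n)) g sequentially"
    using uniform_polynomial_approximation[OF g] by blast
  have "uniform_limit {a..b} (\<lambda>n x. poly (P n) x + poly (Q n) x) (\<lambda>x. f x + g x) sequentially"
    by (intro uniform_limit_add P Q)
  then have PQ: "uniform_limit {a..b} (\<lambda>n. poly (P n + Q n)) (\<lambda>x. f x + g x) sequentially"
    by (rule uniform_limit_cong'[THEN iffD1, rotated -1]) simp_all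
  show ?thesis
  proof (rule LIMSEQ_unique)
    show "(\<lambda>n. op_poly (P n + Q n) A) \<longlonglongrightarrow> cfc (\<lambda>x. f x + g x) A"
      by (rule cfc_op_poly_limit[OF A _ PQ]) (intro continuous_intros f g)
    show "(\<lambda>n. op_poly (P n + Q n) A) \<longlonglongrightarrow> cfc f A + cfc g A"
      unfolding op_poly_add
      by (intro tendsto_intros cfc_op_poly_limit[OF A f P] cfc_op_poly_limit[OF A g Q])
  qed
qed

lemma cfc_mono:
  assumes A: "form_between a b A" and f: "continuous_on {a..b} f" and g: "continuous_on {a..b} g"
    and le: "\<And>x. x \<in> {a..b} \<Longrightarrow> f x \<le> g x"
  shows "inner (cfc f A x) x \<le> inner (cfc g A x) x"
proof -
  have d: "continuous_on {a..b} (\<lambda>x. g x - f x)" by (intro continuous_intros f g)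
  have "cfc g A = cfc (\<lambda>x. f x + (g x - f x)) A" by simp
  also have "\<dots> = cfc f A + cfc (\<lambda>x. g x - f x) A" by (rule cfc_add[OF A f d])
  finally have "inner (cfc g A x) x = inner (cfc f A x) x + inner (cfc (\<lambda>x. g x - f x) A x) x"
    by (simp add: blinfun.bilinear_simps inner_add_left)
  moreover have "0 \<le> inner (cfc (\<lambda>x. g x - f x) A x) x"
    by (rule cfc_nonneg[OF A d]) (simp add: le)
  ultimately show ?thesis by linarith
qed

lemma cfc_const:
  assumes "form_between a b A"
  shows "cfc (\<lambda>_. c) A = c *\<^sub>R id_blinfun"
  using cfc_eq_op_poly[OF assms, of "\<lambda>_. c" "[:c:]"] by (simp add: op_poly_const)

lemma cfc_ident:
  assumes "form_between a b A"
  shows "cfc (\<lambda>x. x) A = A"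
  using cfc_eq_op_poly[OF assms, of "\<lambda>x. x" "[:0, 1:]"] by (simp add: op_poly_X)

lemma cfc_form_between:
  assumes A: "form_between a b A" and f: "continuous_on {a..b} f"
    and bounds: "\<And>x. x \<in> {a..b} \<Longrightarrow> c \<le> f x \<and> f x \<le> d"
  shows "form_between c d (cfc f A)"
  unfolding form_between_def
proof (intro conjI allI)
  show "self_adjoint (cfc f A)" by (rule self_adjoint_cfc[OF A f])
  show "c * inner x x \<le> inner (cfc f A x) x" for x
    using cfc_mono[OF A continuous_on_const f, of c x] bounds
    by (simp add: cfc_const[OF A] blinfun.bilinear_simps)
  show "inner (cfc f A x) x \<le> d * inner x x" for x
    using cfc_mono[OF A f continuous_on_const, of d x] bounds
    by (simp add: cfc_const[OF A] blinfun.bilinear_simps)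
qed

lemma cfc_positive_definite:
  assumes A: "form_between a b A" and f: "continuous_on {a..b} f"
    and pos: "\<And>x. x \<in> {a..b} \<Longrightarrow> 0 < f x"
  shows "positive_definite (cfc f A)"
proof (cases "a \<le> b")
  case True
  then obtain u where u: "u \<in> {a..b}" "\<And>x. x \<in> {a..b} \<Longrightarrow> f u \<le> f x"
    using continuous_attains_inf[OF compact_Icc _ f] by auto
  from True obtain v where v: "v \<in> {a..b}" "\<And>x. x \<in> {a..b} \<Longrightarrow> f x \<le> f v"
    using continuous_attains_sup[OF compact_Icc _ f] by auto
  have "form_between (f u) (f v) (cfc f A)"
    by (rule cfc_form_between[OF A f]) (simp add: u v)
  with pos[OF u(1)] show ?thesis by (rule form_between_positive_definite)
next
  case False
  then have "form_between 1 1 (cfc f A)"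
    by (intro cfc_form_between[OF A f]) auto
  then show ?thesis by (intro form_between_positive_definite[of 1]) auto
qed

section \<open>Operator monotonicity on arbitrary Hilbert spaces\<close>

lemma scaleC_zero_left [simp]: "0 *\<^sub>C (x :: 'h::complex_hilbert_space) = 0"
  using scaleC_of_real[of 0 x] by simp

lemma cinner_sum_left: "cinner (\<Sum>i\<in>I. f i) y = (\<Sum>i\<in>I. cinner (f i) y)"
  by (induction I rule: infinite_finite_induct) (simp_all add: cinner_add_left)

text \<open>The induction step is that of Gram and Schmidt: the part \<open>r\<close> of the new vector orthogonal to the frame
  \<open>u\<close> found so far is normalised and appended, unless it vanishes.\<close>

lemma finite_orthonormal_frame:
  fixes w :: "nat \<Rightarrow> 'h::complex_hilbert_space"
  shows "\<exists>u d. (\<forall>i<d. \<forall>j<d. cinner (u i) (u j) = (if i = j then 1 else 0)) \<and>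
    (\<forall>k<n. w k = (\<Sum>i<d::nat. cinner (w k) (u i) *\<^sub>C u i))"
proof (induction n)
  case 0
  show ?case by (intro exI[of _ undefined] exI[of _ 0]) simp
next
  case (Suc n)
  then obtain u and d :: nat where orth: "\<And>i j. i < d \<Longrightarrow> j < d \<Longrightarrow> cinner (u i) (u j) = (if i = j then 1 else 0)"
    and span: "\<And>k. k < n \<Longrightarrow> w k = (\<Sum>i<d. cinner (w k) (u i) *\<^sub>C u i)" by blast
  define s where "s = (\<Sum>i<d. cinner (w n) (u i) *\<^sub>C u i)"
  define r where "r = w n - s"
  have s_u: "cinner s (u j) = cinner (w n) (u j)" if "j < d" for j
  proof -
    have "cinner s (u j) = (\<Sum>i<d. if i = j then cinner (w n) (u j) else 0)"
      unfolding s_def cinner_sum_left cinner_scaleC_left using that by (intro sum.cong) (simp_all add: orth)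
    also have "\<dots> = cinner (w n) (u j)" using that by simp
    finally show ?thesis .
  qed
  have r_u: "cinner r (u j) = 0" if "j < d" for j
    using s_u[OF that] by (simp add: r_def cinner_diff_left)
  have u_r: "cinner (u j) r = 0" if "j < d" for j
    using r_u[OF that] cinner_commute[of "u j" r] by simp
  show ?case
  proof (cases "r = 0")
    case True
    have "w k = (\<Sum>i<d. cinner (w k) (u i) *\<^sub>C u i)" if "k < Suc n" for k
    proof (cases "k = n")
      case True
      with \<open>r = 0\<close> show ?thesis unfolding r_def s_def by simp
    next
      case False
      with that show ?thesis by (intro span) simp
    qed
    with orth show ?thesis by blast
  next
    case False
    define u' where "u' = u(d := (1 / norm r) *\<^sub>R r)"
    have u'_old: "u' i = u i" if "i < d" for i using that by (simp add: u'_def)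
    have u'_d: "u' d = (1 / norm r) *\<^sub>R r" by (simp add: u'_def)
    have rr: "cinner r r = of_real ((norm r)\<^sup>2)"
      by (simp add: cinner_self power2_norm_eq_inner)
    have "cinner (u' i) (u' j) = (if i = j then 1 else 0)" if "i < Suc d" "j < Suc d" for i j
      using that False
      by (cases "i = d"; cases "j = d")
        (auto simp: u'_old u'_d orth r_u u_r cinner_simps rr power2_eq_square)
    moreover have "w k = (\<Sum>i<Suc d. cinner (w k) (u' i) *\<^sub>C u' i)" if "k < Suc n" for k
    proof -
      have old: "(\<Sum>i<d. cinner (w k) (u' i) *\<^sub>C u' i) = (\<Sum>i<d. cinner (w k) (u i) *\<^sub>C u i)"
        by (intro sum.cong) (simp_all add: u'_old)
      show ?thesis
      proof (cases "k = n")
        case True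
        have "cinner s r = 0"
          unfolding s_def cinner_sum_left cinner_scaleC_left by (simp add: u_r)
        then have "cinner (w n) r = cinner r r"
          using cinner_add_left[of s r r] by (simp add: r_def)
        then have "cinner (w n) (u' d) = of_real (norm r)"
          using \<open>r \<noteq> 0\<close> rr by (simp add: u'_d cinner_scaleR_right power2_eq_square)
        then have "cinner (w n) (u' d) *\<^sub>C u' d = r"
          using \<open>r \<noteq> 0\<close> by (simp add: u'_d scaleC_of_real)
        moreover have "w n = s + r" by (simp add: r_def)
        ultimately show ?thesis unfolding True sum.lessThan_Suc old[unfolded True] s_def by metis
      next
        case False
        then have "k < n" using that by simp
        have "cinner (w k) r = cinner (\<Sum>i<d. cinner (w k) (u i) *\<^sub>C u i) r"
          using span[OF \<open>k < n\<close>] by metis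
        also have "\<dots> = 0"
          unfolding cinner_sum_left cinner_scaleC_left by (simp add: u_r)
        finally have "cinner (w k) (u' d) = 0" by (simp add: u'_d cinner_scaleR_right)
        then show ?thesis
          unfolding sum.lessThan_Suc old using span[OF \<open>k < n\<close>] by (metis scaleC_zero_left add_0_right)
      qed
    qed
    ultimately show ?thesis by blast
  qed
qed

text \<open>\<open>V\<close> sends the first unit vectors of \<^typ>\<open>ell2\<close> to an orthonormal frame for the given vectors and
  annihilates the others. It is a partial isometry with adjoint \<open>W\<close>, so \<open>V W\<close> is the projection onto the
  span of the frame.\<close>

lemma finite_frame_isometry:
  fixes w :: "nat \<Rightarrow> 'h::complex_hilbert_space"
  obtains V :: "ell2 \<Rightarrow>\<^sub>L 'h" and W :: "'h \<Rightarrow>\<^sub>L ell2"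
    where "\<And>x y. cinner (V x) y = cinner x (W y)" "\<And>x. norm (V x) \<le> norm x"
      "\<And>k. k < n \<Longrightarrow> V (W (w k)) = w k"
proof -
  obtain u and d :: nat where orth: "\<And>i j. i < d \<Longrightarrow> j < d \<Longrightarrow> cinner (u i) (u j) = (if i = j then 1 else 0)"
    and span: "\<And>k. k < n \<Longrightarrow> w k = (\<Sum>i<d. cinner (w k) (u i) *\<^sub>C u i)"
    using finite_orthonormal_frame[of n w] by blast
  define v where "v x = (\<Sum>i<d. ell2_nth x i *\<^sub>C u i)" for x
  have "bounded_linear v"
  proof (rule bounded_linear_intro[where K = "\<Sum>i<d. norm (u i)"])
    show "v (x + y) = v x + v y" for x y
      by (simp add: v_def ell2_nth_simps scaleC_add_left sum.distrib)
    have "(complex_of_real r * c) *\<^sub>C y = r *\<^sub>R c *\<^sub>C y" for r c and y :: 'h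
      by (metis scaleC_scaleC scaleC_of_real)
    then show "v (r *\<^sub>R x) = r *\<^sub>R v x" for r x
      by (simp add: v_def ell2_nth_simps scaleR_sum_right)
    show "norm (v x) \<le> norm x * (\<Sum>i<d. norm (u i))" for x
      unfolding v_def sum_distrib_left
      by (intro order_trans[OF norm_sum sum_mono]) (simp add: norm_scaleC mult_right_mono ell2_nth_le_norm)
  qed
  then have V: "Blinfun v x = v x" for x by (simp add: bounded_linear_Blinfun_apply)
  define f where "f y = Abs_ell2 (\<lambda>i. if i < d then cinner y (u i) else 0)" for y
  have f_nth: "ell2_nth (f y) i = (if i < d then cinner y (u i) else 0)" for y i
  proof -
    have "summable (\<lambda>n. (cmod (if n < d then cinner y (u n) else 0))\<^sup>2)"
      by (rule summable_finite[of "{..<d}"]) auto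
    then show ?thesis by (simp add: f_def Abs_ell2_inverse)
  qed
  have adj: "cinner (v x) y = cinner x (f y)" for x y
  proof -
    have "cinner x (f y) = (\<Sum>i<d. ell2_nth x i * cnj (ell2_nth (f y) i))"
      unfolding cinner_ell2_def by (intro suminf_finite) (auto simp: f_nth)
    also have "\<dots> = (\<Sum>i<d. ell2_nth x i * cinner (u i) y)"
      by (intro sum.cong) (simp_all add: f_nth cinner_commute[of "u _" y])
    finally show ?thesis by (simp add: v_def cinner_sum_left cinner_scaleC_left)
  qed
  have adj': "inner (v x) y = inner x (f y)" for x y
    using adj[of x y] by (simp add: Re_cinner[symmetric])
  have "bounded_linear f"
  proof (rule bounded_linear_intro[where K = "norm (Blinfun v)"])
    show "f (x + y) = f x + f y" for x y
      by (rule ell2_eqI) (simp add: f_nth ell2_nth_simps cinner_add_left)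
    show "f (r *\<^sub>R x) = r *\<^sub>R f x" for r x
      by (rule ell2_eqI) (simp add: f_nth ell2_nth_simps cinner_scaleR_left)
    show "norm (f y) \<le> norm y * norm (Blinfun v)" for y
    proof -
      have "(norm (f y))\<^sup>2 = inner (v (f y)) y" by (simp add: adj' power2_norm_eq_inner)
      also have "\<dots> \<le> norm (v (f y)) * norm y" by (rule norm_cauchy_schwarz)
      also have "\<dots> \<le> (norm (Blinfun v) * norm (f y)) * norm y"
        using norm_blinfun[of "Blinfun v" "f y"] by (intro mult_right_mono) (simp_all add: V)
      finally show ?thesis
        by (cases "norm (f y) = 0") (simp_all add: power2_eq_square algebra_simps)
    qed
  qed
  then have W: "Blinfun f y = f y" for y by (simp add: bounded_linear_Blinfun_apply)
  have vfv: "v (f (v x)) = v x" for x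
  proof -
    have "ell2_nth (f (v x)) i = ell2_nth x i" if "i < d" for i
    proof -
      have "ell2_nth (f (v x)) i = (\<Sum>j<d. ell2_nth x j * cinner (u j) (u i))"
        unfolding f_nth v_def cinner_sum_left cinner_scaleC_left using that by simp
      also have "\<dots> = (\<Sum>j<d. if j = i then ell2_nth x i else 0)"
        using that by (intro sum.cong) (simp_all add: orth)
      finally show ?thesis using that by simp
    qed
    then show ?thesis by (simp add: v_def)
  qed
  have "norm (v x) \<le> norm x" for x
  proof -
    have eq: "norm (f (v x)) = norm (v x)"
      by (simp add: norm_eq_sqrt_inner adj'[symmetric] vfv)
    have "(norm (v x))\<^sup>2 = inner x (f (v x))" by (simp add: adj'[symmetric] power2_norm_eq_inner)
    also have "\<dots> \<le> norm x * norm (v x)" using norm_cauchy_schwarz[of x "f (v x)"] eq by simp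
    finally show ?thesis by (cases "norm (v x) = 0") (simp_all add: power2_eq_square)
  qed
  moreover have "v (f (w k)) = w k" if "k < n" for k
  proof -
    have "v (f (w k)) = (\<Sum>i<d. cinner (w k) (u i) *\<^sub>C u i)"
      unfolding v_def by (intro sum.cong) (simp_all add: f_nth)
    then show ?thesis using span[OF that] by metis
  qed
  ultimately show ?thesis
    using that[of "Blinfun v" "Blinfun f"] adj by (simp add: V W)
qed

lemma op_poly_apply: "op_poly P A x = (\<Sum>i\<le>degree P. coeff P i *\<^sub>R (blinfun_apply A ^^ i) x)"
proof -
  have "(((o\<^sub>L) A ^^ i) id_blinfun) x = (blinfun_apply A ^^ i) x" for i
    by (induction i) simp_all
  then show ?thesis
    by (simp add: op_poly_def blinfun.sum_left blinfun.scaleR_left)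
qed

lemma cfc_op_poly_close:
  assumes A: "form_between a b A" and f: "continuous_on {a..b} f"
    and close: "\<And>x. x \<in> {a..b} \<Longrightarrow> \<bar>poly P x - f x\<bar> \<le> e"
  shows "\<bar>inner (op_poly P A x) x - inner (cfc f A x) x\<bar> \<le> e * inner x x"
proof -
  have up: "cfc (\<lambda>x. poly P x + e) A = op_poly P A + e *\<^sub>R id_blinfun"
    using cfc_eq_op_poly[OF A, of "\<lambda>x. poly P x + e" "P + [:e:]"] by (simp add: op_poly_add op_poly_const)
  have lo: "cfc (\<lambda>x. poly P x + - e) A = op_poly P A + (- e) *\<^sub>R id_blinfun"
    using cfc_eq_op_poly[OF A, of "\<lambda>x. poly P x + - e" "P + [:- e:]"] by (simp add: op_poly_add op_poly_const)
  have "inner (cfc f A x) x \<le> inner (cfc (\<lambda>x. poly P x + e) A x) x"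
    by (rule cfc_mono[OF A f]) (use close in \<open>force intro!: continuous_intros simp: abs_le_iff\<close>)+
  moreover have "inner (cfc (\<lambda>x. poly P x + - e) A x) x \<le> inner (cfc f A x) x"
    by (rule cfc_mono[OF A _ f]) (use close in \<open>force intro!: continuous_intros simp: abs_le_iff\<close>)+
  ultimately show ?thesis
    unfolding up lo by (simp add: blinfun.bilinear_simps inner_add_left inner_diff_left abs_le_iff)
qed

text \<open>The compression \<open>W A V\<close> of \<open>A\<close> to \<^typ>\<open>ell2\<close>, filled up by \<open>a\<close> on the kernel of \<open>V\<close> so that
  the form bounds of \<open>A\<close> survive.\<close>

definition compression ::
  "(ell2 \<Rightarrow>\<^sub>L 'h) \<Rightarrow> ('h \<Rightarrow>\<^sub>L ell2) \<Rightarrow> real \<Rightarrow> ('h::complex_hilbert_space \<Rightarrow>\<^sub>L 'h) \<Rightarrow> (ell2 \<Rightarrow>\<^sub>L ell2)" where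
  "compression V W a A = (W o\<^sub>L A o\<^sub>L V) + a *\<^sub>R (id_blinfun - (W o\<^sub>L V))"

context
  fixes V :: "ell2 \<Rightarrow>\<^sub>L 'h::complex_hilbert_space" and W :: "'h \<Rightarrow>\<^sub>L ell2"
  assumes adj: "cinner (V x) y = cinner x (W y)" and V_le: "norm (V x) \<le> norm x"
begin

lemma compression_adjoint: "inner (W y) x = inner y (V x)"
  by (metis adj Re_cinner inner_commute)

lemma inner_compression:
  "inner (compression V W a A x) x = inner (A (V x)) (V x) + a * (inner x x - inner (V x) (V x))"
  by (simp add: compression_def blinfun.bilinear_simps inner_add_left inner_diff_left compression_adjoint)

lemma self_adjoint_compression: "self_adjoint A \<Longrightarrow> self_adjoint (compression V W a A)"
proof -
  have "W o\<^sub>L V = W o\<^sub>L id_blinfun o\<^sub>L V" by (rule blinfun_eqI) simp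
  then have "self_adjoint (W o\<^sub>L V)"
    using self_adjoint_conjugate[OF self_adjoint_id adj] by simp
  then show "self_adjoint A \<Longrightarrow> self_adjoint (compression V W a A)"
    unfolding compression_def
    by (intro self_adjoint_add self_adjoint_scaleR self_adjoint_diff self_adjoint_id
        self_adjoint_conjugate adj)
qed

lemma form_between_compression:
  assumes "form_between a b A" "a \<le> b"
  shows "form_between a b (compression V W a A)"
  unfolding form_between_def
proof (intro conjI allI)
  show "self_adjoint (compression V W a A)"
    by (rule self_adjoint_compression[OF form_between_self_adjoint[OF assms(1)]])
  fix x
  have A: "a * inner (V x) (V x) \<le> inner (A (V x)) (V x)" "inner (A (V x)) (V x) \<le> b * inner (V x) (V x)"
    using assms(1) by (simp_all add: form_between_def)
  show "a * inner x x \<le> inner (compression V W a A x) x"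
    using A(1) by (simp add: inner_compression algebra_simps)
  have "inner (V x) (V x) \<le> inner x x"
    using power_mono[OF V_le[of x], of 2] by (simp add: power2_norm_eq_inner)
  then have "0 \<le> (b - a) * (inner x x - inner (V x) (V x))"
    using assms(2) by (intro mult_nonneg_nonneg) auto
  then show "inner (compression V W a A x) x \<le> b * inner x x"
    using A(2) by (simp add: inner_compression algebra_simps)
qed

text \<open>While \<open>V W\<close> fixes the vectors \<open>A^k \<xi>\<close>, the powers of the compression follow those of \<open>A\<close>.\<close>

lemma inner_op_poly_compression:
  assumes fixed: "\<And>k. k \<le> degree P \<Longrightarrow> V (W ((blinfun_apply A ^^ k) \<xi>)) = (blinfun_apply A ^^ k) \<xi>"
  shows "inner (op_poly P (compression V W a A) (W \<xi>)) (W \<xi>) = inner (op_poly P A \<xi>) \<xi>"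
proof -
  have pow: "(blinfun_apply (compression V W a A) ^^ k) (W \<xi>) = W ((blinfun_apply A ^^ k) \<xi>)"
    if "k \<le> degree P" for k
    using that
  proof (induction k)
    case (Suc k)
    then show ?case using fixed[of k] by (simp add: compression_def blinfun.bilinear_simps)
  qed simp
  have "op_poly P (compression V W a A) (W \<xi>) = W (op_poly P A \<xi>)"
    unfolding op_poly_apply by (simp add: pow blinfun.sum_right blinfun.scaleR_right)
  moreover have "V (W (op_poly P A \<xi>)) = op_poly P A \<xi>"
    unfolding op_poly_apply by (simp add: fixed blinfun.sum_right blinfun.scaleR_right)
  ultimately show ?thesis
    by (metis compression_adjoint inner_commute)
qed

lemma norm_partial_isometry_adjoint_le: "norm (W y) \<le> norm y"
proof -
  have "(norm (W y))\<^sup>2 \<le> norm y * norm (W y)"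
    using order_trans[OF norm_cauchy_schwarz[of y "V (W y)"] mult_left_mono[OF V_le[of "W y"], of "norm y"]]
    by (simp add: power2_norm_eq_inner compression_adjoint)
  then show ?thesis by (cases "norm (W y) = 0") (simp_all add: power2_eq_square)
qed

end

text \<open>The assumption on \<open>g\<close> concerns operators on \<^typ>\<open>ell2\<close>, the conclusion any Hilbert space. Fix \<open>\<xi>\<close> and approximate
  \<open>g\<close> uniformly by a polynomial \<open>P\<close>. The numbers \<open>\<langle>P(A) \<xi>, \<xi>\<rangle>\<close> and \<open>\<langle>P(B) \<xi>, \<xi>\<rangle>\<close> depend only on
  the finitely many vectors \<open>A^k \<xi>\<close> and \<open>B^k \<xi>\<close> with \<open>k \<le> degree P\<close>; they do not change when \<open>A\<close> and \<open>B\<close>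
  are compressed to the span of these vectors, which embeds into \<^typ>\<open>ell2\<close>. Compression preserves
  the order.\<close>

lemma operator_monotone_decreasing_transfer:
  fixes A B :: "'h::complex_hilbert_space \<Rightarrow>\<^sub>L 'h"
  assumes g: "operator_monotone_decreasing g"
    and A: "positive_definite A" and B: "positive_definite B" and BA: "B \<preceq> A"
  shows "inner (cfc g A \<xi>) \<xi> \<le> inner (cfc g B \<xi>) \<xi>"
proof -
  obtain a1 b1 where 1: "0 < a1" "a1 \<le> b1" "form_between a1 b1 A"
    using positive_definite_form_between[OF A] .
  obtain a2 b2 where 2: "0 < a2" "a2 \<le> b2" "form_between a2 b2 B"
    using positive_definite_form_between[OF B] .
  define a where "a = min a1 a2"
  define b where "b = max b1 b2"
  have ab: "0 < a" "a \<le> b" using 1 2 by (auto simp: a_def b_def)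
  have Aab: "form_between a b A" and Bab: "form_between a b B"
    using form_between_mono[OF 1(3), of a b] form_between_mono[OF 2(3), of a b]
    by (simp_all add: a_def b_def)
  have cont: "continuous_on {a..b} g"
    using g ab(1) unfolding operator_monotone_decreasing_def
    by (auto intro: continuous_on_subset)
  have close: "inner (cfc g A \<xi>) \<xi> \<le> inner (cfc g B \<xi>) \<xi> + 4 * e * inner \<xi> \<xi>" if e: "0 < e" for e
  proof -
    obtain Q where "uniform_limit {a..b} (\<lambda>n::nat. poly (Q n)) g sequentially"
      using uniform_polynomial_approximation[OF cont] .
    from uniform_limitD[OF this e] obtain P where P: "\<And>x. x \<in> {a..b} \<Longrightarrow> \<bar>poly P x - g x\<bar> \<le> e"
      unfolding eventually_sequentially dist_real_def by (meson less_imp_le order_refl)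
    define w where "w k = (if even k then (blinfun_apply A ^^ (k div 2)) \<xi>
      else (blinfun_apply B ^^ (k div 2)) \<xi>)" for k :: nat
    obtain V :: "ell2 \<Rightarrow>\<^sub>L 'h" and W :: "'h \<Rightarrow>\<^sub>L ell2" where
      adj: "\<And>x y. cinner (V x) y = cinner x (W y)" and V_le: "\<And>x. norm (V x) \<le> norm x"
      and fixed: "\<And>k. k < 2 * degree P + 2 \<Longrightarrow> V (W (w k)) = w k"
      by (rule finite_frame_isometry[of "2 * degree P + 2" w]) blast
    have fixedA: "V (W ((blinfun_apply A ^^ k) \<xi>)) = (blinfun_apply A ^^ k) \<xi>" if "k \<le> degree P" for k
      using fixed[of "2 * k"] that by (simp add: w_def)
    have fixedB: "V (W ((blinfun_apply B ^^ k) \<xi>)) = (blinfun_apply B ^^ k) \<xi>" if "k \<le> degree P" for k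
      using fixed[of "2 * k + 1"] that by (simp add: w_def)
    let ?A = "compression V W a A" and ?B = "compression V W a B"
    let ?\<eta> = "W \<xi>"
    have A': "form_between a b ?A" and B': "form_between a b ?B"
      using form_between_compression[OF adj V_le] Aab Bab ab(2) by blast+
    have "inner (?B x) x \<le> inner (?A x) x" for x
      using BA unfolding inner_compression[OF adj V_le] op_le_iff by simp
    then have "?B \<preceq> ?A"
      using form_between_self_adjoint A' B' by (auto simp: op_le_iff)
    then have "cfc g ?A \<preceq> cfc g ?B"
      using g A' B' ab(1) form_between_positive_definite
      unfolding operator_monotone_decreasing_def by blast
    then have le: "inner (cfc g ?A ?\<eta>) ?\<eta> \<le> inner (cfc g ?B ?\<eta>) ?\<eta>"
      by (simp add: op_le_iff)
    have \<eta>: "e * inner ?\<eta> ?\<eta> \<le> e * inner \<xi> \<xi>"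
      using power_mono[OF norm_partial_isometry_adjoint_le[OF adj V_le, of \<xi>], of 2] e
      by (simp add: power2_norm_eq_inner)
    have "inner (op_poly P ?A ?\<eta>) ?\<eta> = inner (op_poly P A \<xi>) \<xi>"
      "inner (op_poly P ?B ?\<eta>) ?\<eta> = inner (op_poly P B \<xi>) \<xi>"
      by (simp_all add: inner_op_poly_compression[OF adj V_le] fixedA fixedB)
    then show ?thesis
      using cfc_op_poly_close[OF Aab cont P, of \<xi>] cfc_op_poly_close[OF Bab cont P, of \<xi>]
        cfc_op_poly_close[OF A' cont P, of ?\<eta>] cfc_op_poly_close[OF B' cont P, of ?\<eta>] le \<eta>
      unfolding abs_le_iff by linarith
  qed
  show ?thesis
  proof (rule field_le_epsilon)
    fix d :: real assume d: "0 < d"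
    define e where "e = d / (4 * (inner \<xi> \<xi> + 1))"
    have pos: "0 < 4 * (inner \<xi> \<xi> + 1)" by (simp add: add_nonneg_pos)
    then have "0 < e" using d by (simp add: e_def)
    moreover have "4 * e * inner \<xi> \<xi> \<le> d"
    proof -
      have "4 * e * inner \<xi> \<xi> \<le> e * (4 * (inner \<xi> \<xi> + 1))" using \<open>0 < e\<close> by (simp add: algebra_simps)
      also have "\<dots> = d" using pos by (simp add: e_def)
      finally show ?thesis .
    qed
    ultimately show "inner (cfc g A \<xi>) \<xi> \<le> inner (cfc g B \<xi>) \<xi> + d"
      using close[of e] by linarith
  qed
qed

section \<open>Functions and inverses of positive definite operators\<close>

lemma positive_definite_cfcE:
  assumes "positive_definite A" "continuous_on {0<..} f"
  obtains a b where "0 < a" "a \<le> b" "form_between a b A" "continuous_on {a..b} f"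
proof -
  obtain a b where "0 < a" "a \<le> b" "form_between a b A"
    using positive_definite_form_between[OF assms(1)] .
  then show ?thesis
    using that continuous_on_subset[OF assms(2), of "{a..b}"] by (simp add: subset_iff)
qed

lemma pd_cfc_cong:
  assumes "positive_definite A" "\<And>x. 0 < x \<Longrightarrow> f x = g x"
  shows "cfc f A = cfc g A"
proof -
  obtain a b where "0 < a" "a \<le> b" "form_between a b A"
    using positive_definite_form_between[OF assms(1)] .
  with assms(2) show ?thesis by (intro cfc_cong_between) auto
qed

lemma pd_cfc_positive_definite:
  assumes "positive_definite A" "continuous_on {0<..} f" "\<And>x. 0 < x \<Longrightarrow> 0 < f x"
  shows "positive_definite (cfc f A)"
proof -
  obtain a b where "0 < a" "a \<le> b" "form_between a b A" "continuous_on {a..b} f"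
    using positive_definite_cfcE[OF assms(1,2)] .
  with assms(3) show ?thesis by (intro cfc_positive_definite[of a b]) auto
qed

lemma pd_cfc_const: "positive_definite A \<Longrightarrow> cfc (\<lambda>_. c) A = c *\<^sub>R id_blinfun"
  by (elim positive_definite_form_between) (rule cfc_const)

lemma pd_cfc_ident: "positive_definite A \<Longrightarrow> cfc (\<lambda>x. x) A = A"
  by (elim positive_definite_form_between) (rule cfc_ident)

lemma pd_cfc_mult:
  assumes "positive_definite A" "continuous_on {0<..} f" "continuous_on {0<..} g"
  shows "cfc (\<lambda>x. f x * g x) A = cfc f A o\<^sub>L cfc g A"
proof -
  obtain a b where ab: "0 < a" "a \<le> b" "form_between a b A" "continuous_on {a..b} f"
    using positive_definite_cfcE[OF assms(1,2)] .
  then have "continuous_on {a..b} g"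
    using continuous_on_subset[OF assms(3), of "{a..b}"] by (simp add: subset_iff)
  with ab show ?thesis by (intro cfc_mult)
qed

lemma pd_cfc_linear:
  assumes "positive_definite A" "continuous_on {0<..} f"
  shows "cfc (\<lambda>x. c * f x + d) A = c *\<^sub>R cfc f A + d *\<^sub>R id_blinfun"
proof -
  obtain a b where "0 < a" "a \<le> b" "form_between a b A" "continuous_on {a..b} f"
    using positive_definite_cfcE[OF assms] .
  then show ?thesis by (intro cfc_linear)
qed

lemma pd_cfc_mono:
  assumes "positive_definite A" "continuous_on {0<..} f" "continuous_on {0<..} g"
    and "\<And>x. 0 < x \<Longrightarrow> f x \<le> g x"
  shows "inner (cfc f A x) x \<le> inner (cfc g A x) x"
proof -
  obtain a b where ab: "0 < a" "a \<le> b" "form_between a b A" "continuous_on {a..b} f"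
    using positive_definite_cfcE[OF assms(1,2)] .
  then have "continuous_on {a..b} g"
    using continuous_on_subset[OF assms(3), of "{a..b}"] by (simp add: subset_iff)
  with ab assms(4) show ?thesis by (intro cfc_mono) auto
qed

lemma pd_cfc_scale:
  assumes "positive_definite A" "continuous_on {0<..} f" "0 < k"
  shows "cfc f (k *\<^sub>R A) = cfc (\<lambda>x. f (k * x)) A"
proof -
  obtain a b where ab: "0 < a" "a \<le> b" "form_between a b A"
    using positive_definite_form_between[OF assms(1)] .
  have "continuous_on {k * a + 0..k * b + 0} f"
    by (rule continuous_on_subset[OF assms(2)]) (use ab assms(3) in \<open>auto intro: less_le_trans[of 0 "k * a"]\<close>)
  from cfc_affine_argument[OF ab(3) this assms(3)] show ?thesis by simp
qed

lemma pd_cfc_reciprocal: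
  assumes "positive_definite A" "continuous_on {0<..} f" "\<And>x. 0 < x \<Longrightarrow> 0 < f x"
  shows "cfc f A (cfc (\<lambda>x. 1 / f x) A x) = x" "cfc (\<lambda>x. 1 / f x) A (cfc f A x) = x"
proof -
  have r: "continuous_on {0<..} (\<lambda>x. 1 / f x)"
    using assms(2,3) by (intro continuous_intros) (auto simp: less_imp_neq[symmetric])
  have nz: "x > 0 \<Longrightarrow> f x \<noteq> 0" for x using assms(3)[of x] by simp
  have "cfc f A o\<^sub>L cfc (\<lambda>x. 1 / f x) A = cfc (\<lambda>x. f x * (1 / f x)) A"
    by (rule pd_cfc_mult[OF assms(1,2) r, symmetric])
  also have "\<dots> = cfc (\<lambda>_. 1) A"
    by (rule pd_cfc_cong[OF assms(1)]) (simp add: nz)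
  finally have 1: "cfc f A o\<^sub>L cfc (\<lambda>x. 1 / f x) A = id_blinfun"
    by (simp add: pd_cfc_const[OF assms(1)])
  have "cfc (\<lambda>x. 1 / f x) A o\<^sub>L cfc f A = cfc (\<lambda>x. 1 / f x * f x) A"
    by (rule pd_cfc_mult[OF assms(1) r assms(2), symmetric])
  also have "\<dots> = cfc (\<lambda>_. 1) A"
    by (rule pd_cfc_cong[OF assms(1)]) (simp add: nz)
  finally have 2: "cfc (\<lambda>x. 1 / f x) A o\<^sub>L cfc f A = id_blinfun"
    by (simp add: pd_cfc_const[OF assms(1)])
  show "cfc f A (cfc (\<lambda>x. 1 / f x) A x) = x" "cfc (\<lambda>x. 1 / f x) A (cfc f A x) = x"
    using arg_cong[OF 1, of "\<lambda>T. blinfun_apply T x"] arg_cong[OF 2, of "\<lambda>T. blinfun_apply T x"] by simp_all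
qed

lemma continuous_on_powr_pos: "continuous_on {0<..} (\<lambda>x::real. x powr r)"
  by (intro continuous_intros) auto

lemma op_powr_positive_definite: "positive_definite A \<Longrightarrow> positive_definite (op_powr A r)"
  unfolding op_powr_def by (rule pd_cfc_positive_definite[OF _ continuous_on_powr_pos]) auto

lemma op_powr_compose: "positive_definite A \<Longrightarrow> op_powr A r o\<^sub>L op_powr A s = op_powr A (r + s)"
  unfolding op_powr_def pd_cfc_mult[OF _ continuous_on_powr_pos continuous_on_powr_pos, symmetric]
  by (simp add: powr_add)

lemma op_powr_0: "positive_definite A \<Longrightarrow> op_powr A 0 = id_blinfun"
  using pd_cfc_cong[of A "\<lambda>x. x powr 0" "\<lambda>_. 1"] pd_cfc_const[of A 1] by (simp add: op_powr_def)

lemma op_powr_1: "positive_definite A \<Longrightarrow> op_powr A 1 = A"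
  using pd_cfc_cong[of A "\<lambda>x. x powr 1" "\<lambda>x. x"] pd_cfc_ident[of A] by (simp add: op_powr_def)

lemma op_powr_half_sqrt:
  assumes "positive_definite P"
  shows "op_powr P (1/2) (op_powr P (1/2) x) = P x"
    and "op_powr P (1/2) (op_powr P (-1/2) x) = x"
    and "op_powr P (-1/2) (op_powr P (1/2) x) = x"
proof -
  note c = arg_cong[OF op_powr_compose[OF assms], of "\<lambda>T. blinfun_apply T x"]
  show "op_powr P (1/2) (op_powr P (1/2) x) = P x" "op_powr P (1/2) (op_powr P (-1/2) x) = x"
    "op_powr P (-1/2) (op_powr P (1/2) x) = x"
    using c[of "1/2" "1/2"] c[of "1/2" "-1/2"] c[of "-1/2" "1/2"]
    by (simp_all add: op_powr_0[OF assms] op_powr_1[OF assms])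
qed

lemma positive_definite_scaleR: "positive_definite A \<Longrightarrow> 0 < k \<Longrightarrow> positive_definite (k *\<^sub>R A)"
proof (elim positive_definite_form_between)
  fix a b assume "0 < k" "0 < a" "form_between a b A"
  then show "positive_definite (k *\<^sub>R A)"
    by (intro form_between_positive_definite[of "k * a" "k * b"])
      (auto simp: form_between_def blinfun.bilinear_simps mult.assoc intro!: self_adjoint_scaleR)
qed

lemma positive_definite_convex_combination:
  assumes A: "positive_definite A" and B: "positive_definite B" and \<alpha>: "0 \<le> \<alpha>" "\<alpha> \<le> 1"
  shows "positive_definite ((1 - \<alpha>) *\<^sub>R A + \<alpha> *\<^sub>R B)"
proof -
  obtain a where a: "0 < a" "\<And>x. a * inner x x \<le> inner (A x) x"
    using A by (auto simp: positive_definite_iff_coercive)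
  obtain b where b: "0 < b" "\<And>x. b * inner x x \<le> inner (B x) x"
    using B by (auto simp: positive_definite_iff_coercive)
  have "min a b * inner x x \<le> inner (((1 - \<alpha>) *\<^sub>R A + \<alpha> *\<^sub>R B) x) x" for x
  proof -
    have "min a b * inner x x \<le> inner (A x) x" "min a b * inner x x \<le> inner (B x) x"
      by (rule order_trans[OF mult_right_mono a(2)], simp_all)
        (rule order_trans[OF mult_right_mono b(2)], simp_all)
    then have "(1 - \<alpha>) * (min a b * inner x x) + \<alpha> * (min a b * inner x x)
        \<le> (1 - \<alpha>) * inner (A x) x + \<alpha> * inner (B x) x"
      using \<alpha> by (intro add_mono mult_left_mono) auto
    then show ?thesis by (simp add: blinfun.bilinear_simps inner_add_left algebra_simps)
  qed
  moreover have "0 < min a b" using a b by simp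
  ultimately show ?thesis
    unfolding positive_definite_iff_coercive
    using A B by (intro conjI exI[of _ "min a b"] allI self_adjoint_add self_adjoint_scaleR
        positive_definite_self_adjoint) auto
qed

lemma positive_definite_sandwich:
  assumes C: "positive_definite C" and S: "positive_definite S"
  shows "positive_definite (S o\<^sub>L C o\<^sub>L S)"
proof -
  obtain c where c: "0 < c" "\<And>x. c * inner x x \<le> inner (C x) x"
    using C by (auto simp: positive_definite_iff_coercive)
  obtain m where m: "0 < m" "\<And>x. m * norm x \<le> norm (S x)"
    using invertible_op_bounded_below[of S] S by (auto simp: positive_definite_def)
  have sS: "self_adjoint S" by (rule positive_definite_self_adjoint[OF S])
  have "c * m\<^sup>2 * inner x x \<le> inner ((S o\<^sub>L C o\<^sub>L S) x) x" for x
  proof -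
    have "m\<^sup>2 * inner x x \<le> inner (S x) (S x)"
      using power_mono[OF m(2)[of x], of 2] m(1) by (simp add: power_mult_distrib power2_norm_eq_inner)
    then have "c * (m\<^sup>2 * inner x x) \<le> c * inner (S x) (S x)" using c(1) by simp
    also have "\<dots> \<le> inner (C (S x)) (S x)" by (rule c(2))
    finally show ?thesis by (simp add: self_adjoint_inner[OF sS, of "C (S x)" x] mult.assoc)
  qed
  moreover have "0 < c * m\<^sup>2" using c m by simp
  ultimately show ?thesis
    unfolding positive_definite_iff_coercive
    using self_adjoint_sandwich[OF positive_definite_self_adjoint[OF C] sS] by blast
qed

text \<open>By the Cauchy-Schwarz inequality for the form of \<open>A\<close>,
  \<open>\<langle>B\<^sup>-\<^sup>1 x, x\<rangle>\<^sup>2 = \<langle>A (B\<^sup>-\<^sup>1 x), A\<^sup>-\<^sup>1 x\<rangle>\<^sup>2 \<le> \<langle>A (B\<^sup>-\<^sup>1 x), B\<^sup>-\<^sup>1 x\<rangle> \<langle>x, A\<^sup>-\<^sup>1 x\<rangle> \<le> \<langle>B\<^sup>-\<^sup>1 x, x\<rangle> \<langle>A\<^sup>-\<^sup>1 x, x\<rangle>\<close>.\<close>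

lemma inverse_antitone:
  fixes A B :: "'h::complex_hilbert_space \<Rightarrow>\<^sub>L 'h"
  assumes A: "positive_op A" and le: "\<And>x. inner (A x) x \<le> inner (B x) x"
    and Ay: "A y = x" and Bz: "B z = x"
  shows "inner z x \<le> inner y x"
proof -
  have sa: "self_adjoint A" and pos: "\<And>x. 0 \<le> inner (A x) x"
    using A by (auto simp: positive_op_iff)
  have "inner (A z) y = inner z x" using self_adjoint_inner[OF sa, of z y] Ay by simp
  then have "(inner z x)\<^sup>2 \<le> inner (A z) z * inner y x"
    using positive_op_Cauchy_Schwarz[OF A, of z y] Ay by (simp add: inner_commute)
  also have "\<dots> \<le> inner z x * inner y x"
    using le[of z] pos[of y] Ay Bz by (intro mult_right_mono) (simp_all add: inner_commute)
  finally have "inner z x * inner z x \<le> inner z x * inner y x" by (simp add: power2_eq_square)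
  moreover have "0 \<le> inner y x" using pos[of y] Ay by (simp add: inner_commute)
  ultimately show ?thesis by (cases "0 < inner z x") auto
qed

section \<open>Operator concavity of operator monotone functions\<close>

instantiation prod :: (complex_hilbert_space, complex_hilbert_space) complex_hilbert_space
begin

definition scaleC_prod :: "complex \<Rightarrow> 'a \<times> 'b \<Rightarrow> 'a \<times> 'b" where
  "scaleC_prod c x = (c *\<^sub>C fst x, c *\<^sub>C snd x)"

definition cinner_prod :: "'a \<times> 'b \<Rightarrow> 'a \<times> 'b \<Rightarrow> complex" where
  "cinner_prod x y = cinner (fst x) (fst y) + cinner (snd x) (snd y)"

instance
proof
  fix c d :: complex and r :: real and x y z :: "'a \<times> 'b"
  show "c *\<^sub>C (x + y) = c *\<^sub>C x + c *\<^sub>C y" "(c + d) *\<^sub>C x = c *\<^sub>C x + d *\<^sub>C x"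
    "c *\<^sub>C d *\<^sub>C x = (c * d) *\<^sub>C x" "complex_of_real r *\<^sub>C x = r *\<^sub>R x"
    by (simp_all add: scaleC_prod_def scaleC_add_right scaleC_add_left scaleC_scaleC scaleC_of_real
        prod_eq_iff)
  show "cinner (x + y) z = cinner x z + cinner y z" "cinner (c *\<^sub>C x) y = c * cinner x y"
    by (simp_all add: cinner_prod_def scaleC_prod_def cinner_simps algebra_simps)
  show "cinner x y = cnj (cinner y x)"
    by (simp add: cinner_prod_def cinner_commute[of "fst x"] cinner_commute[of "snd x"])
  show "Re (cinner x y) = inner x y"
    by (simp add: cinner_prod_def Re_cinner inner_prod_def)
qed

end

definition diag_op ::
  "('h::complex_hilbert_space \<Rightarrow>\<^sub>L 'h) \<Rightarrow> ('h \<Rightarrow>\<^sub>L 'h) \<Rightarrow> (('h \<times> 'h) \<Rightarrow>\<^sub>L ('h \<times> 'h))" where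
  "diag_op X Y = Blinfun (\<lambda>v. (X (fst v), Y (snd v)))"

lemma diag_op_apply [simp]: "diag_op X Y v = (X (fst v), Y (snd v))"
proof -
  have "bounded_linear (\<lambda>v. (X (fst v), Y (snd v)))"
    by (intro bounded_linear_Pair blinfun.bounded_linear_right[THEN bounded_linear_compose]
        bounded_linear_fst bounded_linear_snd)
  then show ?thesis by (simp add: diag_op_def bounded_linear_Blinfun_apply)
qed

definition first_inclusion :: "'h::complex_hilbert_space \<Rightarrow>\<^sub>L ('h \<times> 'h)" where
  "first_inclusion = Blinfun (\<lambda>x. (x, 0))"

definition second_inclusion :: "'h::complex_hilbert_space \<Rightarrow>\<^sub>L ('h \<times> 'h)" where
  "second_inclusion = Blinfun (\<lambda>x. (0, x))"

lemma inclusion_apply [simp]: "first_inclusion x = (x, 0)" "second_inclusion x = (0, x)"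
  unfolding first_inclusion_def second_inclusion_def
  by (simp_all add: bounded_linear_Blinfun_apply bounded_linear_Pair bounded_linear_ident bounded_linear_zero)

lemma form_between_diag_op:
  assumes "form_between a b X" "form_between a b Y"
  shows "form_between a b (diag_op X Y)"
  using assms unfolding form_between_def self_adjoint_def
  by (auto simp: cinner_prod_def inner_prod_def distrib_left intro!: add_mono)

lemma cfc_diag_op:
  assumes X: "form_between a b X" and Y: "form_between a b Y" and f: "continuous_on {a..b} f"
  shows "cfc f (diag_op X Y) (x, y) = (cfc f X x, cfc f Y y)"
proof -
  note D = form_between_diag_op[OF X Y]
  have "cfc f (diag_op X Y) (first_inclusion x) = first_inclusion (cfc f X x)"
    by (rule cfc_intertwine[OF X D f, symmetric]) (simp add: blinfun.zero_right)
  moreover have "cfc f (diag_op X Y) (second_inclusion y) = second_inclusion (cfc f Y y)"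
    by (rule cfc_intertwine[OF Y D f, symmetric]) (simp add: blinfun.zero_right)
  moreover have "cfc f (diag_op X Y) (x, y)
      = cfc f (diag_op X Y) (first_inclusion x) + cfc f (diag_op X Y) (second_inclusion y)"
    unfolding blinfun.add_right[symmetric] by simp
  ultimately show ?thesis by simp
qed

definition rotation_op :: "real \<Rightarrow> real \<Rightarrow> ('h::complex_hilbert_space \<times> 'h) \<Rightarrow>\<^sub>L ('h \<times> 'h)" where
  "rotation_op c s = Blinfun (\<lambda>v. (c *\<^sub>R fst v - s *\<^sub>R snd v, s *\<^sub>R fst v + c *\<^sub>R snd v))"

lemma rotation_op_apply [simp]:
  "rotation_op c s v = (c *\<^sub>R fst v - s *\<^sub>R snd v, s *\<^sub>R fst v + c *\<^sub>R snd v)"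
proof -
  have "bounded_linear (\<lambda>v::'a \<times> 'a. (c *\<^sub>R fst v - s *\<^sub>R snd v, s *\<^sub>R fst v + c *\<^sub>R snd v))"
    by (intro bounded_linear_intros)
  then show ?thesis by (simp add: rotation_op_def bounded_linear_Blinfun_apply)
qed

lemma rotation_op_adjoint: "cinner (rotation_op c s x) y = cinner x (rotation_op c (- s) y)"
  by (simp add: cinner_prod_def cinner_simps algebra_simps)

lemma rotation_op_inverse:
  assumes "c\<^sup>2 + s\<^sup>2 = 1"
  shows "rotation_op c s (rotation_op c (- s) v) = v" "rotation_op c (- s) (rotation_op c s v) = v"
proof -
  have "(c * c) *\<^sub>R x + (s * s) *\<^sub>R x = x" for x :: 'a
    using assms by (metis power2_eq_square scaleR_add_left scaleR_one)
  then show "rotation_op c s (rotation_op c (- s) v) = v" "rotation_op c (- s) (rotation_op c s v) = v"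
    by (simp_all add: prod_eq_iff scaleR_right_diff_distrib scaleR_right_distrib add.commute mult.commute)
qed

text \<open>Operator monotone functions on \<open>(0, \<infinity>)\<close> are operator concave by a dilation to \<open>2 \<times> 2\<close> blocks. With
  \<open>c\<^sup>2 = 1 - \<alpha>\<close> and \<open>s\<^sup>2 = \<alpha>\<close>, conjugating \<open>X \<oplus> Y\<close> by the rotation \<open>U\<close> gives an operator
  \<open>T\<close> whose upper left corner is \<open>Z = (1 - \<alpha>) X + \<alpha> Y\<close>. Its off-diagonal part is absorbed by
  a small number \<open>e\<close> in that corner and a large multiple of the identity in the other, so \<open>T \<le> (Z + e) \<oplus> K\<close>.
  Apply \<open>f\<close> and compare upper left corners: as \<open>f(T) = U\<^sup>* (f(X) \<oplus> f(Y)) U\<close>, that of \<open>f(T)\<close> is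
  \<open>(1 - \<alpha>) f(X) + \<alpha> f(Y)\<close>.\<close>

lemma operator_monotone_imp_concave_eps:
  fixes X Y :: "'h::complex_hilbert_space \<Rightarrow>\<^sub>L 'h"
  assumes f: "continuous_on {0<..} f"
    and mono: "\<And>(A :: ('h \<times> 'h) \<Rightarrow>\<^sub>L ('h \<times> 'h)) B v. positive_definite A \<Longrightarrow> positive_definite B \<Longrightarrow>
      B \<preceq> A \<Longrightarrow> inner (cfc f B v) v \<le> inner (cfc f A v) v"
    and X: "positive_definite X" and Y: "positive_definite Y" and \<alpha>: "0 \<le> \<alpha>" "\<alpha> \<le> 1" and e: "0 < e"
  shows "(1 - \<alpha>) * inner (cfc f X x) x + \<alpha> * inner (cfc f Y x) x
    \<le> inner (cfc f ((1 - \<alpha>) *\<^sub>R X + \<alpha> *\<^sub>R Y + e *\<^sub>R id_blinfun) x) x"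
proof -
  define c where "c = sqrt (1 - \<alpha>)"
  define s where "s = sqrt \<alpha>"
  have cs: "c\<^sup>2 = 1 - \<alpha>" "s\<^sup>2 = \<alpha>" "c\<^sup>2 + s\<^sup>2 = 1" using \<alpha> by (simp_all add: c_def s_def)
  obtain a1 b1 where 1: "0 < a1" "a1 \<le> b1" "form_between a1 b1 X"
    using positive_definite_form_between[OF X] .
  obtain a2 b2 where 2: "0 < a2" "a2 \<le> b2" "form_between a2 b2 Y"
    using positive_definite_form_between[OF Y] .
  define a where "a = min a1 a2"
  define b where "b = max b1 b2"
  have ab: "0 < a" "a \<le> b" using 1 2 by (auto simp: a_def b_def)
  have Xab: "form_between a b X" and Yab: "form_between a b Y"
    using form_between_mono[OF 1(3), of a b] form_between_mono[OF 2(3), of a b]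
    by (simp_all add: a_def b_def)
  define Z where "Z = (1 - \<alpha>) *\<^sub>R X + \<alpha> *\<^sub>R Y"
  define U :: "('h \<times> 'h) \<Rightarrow>\<^sub>L ('h \<times> 'h)" where "U = rotation_op c s"
  define U' :: "('h \<times> 'h) \<Rightarrow>\<^sub>L ('h \<times> 'h)" where "U' = rotation_op c (- s)"
  have UU': "U (U' v) = v" "U' (U v) = v" for v
    using rotation_op_inverse[OF cs(3)] by (simp_all add: U_def U'_def)
  have adj: "cinner (U v) w = cinner v (U' w)" for v w
    unfolding U_def U'_def by (rule rotation_op_adjoint)
  then have adj': "inner (U' v) w = inner v (U w)" for v w
    by (metis Re_cinner inner_commute)
  define D where "D = diag_op X Y"
  have Dab: "form_between a b D" unfolding D_def by (rule form_between_diag_op[OF Xab Yab])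
  define T where "T = U' o\<^sub>L D o\<^sub>L U"
  have T_apply: "T v = U' (D (U v))" for v by (simp add: T_def)
  have innerT: "inner (T v) v = inner (D (U v)) (U v)" for v
    by (simp add: T_apply adj')
  have UU: "inner (U v) (U v) = inner v v" for v
    by (metis UU'(2) adj')
  have Tab: "form_between a b T"
    unfolding form_between_def
  proof (intro conjI allI)
    show "self_adjoint T"
      unfolding T_def by (rule self_adjoint_conjugate[OF form_between_self_adjoint[OF Dab] adj])
    show "a * inner v v \<le> inner (T v) v" "inner (T v) v \<le> b * inner v v" for v
      using Dab unfolding innerT form_between_def by (metis UU)+
  qed
  \<comment> \<open>Since \<open>2 c s \<le> 1\<close>, the off-diagonal form at \<open>(y, z)\<close> is at most
    \<open>N |y| |z| \<le> e |y|\<^sup>2 + (N\<^sup>2 / e) |z|\<^sup>2\<close>, which dictates \<open>K\<close>.\<close>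
  define N where "N = norm (Y - X)"
  define K where "K = b + N\<^sup>2 / e + e"
  define E where "E = diag_op (Z + e *\<^sub>R id_blinfun) (K *\<^sub>R id_blinfun)"
  have Zab: "form_between a b Z"
    unfolding form_between_def
  proof (intro conjI allI)
    show "self_adjoint Z"
      unfolding Z_def using Xab Yab
      by (intro self_adjoint_add self_adjoint_scaleR) (simp_all add: form_between_def)
    fix v
    have "(1 - \<alpha>) * (a * inner v v) + \<alpha> * (a * inner v v) \<le> (1 - \<alpha>) * inner (X v) v + \<alpha> * inner (Y v) v"
      using Xab Yab \<alpha> by (intro add_mono mult_left_mono) (auto simp: form_between_def)
    then show "a * inner v v \<le> inner (Z v) v"
      by (simp add: Z_def blinfun.bilinear_simps inner_add_left algebra_simps)
    have "(1 - \<alpha>) * inner (X v) v + \<alpha> * inner (Y v) v \<le> (1 - \<alpha>) * (b * inner v v) + \<alpha> * (b * inner v v)"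
      using Xab Yab \<alpha> by (intro add_mono mult_left_mono) (auto simp: form_between_def)
    then show "inner (Z v) v \<le> b * inner v v"
      by (simp add: Z_def blinfun.bilinear_simps inner_add_left algebra_simps)
  qed
  have Ze: "form_between a (K + b + e) (Z + e *\<^sub>R id_blinfun)"
    unfolding form_between_def
  proof (intro conjI allI)
    show "self_adjoint (Z + e *\<^sub>R id_blinfun)"
      using Zab by (intro self_adjoint_add self_adjoint_scaleR) (simp_all add: form_between_def)
    fix v
    have Zv: "a * inner v v \<le> inner (Z v) v" "inner (Z v) v \<le> b * inner v v"
      using Zab by (simp_all add: form_between_def)
    have "0 \<le> e * inner v v" using e by simp
    then show "a * inner v v \<le> inner ((Z + e *\<^sub>R id_blinfun) v) v"
      using Zv by (simp add: blinfun.bilinear_simps inner_add_left)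
    have "0 \<le> K" using ab e by (simp add: K_def)
    then have "0 \<le> K * inner v v" by simp
    then show "inner ((Z + e *\<^sub>R id_blinfun) v) v \<le> (K + b + e) * inner v v"
      using Zv by (simp add: blinfun.bilinear_simps inner_add_left distrib_right)
  qed
  have aK: "a \<le> K" using ab e by (simp add: K_def add_increasing2)
  have Ke: "form_between a (K + b + e) (K *\<^sub>R id_blinfun :: 'h \<Rightarrow>\<^sub>L 'h)"
    unfolding form_between_def using ab e aK
    by (auto simp: blinfun.bilinear_simps intro!: self_adjoint_scaleR mult_right_mono)
  have Eab: "form_between a (K + b + e) E"
    unfolding E_def by (rule form_between_diag_op[OF Ze Ke])
  have "inner (T v) v \<le> inner (E v) v" for v
  proof -
    obtain y z where v: "v = (y, z)" by (cases v)
    have symX: "inner (X z) y = inner (X y) z" and symY: "inner (Y z) y = inner (Y y) z"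
      using self_adjoint_inner[OF form_between_self_adjoint[OF Xab], of y z]
        self_adjoint_inner[OF form_between_self_adjoint[OF Yab], of y z] by (simp_all add: inner_commute)
    have "inner (T v) v = c\<^sup>2 * inner (X y) y + s\<^sup>2 * inner (Y y) y + 2 * (c * s) * inner ((Y - X) y) z
        + (s\<^sup>2 * inner (X z) z + c\<^sup>2 * inner (Y z) z)"
      by (simp add: innerT v D_def U_def blinfun.bilinear_simps inner_add_left inner_diff_left
          inner_add_right inner_diff_right power2_eq_square symX symY algebra_simps)
    also have "c\<^sup>2 * inner (X y) y + s\<^sup>2 * inner (Y y) y = inner (Z y) y"
      by (simp add: cs Z_def blinfun.bilinear_simps inner_add_left)
    also have "s\<^sup>2 * inner (X z) z + c\<^sup>2 * inner (Y z) z \<le> s\<^sup>2 * (b * inner z z) + c\<^sup>2 * (b * inner z z)"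
      using Xab Yab by (intro add_mono mult_left_mono) (auto simp: form_between_def)
    also have "\<dots> = b * inner z z"
      using cs(3) by (metis add.commute distrib_right mult_1)
    also have "2 * (c * s) * inner ((Y - X) y) z \<le> e * inner y y + N\<^sup>2 / e * inner z z"
    proof -
      have "0 \<le> (c - s)\<^sup>2" "0 \<le> (c + s)\<^sup>2" by simp_all
      then have "2 * \<bar>c * s\<bar> \<le> 1" using cs(3) by (simp add: power2_eq_square algebra_simps abs_if)
      moreover have "\<bar>inner ((Y - X) y) z\<bar> \<le> N * norm y * norm z"
        unfolding N_def
        by (rule order_trans[OF Cauchy_Schwarz_ineq2 mult_right_mono[OF norm_blinfun]]) simp
      ultimately have "(2 * \<bar>c * s\<bar>) * \<bar>inner ((Y - X) y) z\<bar> \<le> 1 * (N * norm y * norm z)"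
        by (intro mult_mono) auto
      then have "2 * (c * s) * inner ((Y - X) y) z \<le> N * norm y * norm z"
        by (metis abs_ge_self abs_mult abs_numeral mult_1 order_trans)
      also have "\<dots> \<le> e * (norm y)\<^sup>2 + N\<^sup>2 / e * (norm z)\<^sup>2"
      proof -
        have "0 \<le> (e * norm y - N * norm z)\<^sup>2 + (e * norm y)\<^sup>2 + (N * norm z)\<^sup>2" by simp
        then have "e * (N * norm y * norm z) \<le> e * (e * (norm y)\<^sup>2 + N\<^sup>2 / e * (norm z)\<^sup>2)"
          using e by (simp add: power2_eq_square algebra_simps)
        then show ?thesis using e by simp
      qed
      finally show ?thesis by (simp add: power2_norm_eq_inner)
    qed
    finally have "inner (T v) v \<le> inner (Z y) y + (e * inner y y + N\<^sup>2 / e * inner z z) + b * inner z z"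
      by linarith
    moreover have "inner (E v) v = inner (Z y) y + e * inner y y + (b * inner z z + N\<^sup>2 / e * inner z z + e * inner z z)"
      by (simp add: E_def v K_def blinfun.bilinear_simps inner_add_left distrib_right)
    moreover have "0 \<le> e * inner z z" using e by simp
    ultimately show ?thesis by linarith
  qed
  then have "T \<preceq> E"
    using form_between_self_adjoint Tab Eab by (auto simp: op_le_iff)
  then have "inner (cfc f T (x, 0)) (x, 0) \<le> inner (cfc f E (x, 0)) (x, 0)"
    using mono form_between_positive_definite[OF ab(1)] Tab Eab by blast
  moreover have "inner (cfc f E (x, 0)) (x, 0) = inner (cfc f (Z + e *\<^sub>R id_blinfun) x) x"
  proof -
    have "continuous_on {a..K + b + e} f"
      using ab(1) by (intro continuous_on_subset[OF f]) auto
    from cfc_diag_op[OF Ze Ke this] show ?thesis by (simp add: E_def)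
  qed
  moreover have "inner (cfc f T (x, 0)) (x, 0) = (1 - \<alpha>) * inner (cfc f X x) x + \<alpha> * inner (cfc f Y x) x"
  proof -
    have fab: "continuous_on {a..b} f"
      using ab(1) by (intro continuous_on_subset[OF f]) auto
    have "U (cfc f T v) = cfc f D (U v)" for v
      by (rule cfc_intertwine[OF Tab Dab fab]) (simp add: T_apply UU')
    then have "cfc f T v = U' (cfc f D (U v))" for v
      by (metis UU'(2))
    then have "inner (cfc f T (x, 0)) (x, 0) = inner (cfc f D (c *\<^sub>R x, s *\<^sub>R x)) (c *\<^sub>R x, s *\<^sub>R x)"
      by (simp add: adj') (simp add: U_def)
    also have "\<dots> = c\<^sup>2 * inner (cfc f X x) x + s\<^sup>2 * inner (cfc f Y x) x"
      unfolding D_def cfc_diag_op[OF Xab Yab fab]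
      by (simp add: blinfun.bilinear_simps power2_eq_square)
    finally show ?thesis by (simp add: cs)
  qed
  ultimately show ?thesis by (simp add: Z_def)
qed

text \<open>The spare \<open>e\<close> disappears in the limit: \<open>f(Z + e)\<close> is the function \<open>x \<mapsto> f(x + e)\<close> of \<open>Z\<close>, and \<open>f\<close> is
  uniformly continuous on a neighbourhood of the spectrum.\<close>

lemma operator_monotone_imp_concave:
  fixes X Y :: "'h::complex_hilbert_space \<Rightarrow>\<^sub>L 'h"
  assumes f: "continuous_on {0<..} f"
    and mono: "\<And>(A :: ('h \<times> 'h) \<Rightarrow>\<^sub>L ('h \<times> 'h)) B v. positive_definite A \<Longrightarrow> positive_definite B \<Longrightarrow>
      B \<preceq> A \<Longrightarrow> inner (cfc f B v) v \<le> inner (cfc f A v) v"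
    and X: "positive_definite X" and Y: "positive_definite Y" and \<alpha>: "0 \<le> \<alpha>" "\<alpha> \<le> 1"
  shows "(1 - \<alpha>) * inner (cfc f X x) x + \<alpha> * inner (cfc f Y x) x
    \<le> inner (cfc f ((1 - \<alpha>) *\<^sub>R X + \<alpha> *\<^sub>R Y) x) x"
proof -
  define Z where "Z = (1 - \<alpha>) *\<^sub>R X + \<alpha> *\<^sub>R Y"
  obtain a b where ab: "0 < a" "a \<le> b" "form_between a b Z"
    using positive_definite_form_between[OF positive_definite_convex_combination[OF X Y \<alpha>]]
    unfolding Z_def .
  have fab: "continuous_on {a..b} f" using ab(1) by (intro continuous_on_subset[OF f]) auto
  have "uniformly_continuous_on {a..b + 1} f"
    using ab(1) by (intro compact_uniformly_continuous continuous_on_subset[OF f]) auto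
  then have unif: "\<exists>\<delta>>0. \<forall>t\<in>{a..b + 1}. \<forall>t'\<in>{a..b + 1}. dist t' t < \<delta> \<longrightarrow> dist (f t') (f t) < d"
    if "0 < d" for d
    using that unfolding uniformly_continuous_on_def by blast
  have "(1 - \<alpha>) * inner (cfc f X x) x + \<alpha> * inner (cfc f Y x) x \<le> inner (cfc f Z x) x + d * inner x x"
    if "0 < d" for d
  proof -
    obtain \<delta> where \<delta>: "0 < \<delta>"
      "\<And>t t'. t \<in> {a..b + 1} \<Longrightarrow> t' \<in> {a..b + 1} \<Longrightarrow> dist t' t < \<delta> \<Longrightarrow> dist (f t') (f t) < d"
      using unif[OF \<open>0 < d\<close>] by blast
    define e where "e = min (\<delta> / 2) 1"
    have e: "0 < e" "e < \<delta>" "e \<le> 1" using \<delta>(1) by (auto simp: e_def)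
    have fe: "continuous_on {1 * a + e..1 * b + e} f"
      using ab(1) e by (intro continuous_on_subset[OF f]) auto
    have "cfc f (Z + e *\<^sub>R id_blinfun) = cfc (\<lambda>t. f (1 * t + e)) Z"
      using cfc_affine_argument[OF ab(3) fe] by simp
    moreover have "inner (cfc (\<lambda>t. f (1 * t + e)) Z x) x \<le> inner (cfc (\<lambda>t. 1 * f t + d) Z x) x"
    proof (rule cfc_mono[OF ab(3)])
      show "continuous_on {a..b} (\<lambda>t. f (1 * t + e))"
        by (rule continuous_on_compose2[OF fe]) (auto intro!: continuous_intros)
      show "continuous_on {a..b} (\<lambda>t. 1 * f t + d)" by (intro continuous_intros fab)
      fix t assume "t \<in> {a..b}"
      then have "dist (f (t + e)) (f t) < d" using e by (intro \<delta>(2)) (auto simp: dist_real_def)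
      then show "f (1 * t + e) \<le> 1 * f t + d" by (simp add: dist_real_def)
    qed
    moreover have "inner (cfc (\<lambda>t. 1 * f t + d) Z x) x = inner (cfc f Z x) x + d * inner x x"
      unfolding cfc_linear[OF ab(3) fab] by (simp add: blinfun.bilinear_simps inner_add_left)
    ultimately show ?thesis
      using operator_monotone_imp_concave_eps[OF f mono X Y \<alpha> e(1), of x] unfolding Z_def by simp
  qed
  note le = this
  show ?thesis
    unfolding Z_def[symmetric]
  proof (rule field_le_epsilon)
    fix d :: real assume d: "0 < d"
    have pos: "0 < inner x x + 1" by (simp add: add_nonneg_pos)
    have "d / (inner x x + 1) * inner x x \<le> d" using d pos by (simp add: field_simps)
    moreover have "0 < d / (inner x x + 1)" using d pos by simp
    ultimately show "(1 - \<alpha>) * inner (cfc f X x) x + \<alpha> * inner (cfc f Y x) x \<le> inner (cfc f Z x) x + d"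
      using le by fastforce
  qed
qed

text \<open>Because inversion reverses the operator order, \<open>1/g\<close> is operator monotone, so the block dilation
  applies to it.\<close>

lemma reciprocal_operator_concave:
  fixes X Y :: "'h::complex_hilbert_space \<Rightarrow>\<^sub>L 'h"
  assumes g: "operator_monotone_decreasing g" and pos: "\<And>x. 0 < x \<Longrightarrow> 0 < g x"
    and X: "positive_definite X" and Y: "positive_definite Y" and \<alpha>: "0 \<le> \<alpha>" "\<alpha> \<le> 1"
  shows "(1 - \<alpha>) * inner (cfc (\<lambda>x. 1 / g x) X x) x + \<alpha> * inner (cfc (\<lambda>x. 1 / g x) Y x) x
    \<le> inner (cfc (\<lambda>x. 1 / g x) ((1 - \<alpha>) *\<^sub>R X + \<alpha> *\<^sub>R Y) x) x"
proof (rule operator_monotone_imp_concave[OF _ _ X Y \<alpha>])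
  have cont: "continuous_on {0<..} g"
    using g by (simp add: operator_monotone_decreasing_def)
  have nz: "0 < x \<Longrightarrow> g x \<noteq> 0" for x using pos[of x] by simp
  show "continuous_on {0<..} (\<lambda>x. 1 / g x)"
    by (intro continuous_intros cont) (auto simp: nz)
  fix A B :: "('h \<times> 'h) \<Rightarrow>\<^sub>L ('h \<times> 'h)" and v
  assume A: "positive_definite A" and B: "positive_definite B" and BA: "B \<preceq> A"
  show "inner (cfc (\<lambda>x. 1 / g x) B v) v \<le> inner (cfc (\<lambda>x. 1 / g x) A v) v"
  proof (rule inverse_antitone)
    show "positive_op (cfc g A)"
      using pd_cfc_positive_definite[OF A cont pos] by (simp add: positive_definite_def)
    show "inner (cfc g A w) w \<le> inner (cfc g B w) w" for w
      by (rule operator_monotone_decreasing_transfer[OF g A B BA])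
    show "cfc g A (cfc (\<lambda>x. 1 / g x) A v) = v" "cfc g B (cfc (\<lambda>x. 1 / g x) B v) = v"
      by (rule pd_cfc_reciprocal[OF A cont pos] pd_cfc_reciprocal[OF B cont pos]; assumption)+
  qed
qed

section \<open>Scalar inequalities\<close>

lemma powr_le_arithmetic_mean:
  fixes x \<alpha> :: real
  assumes "0 \<le> \<alpha>" "\<alpha> \<le> 1" "0 < x"
  shows "x powr \<alpha> \<le> (1 - \<alpha>) + \<alpha> * x"
  using Youngs_inequality_0[of \<alpha> "1 - \<alpha>" x 1] assms by simp

lemma Bernoulli_powr:
  fixes x \<beta> :: real
  assumes "1 \<le> \<beta>" "0 < x"
  shows "1 + \<beta> * (x - 1) \<le> x powr \<beta>"
proof -
  have "x \<le> (1 - 1 / \<beta>) + 1 / \<beta> * x powr \<beta>"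
    using powr_le_arithmetic_mean[of "1 / \<beta>" "x powr \<beta>"] assms by (simp add: powr_powr)
  then have "\<beta> * x \<le> \<beta> * ((1 - 1 / \<beta>) + 1 / \<beta> * x powr \<beta>)"
    using assms by (intro mult_left_mono) auto
  also have "\<dots> = \<beta> - 1 + x powr \<beta>" using assms by (simp add: algebra_simps)
  finally show ?thesis by (simp add: algebra_simps)
qed

lemma kantorovich_ge_1: "0 < x \<Longrightarrow> 1 \<le> kantorovich x"
  using zero_le_power2[of "x - 1"] by (simp add: kantorovich_def power2_eq_square field_simps)

lemma kantorovich_altdef: "0 < x \<Longrightarrow> kantorovich x = (x + 1 / x + 2) / 4"
  by (simp add: kantorovich_def power2_eq_square field_simps)

text \<open>The difference \<open>K(x) - K(y)\<close> has the sign of \<open>(x - y) (x y - 1)\<close>; this decides which endpoint wins.\<close>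

lemma kantorovich_le_endpoints:
  assumes "0 < s" "s \<le> x" "x \<le> t"
  shows "kantorovich x \<le> max (kantorovich s) (kantorovich t)"
proof (cases "x * s \<le> 1")
  case True
  then have "0 \<le> (x - s) * (1 - x * s) / (x * s)" using assms by simp
  then have "kantorovich x \<le> kantorovich s"
    using assms by (simp add: kantorovich_altdef field_simps)
  then show ?thesis by simp
next
  case False
  have "x * s \<le> x * t" using assms by (intro mult_left_mono) auto
  then have "1 \<le> x * t" using False by linarith
  then have "0 \<le> (t - x) * (x * t - 1) / (x * t)"
    using assms by (intro divide_nonneg_nonneg mult_nonneg_nonneg) auto
  then have "kantorovich x \<le> kantorovich t"
    using assms by (simp add: kantorovich_altdef field_simps)
  then show ?thesis by simp
qed

text \<open>For \<open>\<alpha> \<ge> 1/2\<close> the right-hand side is \<open>((x + 1) / 2)\<close> to the power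
  \<open>2 \<alpha> \<ge> 1\<close>, so this is Bernoulli's inequality; the other case follows by \<open>x \<mapsto> 1/x\<close>, which leaves the
  Kantorovich constant unchanged.\<close>

lemma reverse_Young_kantorovich:
  assumes x: "0 < x" and \<alpha>: "0 \<le> \<alpha>" "\<alpha> \<le> 1"
  shows "(1 - \<alpha>) + \<alpha> * x \<le> kantorovich x powr (max (1 - \<alpha>) \<alpha>) * x powr \<alpha>"
proof -
  have upper_half: "(1 - \<beta>) + \<beta> * y \<le> kantorovich y powr \<beta> * y powr \<beta>"
    if y: "0 < y" and \<beta>: "1 / 2 \<le> \<beta>" for y \<beta> :: real
  proof -
    have "kantorovich y powr \<beta> * y powr \<beta> = (((y + 1) / 2)\<^sup>2) powr \<beta>"
      using y by (simp add: kantorovich_def power_divide flip: powr_mult)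
    also have "\<dots> = ((y + 1) / 2) powr (2 * \<beta>)"
      using y powr_powr[of "(y + 1) / 2" 2 \<beta>] by simp
    also have "\<dots> \<ge> 1 + (2 * \<beta>) * ((y + 1) / 2 - 1)"
      using y \<beta> by (intro Bernoulli_powr) auto
    finally show ?thesis by (simp add: field_simps)
  qed
  show ?thesis
  proof (cases "1 / 2 \<le> \<alpha>")
    case True
    then show ?thesis using upper_half[OF x True] by (simp add: max_def)
  next
    case False
    define \<beta> where "\<beta> = 1 - \<alpha>"
    have "kantorovich (1 / x) = kantorovich x" using x by (simp add: kantorovich_altdef)
    then have "(1 - \<beta>) + \<beta> * (1 / x) \<le> kantorovich x powr \<beta> * (1 / x) powr \<beta>"
      using upper_half[of "1 / x" \<beta>] x False by (simp add: \<beta>_def)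
    then have "x * ((1 - \<beta>) + \<beta> * (1 / x)) \<le> x * (kantorovich x powr \<beta> * (1 / x) powr \<beta>)"
      using x by (intro mult_left_mono) auto
    moreover have "x * ((1 - \<beta>) + \<beta> * (1 / x)) = (1 - \<alpha>) + \<alpha> * x"
      using x by (simp add: \<beta>_def field_simps)
    moreover have "x * (1 / x) powr \<beta> = x powr \<alpha>"
    proof -
      have "x * (1 / x) powr \<beta> = x powr 1 * x powr (- \<beta>)"
        using x by (simp add: powr_minus_divide powr_divide)
      also have "\<dots> = x powr (1 + - \<beta>)" by (rule powr_add[symmetric])
      finally show ?thesis by (simp add: \<beta>_def)
    qed
    ultimately have "(1 - \<alpha>) + \<alpha> * x \<le> kantorovich x powr \<beta> * x powr \<alpha>"
      by (metis mult.left_commute)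
    moreover have "max (1 - \<alpha>) \<alpha> = \<beta>" using False by (simp add: \<beta>_def)
    ultimately show ?thesis by simp
  qed
qed

section \<open>Scalar properties of operator monotone decreasing functions\<close>

lemma ell2_nontrivial: "\<exists>e :: ell2. 0 < inner e e"
proof -
  define e where "e = Abs_ell2 (\<lambda>n. if n = 0 then 1 else 0)"
  have "summable (\<lambda>n. (cmod (if n = 0 then 1 else 0))\<^sup>2)"
    by (rule summable_finite[of "{0::nat}"]) auto
  then have "ell2_nth e 0 = 1"
    by (simp add: e_def Abs_ell2_inverse)
  then have "e \<noteq> 0" by (auto simp: ell2_nth_simps)
  then show ?thesis by (intro exI[of _ e]) simp
qed

lemma form_between_scalar_op: "form_between c c (c *\<^sub>R id_blinfun)"
  by (simp add: form_between_def blinfun.bilinear_simps self_adjoint_scaleR)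

lemma scalar_op_positive_definite: "0 < c \<Longrightarrow> positive_definite (c *\<^sub>R id_blinfun)"
  by (rule form_between_positive_definite[OF _ form_between_scalar_op])

lemma cfc_scalar_op: "cfc f (c *\<^sub>R id_blinfun) = f c *\<^sub>R id_blinfun"
proof -
  have "cfc f (c *\<^sub>R id_blinfun :: 'a \<Rightarrow>\<^sub>L 'a) = cfc (\<lambda>_. f c) (c *\<^sub>R id_blinfun)"
    by (rule cfc_cong_between[OF form_between_scalar_op]) (metis order_antisym)
  also have "\<dots> = f c *\<^sub>R id_blinfun" by (rule cfc_const[OF form_between_scalar_op])
  finally show ?thesis .
qed

lemma operator_monotone_decreasing_antimono:
  assumes g: "operator_monotone_decreasing g" and "0 < y" "y \<le> x"
  shows "g x \<le> g y"
proof -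
  obtain e :: ell2 where e: "0 < inner e e" using ell2_nontrivial by blast
  have "(y *\<^sub>R id_blinfun :: ell2 \<Rightarrow>\<^sub>L ell2) \<preceq> x *\<^sub>R id_blinfun"
    using assms by (auto simp: op_le_iff blinfun.bilinear_simps intro!: self_adjoint_scaleR mult_right_mono)
  then have "inner (cfc g (x *\<^sub>R id_blinfun) e) e \<le> inner (cfc g (y *\<^sub>R id_blinfun) e) e"
    using assms by (intro operator_monotone_decreasing_transfer[OF g] scalar_op_positive_definite) auto
  then show ?thesis using e by (simp add: cfc_scalar_op blinfun.bilinear_simps)
qed

lemma operator_monotone_decreasing_add_const:
  assumes g: "operator_monotone_decreasing g"
  shows "operator_monotone_decreasing (\<lambda>x. g x + d)"
proof -
  have cont: "continuous_on {0<..} g" using g by (simp add: operator_monotone_decreasing_def)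
  have "cfc (\<lambda>x. g x + d) A = cfc g A + d *\<^sub>R id_blinfun" if "positive_definite A" for A :: "ell2 \<Rightarrow>\<^sub>L ell2"
    using pd_cfc_linear[OF that cont, of 1 d] by simp
  moreover have "cfc g A + d *\<^sub>R id_blinfun \<preceq> cfc g B + d *\<^sub>R id_blinfun"
    if "cfc g A \<preceq> cfc g B" for A B :: "ell2 \<Rightarrow>\<^sub>L ell2"
    using that by (auto simp: op_le_iff blinfun.bilinear_simps inner_add_left
        intro!: self_adjoint_add self_adjoint_scaleR)
  ultimately show ?thesis
    using g unfolding operator_monotone_decreasing_def
    by (auto intro!: continuous_intros)
qed

text \<open>The nonnegative concave function \<open>1/g\<close> on \<open>(0, \<infinity>)\<close> has decreasing slope \<open>1 / (x g(x))\<close> seen from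
  the origin, so \<open>x g(x)\<close> increases. In the proof a small \<open>\<delta> > 0\<close> stands in for the origin.\<close>

lemma operator_monotone_decreasing_scaling_pos:
  assumes g: "operator_monotone_decreasing g" and pos: "\<And>x. 0 < x \<Longrightarrow> 0 < g x"
    and x: "0 < x" and k: "1 \<le> k"
  shows "g x \<le> k * g (k * x)"
proof -
  obtain e :: ell2 where e: "0 < inner e e" using ell2_nontrivial by blast
  have kx: "0 < k * x" "x \<le> k * x" using x k by simp_all
  have concave: "(1 - \<theta>) / g u + \<theta> / g v \<le> 1 / g ((1 - \<theta>) * u + \<theta> * v)"
    if "0 < u" "0 < v" "0 \<le> \<theta>" "\<theta> \<le> 1" for u v \<theta>
  proof -
    let ?r = "\<lambda>x. 1 / g x" and ?I = "id_blinfun :: ell2 \<Rightarrow>\<^sub>L ell2"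
    have "(1 - \<theta>) *\<^sub>R u *\<^sub>R ?I + \<theta> *\<^sub>R v *\<^sub>R ?I = ((1 - \<theta>) * u + \<theta> * v) *\<^sub>R ?I"
      by (simp add: scaleR_add_left)
    moreover have "(1 - \<theta>) * inner (cfc ?r (u *\<^sub>R ?I) e) e + \<theta> * inner (cfc ?r (v *\<^sub>R ?I) e) e
        \<le> inner (cfc ?r ((1 - \<theta>) *\<^sub>R u *\<^sub>R ?I + \<theta> *\<^sub>R v *\<^sub>R ?I) e) e"
      using that by (intro reciprocal_operator_concave[OF g pos] scalar_op_positive_definite)
    ultimately have "((1 - \<theta>) / g u + \<theta> / g v) * inner e e \<le> 1 / g ((1 - \<theta>) * u + \<theta> * v) * inner e e"
      by (simp only: cfc_scalar_op blinfun.scaleR_left inner_scaleR_left blinfun_apply_id_blinfun)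
        (simp add: distrib_right)
    then show ?thesis using e by (rule mult_right_le_imp_le)
  qed
  have step: "(x - \<delta>) * g x \<le> k * x * g (k * x)" if \<delta>: "0 < \<delta>" "\<delta> < x" for \<delta>
  proof -
    define \<theta> where "\<theta> = (x - \<delta>) / (k * x - \<delta>)"
    have den: "0 < k * x - \<delta>" using \<delta> kx by linarith
    have \<theta>: "0 \<le> \<theta>" "\<theta> \<le> 1" using \<delta> kx den by (simp_all add: \<theta>_def)
    have "\<theta> * (k * x - \<delta>) = x - \<delta>" using den by (simp add: \<theta>_def)
    then have "(1 - \<theta>) * \<delta> + \<theta> * (k * x) = x" by (simp add: algebra_simps)
    moreover have "0 \<le> (1 - \<theta>) / g \<delta>" using \<theta> pos[of \<delta>] \<delta> by simp
    ultimately have "\<theta> / g (k * x) \<le> 1 / g x"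
      using concave[of \<delta> "k * x" \<theta>] \<delta> kx \<theta> by simp
    then have "\<theta> * g x \<le> g (k * x)"
      using pos[OF x] pos[OF kx(1)] by (simp add: field_simps)
    then have "(k * x - \<delta>) * (\<theta> * g x) \<le> (k * x - \<delta>) * g (k * x)"
      using den by (intro mult_left_mono) auto
    then have "(x - \<delta>) * g x \<le> (k * x - \<delta>) * g (k * x)"
      using \<open>\<theta> * (k * x - \<delta>) = x - \<delta>\<close> by (metis mult.commute mult.left_commute)
    also have "\<dots> \<le> k * x * g (k * x)"
      using pos[OF kx(1)] \<delta> by (intro mult_right_mono) auto
    finally show ?thesis .
  qed
  have "x * g x \<le> k * x * g (k * x)"
  proof (rule field_le_epsilon)
    fix d :: real assume d: "0 < d"
    define \<delta> where "\<delta> = min (x / 2) (d / g x)"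
    have \<delta>: "0 < \<delta>" "\<delta> < x" "\<delta> * g x \<le> d"
      using x d pos[OF x] by (auto simp: \<delta>_def min_def field_simps)
    show "x * g x \<le> k * x * g (k * x) + d"
      using step[OF \<delta>(1,2)] \<delta>(3) by (simp add: algebra_simps)
  qed
  then have "x * g x \<le> x * (k * g (k * x))" by (simp add: mult_ac)
  then show ?thesis using x by simp
qed

text \<open>Adding a small constant to \<open>g\<close> makes it positive and costs arbitrarily little.\<close>

lemma operator_monotone_decreasing_scaling:
  assumes g: "operator_monotone_decreasing g" and nonneg: "\<And>x. 0 < x \<Longrightarrow> 0 \<le> g x"
    and x: "0 < x" and k: "1 \<le> k"
  shows "g x \<le> k * g (k * x)"
proof (rule field_le_epsilon)
  fix d :: real assume d: "0 < d"
  have "g x + d / k \<le> k * (g (k * x) + d / k)"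
    using operator_monotone_decreasing_scaling_pos[OF operator_monotone_decreasing_add_const[OF g], of "d / k"]
      nonneg x k d by (simp add: add_nonneg_pos)
  moreover have "0 \<le> d / k" using d k by simp
  ultimately show "g x \<le> k * g (k * x) + d" using k by (simp add: distrib_left)
qed

text \<open>A zero at \<open>z\<close> propagates to the right because \<open>g\<close> decreases, and to the left because \<open>x g(x)\<close>
  increases.\<close>

lemma operator_monotone_decreasing_vanishing:
  assumes g: "operator_monotone_decreasing g" and nonneg: "\<And>x. 0 < x \<Longrightarrow> 0 \<le> g x"
    and z: "0 < z" "g z = 0" and x: "0 < x"
  shows "g x = 0"
proof (cases "z \<le> x")
  case True
  then show ?thesis
    using operator_monotone_decreasing_antimono[OF g z(1) True] nonneg[OF x] z by simp
next
  case False
  then have "g x \<le> (z / x) * g (z / x * x)"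
    using x by (intro operator_monotone_decreasing_scaling[OF g nonneg x]) auto
  then show ?thesis using x z nonneg[OF x] by simp
qed

section \<open>Operator means\<close>

lemma geometric_mean_positive_definite_eq:
  fixes P Q :: "'h::complex_hilbert_space \<Rightarrow>\<^sub>L 'h"
  assumes "positive_definite P"
  shows "geometric_mean \<alpha> P Q = op_powr P (1/2)
    o\<^sub>L op_powr (op_powr P (-1/2) o\<^sub>L Q o\<^sub>L op_powr P (-1/2)) \<alpha> o\<^sub>L op_powr P (1/2)"
proof (cases "P = 0")
  case True
  \<comment> \<open>Only the zero space has the zero operator positive definite.\<close>
  obtain c where "0 < c" "\<And>x. c * inner x x \<le> inner (P x) x"
    using assms by (auto simp: positive_definite_iff_coercive)
  with True have "inner x x \<le> 0" for x :: 'h by (simp add: mult_le_0_iff)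
  then have "x = 0" for x :: 'h by (metis inner_eq_zero_iff inner_ge_zero order_antisym)
  then have "S = T" for S T :: "'h \<Rightarrow>\<^sub>L 'h" by (intro blinfun_eqI) metis
  then show ?thesis by blast
qed (simp add: geometric_mean_def)

context
  fixes P Q S S' C :: "'h::complex_hilbert_space \<Rightarrow>\<^sub>L 'h"
  assumes P: "positive_definite P" and Q: "positive_definite Q"
  defines "S \<equiv> op_powr P (1/2)" and "S' \<equiv> op_powr P (-1/2)"
    and "C \<equiv> op_powr P (-1/2) o\<^sub>L Q o\<^sub>L op_powr P (-1/2)"
begin

lemma
  shows sqrt_pd: "positive_definite S" and inverse_sqrt_pd: "positive_definite S'"
    and sqrt_self_adjoint: "self_adjoint S" and inverse_sqrt_self_adjoint: "self_adjoint S'"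
    and quotient_pd: "positive_definite C"
  using op_powr_positive_definite[OF P] positive_definite_sandwich[OF Q]
  by (auto simp: S_def S'_def C_def positive_definite_self_adjoint)

lemma sqrt_sqrt: "S (S x) = P x" and sqrt_inverse_sqrt: "S (S' x) = x" and inverse_sqrt_sqrt: "S' (S x) = x"
  using op_powr_half_sqrt[OF P] by (simp_all add: S_def S'_def)

lemma quotient_apply: "C x = S' (Q (S' x))"
  by (simp add: C_def S'_def)

lemma inner_via_sqrt: "inner (P x) x = inner (S x) (S x)"
  by (simp add: sqrt_sqrt[symmetric] self_adjoint_inner[OF sqrt_self_adjoint])

lemma inner_via_quotient: "inner (Q x) x = inner (C (S x)) (S x)"
  by (simp add: quotient_apply inverse_sqrt_sqrt self_adjoint_inner[OF inverse_sqrt_self_adjoint])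

lemma inner_geometric_mean:
  "inner (geometric_mean \<alpha> P Q x) x = inner (op_powr C \<alpha> (S x)) (S x)"
  unfolding geometric_mean_positive_definite_eq[OF P]
  by (simp add: self_adjoint_inner[OF sqrt_self_adjoint, unfolded S_def] S_def C_def)

lemma geometric_mean_positive_definite: "positive_definite (geometric_mean \<alpha> P Q)"
  unfolding geometric_mean_positive_definite_eq[OF P]
  using positive_definite_sandwich[OF op_powr_positive_definite[OF quotient_pd] sqrt_pd]
  by (simp add: S_def C_def)

text \<open>The bounds \<open>s P \<le> Q \<le> t P\<close> confine the spectrum of \<open>C = P\<^sup>-\<^sup>1\<^sup>/\<^sup>2 Q P\<^sup>-\<^sup>1\<^sup>/\<^sup>2\<close> to \<open>[s, t]\<close>, so the operator
  inequality reduces to a scalar one there.\<close>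

lemma arithmetic_le_geometric_mean:
  assumes s: "0 < s" and sP: "\<And>x. s * inner (P x) x \<le> inner (Q x) x"
    and tP: "\<And>x. inner (Q x) x \<le> t * inner (P x) x"
    and le: "\<And>x. s \<le> x \<Longrightarrow> x \<le> t \<Longrightarrow> (1 - \<alpha>) + \<alpha> * x \<le> k * x powr \<alpha>"
  shows "inner (((1 - \<alpha>) *\<^sub>R P + \<alpha> *\<^sub>R Q) x) x \<le> k * inner (geometric_mean \<alpha> P Q x) x"
proof -
  have Cst: "form_between s t C"
    unfolding form_between_def
  proof (intro conjI allI)
    show "self_adjoint C" by (rule positive_definite_self_adjoint[OF quotient_pd])
    show "s * inner y y \<le> inner (C y) y" "inner (C y) y \<le> t * inner y y" for y
      using sP[of "S' y"] tP[of "S' y"] unfolding inner_via_sqrt inner_via_quotient sqrt_inverse_sqrt .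
  qed
  have powr: "continuous_on {s..t} (\<lambda>x. x powr \<alpha>)"
    using s by (intro continuous_on_subset[OF continuous_on_powr_pos]) auto
  have "inner (cfc (\<lambda>x. \<alpha> * x + (1 - \<alpha>)) C y) y \<le> inner (cfc (\<lambda>x. k * x powr \<alpha> + 0) C y) y" for y
    by (rule cfc_mono[OF Cst]) (use le in \<open>auto intro!: continuous_intros powr simp: add.commute\<close>)
  then have "inner ((\<alpha> *\<^sub>R C + (1 - \<alpha>) *\<^sub>R id_blinfun) y) y \<le> inner ((k *\<^sub>R op_powr C \<alpha>) y) y" for y
    unfolding cfc_linear[OF Cst powr] cfc_linear[OF Cst continuous_on_id] cfc_ident[OF Cst] op_powr_def
    by simp
  from this[of "S x"] show ?thesis
    unfolding inner_geometric_mean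
    by (simp add: blinfun.bilinear_simps inner_add_left inner_via_sqrt inner_via_quotient algebra_simps)
qed

text \<open>The hypothesis says that \<open>G\<close> lies below the weighted harmonic mean of \<open>P\<close> and \<open>Q\<close>, expressed through
  inverses. In the coordinates given by \<open>P\<^sup>1\<^sup>/\<^sup>2\<close> that mean is \<open>1 / ((1 - \<alpha>) + \<alpha> / x)\<close> at \<open>x = C\<close>, and
  this scalar is at most \<open>x powr \<alpha>\<close> by the inequality between the weighted means.\<close>

lemma harmonic_le_geometric_mean:
  fixes G G' P' Q' :: "'h \<Rightarrow>\<^sub>L 'h"
  assumes \<alpha>: "0 \<le> \<alpha>" "\<alpha> \<le> 1"
    and P': "\<And>x. P (P' x) = x" and Q': "\<And>x. Q (Q' x) = x" and G': "\<And>x. G' (G x) = x"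
    and concave: "\<And>x. (1 - \<alpha>) * inner (P' x) x + \<alpha> * inner (Q' x) x \<le> inner (G' x) x"
  shows "inner (G x) x \<le> inner (geometric_mean \<alpha> P Q x) x"
proof -
  define h where "h = (\<lambda>x::real. (1 - \<alpha>) + \<alpha> * (1 / x))"
  have h_pos: "0 < h x" if "0 < x" for x
  proof (cases "\<alpha> = 0")
    case False
    then have "0 < \<alpha> * (1 / x)" using \<alpha> that by simp
    then show ?thesis using \<alpha> unfolding h_def by linarith
  qed (simp add: h_def)
  have inv: "continuous_on {0<..} (\<lambda>x::real. 1 / x)" by (intro continuous_intros) auto
  have h_cont: "continuous_on {0<..} h" unfolding h_def by (intro continuous_intros inv)
  have h_recip: "1 / h x \<le> x powr \<alpha>" if "0 < x" for x
  proof -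
    have "(1 / x) powr \<alpha> \<le> h x"
      using powr_le_arithmetic_mean[OF \<alpha>, of "1 / x"] that by (simp add: h_def)
    then have "1 / x powr \<alpha> \<le> h x" using that by (simp add: powr_divide)
    then show ?thesis using that h_pos[OF that] by (simp add: field_simps)
  qed
  let ?C' = "cfc (\<lambda>x. 1 / x) C"
  have CC': "C (?C' x) = x" "?C' (C x) = x" for x
    using pd_cfc_reciprocal[OF quotient_pd continuous_on_id] by (simp_all add: pd_cfc_ident[OF quotient_pd])
  have C'_eq: "S (Q' (S x)) = ?C' x" for x
  proof -
    have "C (S (Q' (S x))) = x" by (simp add: quotient_apply inverse_sqrt_sqrt Q')
    then show ?thesis by (metis CC'(2))
  qed
  have P'_eq: "S (P' (S x)) = x" for x
    using sqrt_sqrt[of "P' (S x)"] P'[of "S x"] by (metis inverse_sqrt_sqrt)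
  have hC: "cfc h C x = (1 - \<alpha>) *\<^sub>R x + \<alpha> *\<^sub>R ?C' x" for x
    using pd_cfc_linear[OF quotient_pd inv, of \<alpha> "1 - \<alpha>"]
    by (simp add: h_def add.commute blinfun.bilinear_simps)
  \<comment> \<open>Compare inverses: \<open>h(C) \<le> S G' S\<close> gives \<open>S' G S' \<le> h(C)\<^sup>-\<^sup>1\<close>.\<close>
  have "inner (S' (G (S' y))) y \<le> inner (cfc (\<lambda>x. 1 / h x) C y) y" for y
  proof (rule inverse_antitone)
    show "positive_op (cfc h C)"
      using pd_cfc_positive_definite[OF quotient_pd h_cont h_pos] by (simp add: positive_definite_def)
    show "inner (cfc h C z) z \<le> inner ((S o\<^sub>L G' o\<^sub>L S) z) z" for z
    proof -
      have "inner (cfc h C z) z = (1 - \<alpha>) * inner (S (P' (S z))) z + \<alpha> * inner (S (Q' (S z))) z"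
        by (simp add: hC P'_eq C'_eq inner_add_left)
      also have "\<dots> \<le> inner (G' (S z)) (S z)"
        using concave[of "S z"] by (simp add: self_adjoint_inner[OF sqrt_self_adjoint])
      finally show ?thesis by (simp add: self_adjoint_inner[OF sqrt_self_adjoint])
    qed
    show "cfc h C (cfc (\<lambda>x. 1 / h x) C y) = y"
      by (rule pd_cfc_reciprocal[OF quotient_pd h_cont h_pos])
    show "(S o\<^sub>L G' o\<^sub>L S) (S' (G (S' y))) = y" by (simp add: sqrt_inverse_sqrt G')
  qed
  also have "inner (cfc (\<lambda>x. 1 / h x) C y) y \<le> inner (op_powr C \<alpha> y) y" for y
    unfolding op_powr_def
  proof (rule pd_cfc_mono[OF quotient_pd _ continuous_on_powr_pos h_recip])
    show "continuous_on {0<..} (\<lambda>x. 1 / h x)"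
      using h_pos by (intro continuous_intros h_cont) (auto simp: less_imp_neq[symmetric])
  qed
  finally have "inner (S' (G (S' (S x)))) (S x) \<le> inner (op_powr C \<alpha> (S x)) (S x)" .
  then show ?thesis
    unfolding inner_geometric_mean by (simp add: inverse_sqrt_sqrt self_adjoint_inner[OF inverse_sqrt_self_adjoint])
qed

text \<open>The tangent line of \<open>x powr \<alpha>\<close> at \<open>\<lambda> = \<langle>Q \<xi>, \<xi>\<rangle> / \<langle>P \<xi>, \<xi>\<rangle>\<close> lies above this
  concave function. At \<open>C\<close>, with the vector \<open>P\<^sup>1\<^sup>/\<^sup>2 \<xi>\<close>, its form is \<open>\<lambda> powr \<alpha> * \<langle>P \<xi>, \<xi>\<rangle>\<close>, which is the bound.\<close>

lemma inner_geometric_mean_le: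
  assumes \<alpha>: "0 \<le> \<alpha>" "\<alpha> \<le> 1"
  shows "inner (geometric_mean \<alpha> P Q \<xi>) \<xi> \<le> inner (P \<xi>) \<xi> powr (1 - \<alpha>) * inner (Q \<xi>) \<xi> powr \<alpha>"
proof (cases "\<xi> = 0")
  case False
  define v where "v = inner (P \<xi>) \<xi>"
  define u where "u = inner (Q \<xi>) \<xi>"
  have pos: "0 < inner (T \<xi>) \<xi>" if "positive_definite T" for T
  proof -
    obtain c where "0 < c" "\<And>x. c * inner x x \<le> inner (T x) x"
      using \<open>positive_definite T\<close> by (auto simp: positive_definite_iff_coercive)
    moreover have "0 < inner \<xi> \<xi>" using False by simp
    ultimately show ?thesis by (meson less_le_trans mult_pos_pos)
  qed
  have uv: "0 < u" "0 < v" using pos P Q by (simp_all add: u_def v_def)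
  define l where "l = u / v"
  have l: "0 < l" using uv by (simp add: l_def)
  have "x powr \<alpha> \<le> (l powr \<alpha> * \<alpha> / l) * x + l powr \<alpha> * (1 - \<alpha>)" if "0 < x" for x
  proof -
    have "x powr \<alpha> = l powr \<alpha> * (x / l) powr \<alpha>" using l that by (simp add: powr_divide)
    also have "\<dots> \<le> l powr \<alpha> * ((1 - \<alpha>) + \<alpha> * (x / l))"
      using powr_le_arithmetic_mean[OF \<alpha>, of "x / l"] l that by (intro mult_left_mono) auto
    finally show ?thesis by (simp add: algebra_simps)
  qed
  then have "inner (op_powr C \<alpha> y) y
      \<le> inner (cfc (\<lambda>x. (l powr \<alpha> * \<alpha> / l) * x + l powr \<alpha> * (1 - \<alpha>)) C y) y" for y
    unfolding op_powr_def
    by (intro pd_cfc_mono[OF quotient_pd continuous_on_powr_pos]) (auto intro!: continuous_intros)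
  from this[of "S \<xi>"] have "inner (geometric_mean \<alpha> P Q \<xi>) \<xi> \<le> l powr \<alpha> * \<alpha> / l * u + l powr \<alpha> * (1 - \<alpha>) * v"
    unfolding inner_geometric_mean pd_cfc_linear[OF quotient_pd continuous_on_id] pd_cfc_ident[OF quotient_pd]
    by (simp add: blinfun.bilinear_simps inner_add_left u_def v_def inner_via_sqrt inner_via_quotient)
  also have "\<dots> = l powr \<alpha> * v"
    using uv by (simp add: l_def field_simps)
  also have "\<dots> = v powr (1 - \<alpha>) * u powr \<alpha>"
    using uv by (simp add: l_def powr_divide powr_diff field_simps)
  finally show ?thesis by (simp add: u_def v_def)
qed simp

end

section \<open>The complementary inequality\<close>

text \<open>With \<open>M\<close> the geometric and \<open>Z\<close> the arithmetic mean of \<open>X\<close> and \<open>Y\<close>, the scalar hypothesis gives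
  \<open>Z \<le> k M\<close>, and the bound is the chain \<open>g(M) \<le> k g(k M) \<le> k g(Z) \<le> k (g(X) \<sharp> g(Y))\<close>.\<close>

lemma complementary_geometric_mean_inequality:
  fixes X Y :: "'h::complex_hilbert_space \<Rightarrow>\<^sub>L 'h"
  assumes g: "operator_monotone_decreasing g" and g_pos: "\<And>x. 0 < x \<Longrightarrow> 0 < g x"
    and X: "positive_definite X" and Y: "positive_definite Y" and \<alpha>: "0 \<le> \<alpha>" "\<alpha> \<le> 1"
    and s: "0 < s" and sX: "\<And>x. s * inner (X x) x \<le> inner (Y x) x"
    and tX: "\<And>x. inner (Y x) x \<le> t * inner (X x) x"
    and k: "1 \<le> k" and le: "\<And>x. s \<le> x \<Longrightarrow> x \<le> t \<Longrightarrow> (1 - \<alpha>) + \<alpha> * x \<le> k * x powr \<alpha>"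
  shows "inner (cfc g (geometric_mean \<alpha> X Y) \<xi>) \<xi>
    \<le> k * inner (geometric_mean \<alpha> (cfc g X) (cfc g Y) \<xi>) \<xi>"
proof -
  define M where "M = geometric_mean \<alpha> X Y"
  define Z where "Z = (1 - \<alpha>) *\<^sub>R X + \<alpha> *\<^sub>R Y"
  have cont: "continuous_on {0<..} g" using g by (simp add: operator_monotone_decreasing_def)
  have M: "positive_definite M" unfolding M_def by (rule geometric_mean_positive_definite[OF X Y])
  have Z: "positive_definite Z" unfolding Z_def by (rule positive_definite_convex_combination[OF X Y \<alpha>])
  have k0: "0 < k" using k by simp
  have kM: "positive_definite (k *\<^sub>R M)" by (rule positive_definite_scaleR[OF M k0])
  note gX = pd_cfc_positive_definite[OF X cont g_pos] and gY = pd_cfc_positive_definite[OF Y cont g_pos]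
  have scaled: "continuous_on {0<..} (\<lambda>x. g (k * x))"
    by (rule continuous_on_compose2[OF cont]) (use k0 in \<open>auto intro!: continuous_intros\<close>)
  have "inner (cfc g M \<xi>) \<xi> \<le> inner (cfc (\<lambda>x. k * g (k * x) + 0) M \<xi>) \<xi>"
    by (rule pd_cfc_mono[OF M cont])
      (use operator_monotone_decreasing_scaling_pos[OF g g_pos _ k] in \<open>auto intro!: continuous_intros scaled\<close>)
  also have "\<dots> = k * inner (cfc g (k *\<^sub>R M) \<xi>) \<xi>"
    unfolding pd_cfc_linear[OF M scaled] pd_cfc_scale[OF M cont k0] by (simp add: blinfun.bilinear_simps)
  also have "\<dots> \<le> k * inner (cfc g Z \<xi>) \<xi>"
  proof -
    have "Z \<preceq> k *\<^sub>R M"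
      using arithmetic_le_geometric_mean[OF X Y s sX tX le] Z kM
      by (simp add: op_le_iff positive_definite_self_adjoint Z_def M_def blinfun.bilinear_simps)
    then show ?thesis
      using operator_monotone_decreasing_transfer[OF g kM Z] k0 by simp
  qed
  also have "\<dots> \<le> k * inner (geometric_mean \<alpha> (cfc g X) (cfc g Y) \<xi>) \<xi>"
  proof (intro mult_left_mono)
    show "inner (cfc g Z \<xi>) \<xi> \<le> inner (geometric_mean \<alpha> (cfc g X) (cfc g Y) \<xi>) \<xi>"
    proof (rule harmonic_le_geometric_mean[OF gX gY \<alpha>])
      show "cfc g X (cfc (\<lambda>x. 1 / g x) X x) = x" "cfc g Y (cfc (\<lambda>x. 1 / g x) Y x) = x"
        "cfc (\<lambda>x. 1 / g x) Z (cfc g Z x) = x" for x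
        using pd_cfc_reciprocal[OF _ cont g_pos] X Y Z by simp_all
      show "(1 - \<alpha>) * inner (cfc (\<lambda>x. 1 / g x) X x) x + \<alpha> * inner (cfc (\<lambda>x. 1 / g x) Y x) x
          \<le> inner (cfc (\<lambda>x. 1 / g x) Z x) x" for x
        unfolding Z_def by (rule reciprocal_operator_concave[OF g g_pos X Y \<alpha>])
    qed
  qed (use k0 in simp)
  finally show ?thesis by (simp add: M_def)
qed

theorem theorem2p6:
  fixes g :: "real \<Rightarrow> real"
    and p q s t R :: real
    and A B :: "'h::complex_hilbert_space \<Rightarrow>\<^sub>L 'h"
  assumes "operator_monotone_decreasing g"
    and "\<And>x. 0 < x \<Longrightarrow> 0 \<le> g x"
    and "1 < p" and "1 < q" and "1 / p + 1 / q = 1"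
    and "positive_definite A" and "positive_definite B"
    and "0 < s" and "0 < t"
    and "positive_definite (s *\<^sub>R op_powr A p)"
    and "s *\<^sub>R op_powr A p \<preceq> op_powr B q"
    and "op_powr B q \<preceq> t *\<^sub>R op_powr A p"
    and "R = max (1 / p) (1 / q)"
  shows "cfc g (geometric_mean (1 / q) (op_powr A p) (op_powr B q))
           \<preceq> max (kantorovich s powr R) (kantorovich t powr R)
               *\<^sub>R geometric_mean (1 / q) (cfc g (op_powr A p)) (cfc g (op_powr B q))
       \<and> (\<forall>\<xi>. Re (cinner (cfc g (geometric_mean (1 / q) (op_powr A p) (op_powr B q)) \<xi>) \<xi>)
           \<le> max (kantorovich s powr R) (kantorovich t powr R)
               * Re (cinner (cfc g (op_powr A p) \<xi>) \<xi>) powr (1 / p)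
               * Re (cinner (cfc g (op_powr B q) \<xi>) \<xi>) powr (1 / q))"
proof -
  define X where "X = op_powr A p"
  define Y where "Y = op_powr B q"
  define \<alpha> where "\<alpha> = 1 / q"
  define k where "k = max (kantorovich s powr R) (kantorovich t powr R)"
  have \<alpha>: "0 \<le> \<alpha>" "\<alpha> \<le> 1" "1 / p = 1 - \<alpha>" and R: "R = max (1 - \<alpha>) \<alpha>"
    using assms(3-5,13) by (auto simp: \<alpha>_def)
  have X: "positive_definite X" and Y: "positive_definite Y"
    using assms(6,7) by (simp_all add: X_def Y_def op_powr_positive_definite)
  note M = geometric_mean_positive_definite[OF X Y, of \<alpha>]
  have cont: "continuous_on {0<..} g" using assms(1) by (simp add: operator_monotone_decreasing_def)
  have R0: "0 \<le> R" using \<alpha> by (simp add: R)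
  have k1: "1 \<le> k"
    using ge_one_powr_ge_zero[OF kantorovich_ge_1[OF assms(8)] R0] by (simp add: k_def)
  have le: "(1 - \<alpha>) + \<alpha> * x \<le> k * x powr \<alpha>" if x: "s \<le> x" "x \<le> t" for x
  proof -
    have x0: "0 < x" using x assms(8) by simp
    have "kantorovich x \<le> kantorovich s \<or> kantorovich x \<le> kantorovich t"
      using kantorovich_le_endpoints[OF assms(8) x] by (simp add: le_max_iff_disj)
    then have "kantorovich x powr R \<le> k"
      using powr_mono2[OF R0, of "kantorovich x"] kantorovich_ge_1[OF x0]
      by (auto simp: k_def le_max_iff_disj)
    then have "kantorovich x powr R * x powr \<alpha> \<le> k * x powr \<alpha>" by (intro mult_right_mono) auto
    then show ?thesis using reverse_Young_kantorovich[OF x0 \<alpha>(1,2)] by (simp add: R)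
  qed
  show ?thesis
    unfolding X_def[symmetric] Y_def[symmetric] \<alpha>_def[symmetric] k_def[symmetric] Re_cinner \<alpha>(3)
  proof (cases "\<exists>z>0. g z = 0")
    case True
    \<comment> \<open>Then \<open>g\<close> vanishes identically and the convention that the mean of \<open>0\<close> and \<open>0\<close> is \<open>0\<close> applies.\<close>
    then have "g x = 0" if "0 < x" for x
      using operator_monotone_decreasing_vanishing[OF assms(1,2)] that by blast
    then have zero: "cfc g T = 0" if "positive_definite T" for T :: "'h \<Rightarrow>\<^sub>L 'h"
      using pd_cfc_cong[OF that, of g "\<lambda>_. 0"] pd_cfc_const[OF that, of 0] by simp
    show "cfc g (geometric_mean \<alpha> X Y) \<preceq> k *\<^sub>R geometric_mean \<alpha> (cfc g X) (cfc g Y) \<and>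
      (\<forall>\<xi>. inner (cfc g (geometric_mean \<alpha> X Y) \<xi>) \<xi>
        \<le> k * inner (cfc g X \<xi>) \<xi> powr (1 - \<alpha>) * inner (cfc g Y \<xi>) \<xi> powr \<alpha>)"
    proof -
      have "geometric_mean \<alpha> (cfc g X) (cfc g Y) = 0"
        by (simp add: zero X Y geometric_mean_def)
      then show ?thesis by (simp add: zero X Y M op_le_iff)
    qed
  next
    case False
    then have g_pos: "0 < g x" if "0 < x" for x
      using assms(2)[OF that] that by (metis less_eq_real_def)
    have "s * inner (X x) x \<le> inner (Y x) x" "inner (Y x) x \<le> t * inner (X x) x" for x
      using assms(11,12) by (simp_all add: op_le_iff X_def Y_def blinfun.bilinear_simps)
    then have main: "inner (cfc g (geometric_mean \<alpha> X Y) \<xi>) \<xi>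
        \<le> k * inner (geometric_mean \<alpha> (cfc g X) (cfc g Y) \<xi>) \<xi>" for \<xi>
      by (intro complementary_geometric_mean_inequality[OF assms(1) g_pos X Y \<alpha>(1,2) assms(8) _ _ k1 le])
    note gX = pd_cfc_positive_definite[OF X cont g_pos] and gY = pd_cfc_positive_definite[OF Y cont g_pos]
    note gM = pd_cfc_positive_definite[OF M cont g_pos] and gm = geometric_mean_positive_definite[OF gX gY, of \<alpha>]
    have "k * inner (geometric_mean \<alpha> (cfc g X) (cfc g Y) \<xi>) \<xi>
        \<le> k * (inner (cfc g X \<xi>) \<xi> powr (1 - \<alpha>) * inner (cfc g Y \<xi>) \<xi> powr \<alpha>)" for \<xi>
      by (rule mult_left_mono[OF inner_geometric_mean_le[OF gX gY \<alpha>(1,2)]]) (use k1 in simp_all)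
    from order_trans[OF main this] main
    show "cfc g (geometric_mean \<alpha> X Y) \<preceq> k *\<^sub>R geometric_mean \<alpha> (cfc g X) (cfc g Y) \<and>
      (\<forall>\<xi>. inner (cfc g (geometric_mean \<alpha> X Y) \<xi>) \<xi>
        \<le> k * inner (cfc g X \<xi>) \<xi> powr (1 - \<alpha>) * inner (cfc g Y \<xi>) \<xi> powr \<alpha>)"
      by (simp add: op_le_iff positive_definite_self_adjoint[OF gM] mult.assoc
          self_adjoint_scaleR[OF positive_definite_self_adjoint[OF gm]] blinfun.bilinear_simps)
  qed
qed

end
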